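(* Let $P_\epsilon$, $\epsilon\in\mathbb{R}$, be a generic 1-parameter unfolding of a generic Poisson structure $P$ (i.e. $P_0=P$) on $\mathbb{R}^3$ having an $A$ singularity at the origin. Then the following bifurcation (up to the change $\epsilon\to-\epsilon$) holds in a neighbourhood of the origin $U\subset\mathbb{R}^3$ and in a neighbourhood of the origin $W\subset\mathbb{R}$. If $\epsilon\in W$ and $\epsilon<0$ then $U$ contains no singular points of $P_\epsilon$; if $\epsilon\in W$ and $\epsilon>0$ then $U$ contains two singular points of $P_\epsilon$. If the singularity of $P$ has the type $A^+$ then one of these singular points is a $so(3)$ singularity and the other is a $sl(2)$ singularity. If the singularity of $P$ has the type $A^-$ then the two singular points are $sl(2)$ singularities.
   Context: All objects are of class $C^\infty$ and all families depend smoothly on $\epsilon$, which varies near $0$. A Poisson structure in coordinates $x,y,z$ is identified with the bivector field $P=\{x,y\}\,\partial_x\wedge\partial_y+\{y,z\}\,\partial_y\wedge\partial_z+\{z,x\}\,\partial_z\wedge\partial_x$. A singular point is a point where the Poisson structure vanishes. Singularity classes. Let $P$ be a germ at the origin of a Poisson structure with $P(0)=0$, $j^1_0P\neq0$, and $j^1_0P$ not isomorphic (under linear changes of coordinates) to the linear Poisson structure $\{x,y\}=0,\ \{y,z\}=y,\ \{z,x\}=-x$. Then there are smooth local coordinates followed by a formal change of coordinates, preserving the origin, in which (the Taylor series of) $P$ has the form $$\{x,y\}=z,\quad \{y,z\}=\frac{\partial \hat f}{\partial x}+z\frac{\partial \hat g}{\partial x},\quad \{z,x\}=\frac{\partial \hat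 f}{\partial y}+z\frac{\partial \hat g}{\partial y},$$ with formal power series $\hat f(x,y)$, $\hat g(x,y)$, $\hat f(0)=\hat g(0)=0$, $d\hat f\wedge d\hat g\equiv0$. R-equivalence of (jets of) series means equivalence under changes of coordinates $(x,y)$ in the source fixing the origin. $P$ has at the origin: - a $so(3)$ singularity if $j^2_0\hat f$ is R-equivalent to $x^2+y^2$; - a $sl(2)$ singularity if $j^2_0\hat f$ is R-equivalent to $x^2-y^2$ or to $-x^2-y^2$; - an $A^+$ (resp. $A^-$) singularity if $j^2_0\hat f$ is R-equivalent to $x^2$ (resp. $-x^2$) and $j^1_0\hat g=0$. An $A$ singularity is either an $A^+$ or an $A^-$ singularity. The type of singularity at another singular point is defined by translating that point to the origin. Genericity. An $A$ singularity is algebraically isolated (the quotient of $\mathbb{R}[[x,y,z]]$ by the ideal generated by the Taylor series of $\{x,y\},\{y,z\},\{z,x\}$ is finite dimensional over $\mathbb{R}$) if and only if $\hat f$ is R-equivalent to $\pm x^2\pm y^{m+1}$ for some $m\geq2$; it is called generic if $m=2$. Any 1-parameter unfolding $P_\epsilon$ of a Poisson structure with a generic $A$ singularity at the origin can be brought, by a smooth family of smooth coordinate changes, to the form $$H_\epsilon(x,y,z)\left(z\frac{\partial}{\partial x}\wedge\frac{\partial}{\partial y}\pm x\frac{\partial}{\partial y}\wedge\frac{\partial}{\partial z}+(y^2+h_0(\epsilon))\frac{\partial}{\partial z}\wedge\frac{\partial}{\partial x}\right)$$ modulo a bivector field flat (all derivatives vanishing) at a point $p_0$. Here, in suitable initial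 smooth coordinates (depending on $\epsilon$) in which $P_\epsilon$ has the form $\{x,y\}=z,\ \{y,z\}=U_\epsilon,\ \{z,x\}=V_\epsilon$, the point $p_0$ is the origin of these initial coordinates; moreover $H_0(0)>0$, $h_0(0)=0$, and the sign $+$ (resp. $-$) corresponds to $A^+$ (resp. $A^-$). The unfolding is called generic if $h_0'(0)\neq0$. *)

theory Defs
  imports "HOL-Analysis.Analysis"
begin

section \<open>Smooth maps\<close>

definition dir_deriv :: "'a::real_normed_vector \<Rightarrow> ('a \<Rightarrow> 'b::real_normed_vector) \<Rightarrow> 'a \<Rightarrow> 'b" where
  "dir_deriv v f = (\<lambda>x. frechet_derivative f (at x) v)"

fun C_k_on :: "nat \<Rightarrow> 'a::real_normed_vector set \<Rightarrow> ('a \<Rightarrow> 'b::real_normed_vector) \<Rightarrow> bool" where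
  "C_k_on 0 S f \<longleftrightarrow> continuous_on S f"
| "C_k_on (Suc k) S f \<longleftrightarrow> (\<forall>x\<in>S. f differentiable (at x)) \<and> (\<forall>v. C_k_on k S (dir_deriv v f))"

text \<open>The derivatives are taken in the whole space, so \<^const>\<open>C_k_on\<close> and \<open>smooth_on\<close> are meant
  for open \<open>S\<close> only; in finite dimension they are the usual notions there.\<close>

definition smooth_on :: "'a::real_normed_vector set \<Rightarrow> ('a \<Rightarrow> 'b::real_normed_vector) \<Rightarrow> bool" where
  "smooth_on S f \<longleftrightarrow> (\<forall>k. C_k_on k S f)"

definition flat_at :: "('a::real_normed_vector \<Rightarrow> 'b::real_normed_vector) \<Rightarrow> 'a \<Rightarrow> bool" where
  "flat_at f p \<longleftrightarrow> (\<forall>vs. fold dir_deriv vs f p = 0)"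

definition jacobian :: "(real^3 \<Rightarrow> real^3) \<Rightarrow> real^3 \<Rightarrow> real^3^3" where
  "jacobian \<psi> x = matrix (frechet_derivative \<psi> (at x))"

definition local_coordinates :: "(real^3) set \<Rightarrow> (real^3 \<Rightarrow> real^3) \<Rightarrow> bool" where
  "local_coordinates N \<psi> \<longleftrightarrow>
     open N \<and> smooth_on N \<psi> \<and> inj_on \<psi> N \<and> (\<forall>x\<in>N. invertible (jacobian \<psi> x))"


section \<open>Poisson structures on \<open>\<real>\<^sup>3\<close>\<close>

definition skew3 :: "'a::group_add \<Rightarrow> 'a \<Rightarrow> 'a \<Rightarrow> 3 \<Rightarrow> 3 \<Rightarrow> 'a" where
  "skew3 a b c i j =
     (if i = 1 \<and> j = 2 then a else if i = 2 \<and> j = 1 then - a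
      else if i = 2 \<and> j = 3 then b else if i = 3 \<and> j = 2 then - b
      else if i = 3 \<and> j = 1 then c else if i = 1 \<and> j = 3 then - c
      else 0)"

text \<open>A bivector field \<open>P\<close> is represented by its skew-symmetric matrix of brackets of coordinates:
  \<open>P x $ i $ j\<close> is the value of \<open>{x\<^sub>i, x\<^sub>j}\<close> at \<open>x\<close>. Thus \<open>bivector a b c\<close> is the bivector with
  \<open>{x,y} = a\<close>, \<open>{y,z} = b\<close>, \<open>{z,x} = c\<close>, where \<open>x, y, z\<close> are the coordinates with indices
  \<open>1, 2, 3\<close>.\<close>

definition bivector :: "real \<Rightarrow> real \<Rightarrow> real \<Rightarrow> real^3^3" where
  "bivector a b c = (\<chi> i j. skew3 a b c i j)"

definition bracket :: "(real^3 \<Rightarrow> real^3^3) \<Rightarrow> (real^3 \<Rightarrow> real) \<Rightarrow> (real^3 \<Rightarrow> real) \<Rightarrow> real^3 \<Rightarrow> real" where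
  "bracket P f g x =
     (\<Sum>i\<in>UNIV. \<Sum>j\<in>UNIV. P x $ i $ j * dir_deriv (axis i 1) f x * dir_deriv (axis j 1) g x)"

definition poisson_structure :: "(real^3 \<Rightarrow> real^3^3) \<Rightarrow> bool" where
  "poisson_structure P \<longleftrightarrow>
     smooth_on UNIV P \<and>
     (\<forall>x. transpose (P x) = - P x) \<and>
     (\<forall>f g h. smooth_on UNIV f \<longrightarrow> smooth_on UNIV g \<longrightarrow> smooth_on UNIV h \<longrightarrow>
        (\<forall>x. bracket P f (bracket P g h) x + bracket P g (bracket P h f) x
              + bracket P h (bracket P f g) x = 0))"

definition singular_point :: "(real^3 \<Rightarrow> real^3^3) \<Rightarrow> real^3 \<Rightarrow> bool" where
  "singular_point P p \<longleftrightarrow> P p = 0"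

text \<open>\<open>Q\<close> is the expression of \<open>P\<close> in the coordinates \<open>\<psi>\<close>, i.e. the push-forward of \<open>P\<close>.\<close>

definition in_coordinates ::
    "(real^3) set \<Rightarrow> (real^3 \<Rightarrow> real^3) \<Rightarrow> (real^3 \<Rightarrow> real^3^3) \<Rightarrow> (real^3 \<Rightarrow> real^3^3) \<Rightarrow> bool" where
  "in_coordinates N \<psi> P Q \<longleftrightarrow>
     (\<forall>x\<in>N. Q (\<psi> x) = jacobian \<psi> x ** P x ** transpose (jacobian \<psi> x))"

definition linear_isomorphic :: "(real^3 \<Rightarrow> real^3^3) \<Rightarrow> (real^3 \<Rightarrow> real^3^3) \<Rightarrow> bool" where
  "linear_isomorphic L L' \<longleftrightarrow>
     (\<exists>A::real^3^3. invertible A \<and> (\<forall>x. L' (A *v x) = A ** L x ** transpose A))"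

text \<open>The standing conditions on a germ under which a normal form exists.
  When \<open>P 0 = 0\<close>, the 1-jet of \<open>P\<close> at \<open>0\<close> is its derivative there.\<close>

definition admissible_germ :: "(real^3 \<Rightarrow> real^3^3) \<Rightarrow> bool" where
  "admissible_germ P \<longleftrightarrow>
     P 0 = 0 \<and>
     frechet_derivative P (at 0) \<noteq> (\<lambda>x. 0) \<and>
     \<not> linear_isomorphic (frechet_derivative P (at 0)) (\<lambda>x. bivector 0 (x $ 2) (- (x $ 1)))"


section \<open>Formal power series in several variables\<close>

text \<open>Real formal power series in variables indexed by \<open>'n\<close>; the exponent of a monomial is a
  function \<open>'n \<Rightarrow> nat\<close>.\<close>

typedef 'n pseries = "UNIV :: (('n \<Rightarrow> nat) \<Rightarrow> real) set"
  morphisms ps_coeff PSeries by simp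

lemma pseries_eqI: "(\<And>\<alpha>. ps_coeff F \<alpha> = ps_coeff G \<alpha>) \<Longrightarrow> F = G"
  by (metis ext ps_coeff_inject)

lemma ps_coeff_PSeries [simp]: "ps_coeff (PSeries a) = a"
  by (simp add: PSeries_inverse)

lemma finite_exponents_le [simp]: "finite {\<beta> :: 'n::finite \<Rightarrow> nat. \<forall>i. \<beta> i \<le> \<alpha> i}"
proof -
  have "{\<beta>. \<forall>i. \<beta> i \<le> \<alpha> i} \<subseteq> (\<Pi>\<^sub>E i\<in>UNIV. {..\<alpha> i})"
    by auto
  moreover have "finite (\<Pi>\<^sub>E i\<in>(UNIV :: 'n set). {..\<alpha> i})"
    by (intro finite_PiE) auto
  ultimately show ?thesis
    by (rule finite_subset)
qed

instantiation pseries :: (finite) comm_ring_1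
begin

definition zero_pseries :: "'a pseries" where
  "0 = PSeries (\<lambda>\<alpha>. 0)"

definition one_pseries :: "'a pseries" where
  "1 = PSeries (\<lambda>\<alpha>. if \<alpha> = (\<lambda>_. 0) then 1 else 0)"

definition plus_pseries :: "'a pseries \<Rightarrow> 'a pseries \<Rightarrow> 'a pseries" where
  "F + G = PSeries (\<lambda>\<alpha>. ps_coeff F \<alpha> + ps_coeff G \<alpha>)"

definition minus_pseries :: "'a pseries \<Rightarrow> 'a pseries \<Rightarrow> 'a pseries" where
  "F - G = PSeries (\<lambda>\<alpha>. ps_coeff F \<alpha> - ps_coeff G \<alpha>)"

definition uminus_pseries :: "'a pseries \<Rightarrow> 'a pseries" where
  "- F = PSeries (\<lambda>\<alpha>. - ps_coeff F \<alpha>)"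

definition times_pseries :: "'a pseries \<Rightarrow> 'a pseries \<Rightarrow> 'a pseries" where
  "F * G = PSeries (\<lambda>\<alpha>. \<Sum>\<beta> | \<forall>i. \<beta> i \<le> \<alpha> i. ps_coeff F \<beta> * ps_coeff G (\<lambda>i. \<alpha> i - \<beta> i))"

instance
proof
  fix F G H :: "'a pseries"
  show "F + G + H = F + (G + H)" "F + G = G + F" "0 + F = F" "- F + F = 0" "F - G = F + - G"
    by (auto simp: plus_pseries_def zero_pseries_def uminus_pseries_def minus_pseries_def
        intro!: pseries_eqI)
  show "(0 :: 'a pseries) \<noteq> 1"
  proof
    assume "(0 :: 'a pseries) = 1"
    then have "ps_coeff (0 :: 'a pseries) (\<lambda>_. 0) = ps_coeff 1 (\<lambda>_. 0)"
      by simp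
    then show False
      by (simp add: zero_pseries_def one_pseries_def)
  qed
  show "(F + G) * H = F * H + G * H"
    by (auto simp: plus_pseries_def times_pseries_def algebra_simps sum.distrib intro!: pseries_eqI)
  show "F * G = G * F"
  proof (rule pseries_eqI)
    fix \<alpha> :: "'a \<Rightarrow> nat"
    show "ps_coeff (F * G) \<alpha> = ps_coeff (G * F) \<alpha>"
      unfolding times_pseries_def ps_coeff_PSeries
      by (rule sum.reindex_bij_witness[where i = "\<lambda>\<beta> i. \<alpha> i - \<beta> i" and j = "\<lambda>\<beta> i. \<alpha> i - \<beta> i"])
        auto
  qed
  show "1 * F = F"
  proof (rule pseries_eqI)
    fix \<alpha> :: "'a \<Rightarrow> nat"
    have "ps_coeff (1 * F) \<alpha> =
        (\<Sum>\<beta> | \<forall>i. \<beta> i \<le> \<alpha> i. if \<beta> = (\<lambda>_. 0) then ps_coeff F (\<lambda>i. \<alpha> i - \<beta> i) else 0)"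
      unfolding times_pseries_def one_pseries_def ps_coeff_PSeries
      by (intro sum.cong) auto
    also have "\<dots> = ps_coeff F \<alpha>"
      by (subst sum.delta) auto
    finally show "ps_coeff (1 * F) \<alpha> = ps_coeff F \<alpha>" .
  qed
  show "F * G * H = F * (G * H)"
  proof (rule pseries_eqI)
    fix \<alpha> :: "'a \<Rightarrow> nat"
    let ?f = "ps_coeff F" and ?g = "ps_coeff G" and ?h = "ps_coeff H"
    have "ps_coeff (F * G * H) \<alpha> =
        (\<Sum>\<beta> | \<forall>i. \<beta> i \<le> \<alpha> i. \<Sum>\<gamma> | \<forall>i. \<gamma> i \<le> \<beta> i.
           ?f \<gamma> * ?g (\<lambda>i. \<beta> i - \<gamma> i) * ?h (\<lambda>i. \<alpha> i - \<beta> i))"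
      by (simp add: times_pseries_def sum_distrib_right)
    also have "\<dots> = (\<Sum>(\<beta>, \<gamma>) \<in> (SIGMA \<beta>:{\<beta>. \<forall>i. \<beta> i \<le> \<alpha> i}. {\<gamma>. \<forall>i. \<gamma> i \<le> \<beta> i}).
           ?f \<gamma> * ?g (\<lambda>i. \<beta> i - \<gamma> i) * ?h (\<lambda>i. \<alpha> i - \<beta> i))"
      by (subst sum.Sigma) auto
    also have "\<dots> = (\<Sum>(\<beta>, \<gamma>) \<in> (SIGMA \<beta>:{\<beta>. \<forall>i. \<beta> i \<le> \<alpha> i}. {\<gamma>. \<forall>i. \<gamma> i \<le> \<alpha> i - \<beta> i}).
           ?f \<beta> * (?g \<gamma> * ?h (\<lambda>i. \<alpha> i - \<beta> i - \<gamma> i)))"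
    proof (rule sum.reindex_bij_witness[where
            j = "\<lambda>(\<beta>, \<gamma>). (\<gamma>, \<lambda>i. \<beta> i - \<gamma> i)" and i = "\<lambda>(\<beta>, \<gamma>). (\<lambda>i. \<beta> i + \<gamma> i, \<beta>)"], goal_cases)
      case (1 a)
      then show ?case by auto
    next
      case (2 a)
      then show ?case
        by (auto simp: diff_le_mono intro: order_trans)
    next
      case (3 b)
      then show ?case by auto
    next
      case (4 b)
      then show ?case
        by (auto simp: add.commute Nat.le_diff_conv2 le_diff_conv)
    next
      case (5 a)
      then show ?case
        by (auto simp: mult.assoc)
    qed
    also have "\<dots> = (\<Sum>\<beta> | \<forall>i. \<beta> i \<le> \<alpha> i. \<Sum>\<gamma> | \<forall>i. \<gamma> i \<le> \<alpha> i - \<beta> i.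
           ?f \<beta> * (?g \<gamma> * ?h (\<lambda>i. \<alpha> i - \<beta> i - \<gamma> i)))"
      by (subst sum.Sigma) auto
    also have "\<dots> = ps_coeff (F * (G * H)) \<alpha>"
      by (simp add: times_pseries_def sum_distrib_left)
    finally show "ps_coeff (F * G * H) \<alpha> = ps_coeff (F * (G * H)) \<alpha>" .
  qed
qed

end

definition ps_var :: "'n \<Rightarrow> 'n pseries" where
  "ps_var i = PSeries (\<lambda>\<alpha>. if \<alpha> = (\<lambda>j. if j = i then 1 else 0) then 1 else 0)"

definition ps_const_term :: "'n pseries \<Rightarrow> real" where
  "ps_const_term F = ps_coeff F (\<lambda>_. 0)"

definition ps_linear_coeff :: "'n pseries \<Rightarrow> 'n \<Rightarrow> real" where
  "ps_linear_coeff F i = ps_coeff F (\<lambda>j. if j = i then 1 else 0)"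

definition ps_deriv :: "'n \<Rightarrow> 'n pseries \<Rightarrow> 'n pseries" where
  "ps_deriv i F = PSeries (\<lambda>\<alpha>. real (\<alpha> i + 1) * ps_coeff F (\<alpha>(i := \<alpha> i + 1)))"

definition ps_jet :: "nat \<Rightarrow> 'n::finite pseries \<Rightarrow> 'n pseries" where
  "ps_jet k F = PSeries (\<lambda>\<alpha>. if (\<Sum>i\<in>UNIV. \<alpha> i) \<le> k then ps_coeff F \<alpha> else 0)"

text \<open>Substitution of series \<open>\<Phi> i\<close> without constant term for the variables of \<open>F\<close>. Since
  \<open>\<Prod>i. \<Phi> i ^ \<beta> i\<close> only has terms of degree at least the degree of \<open>\<beta>\<close>, the finite sum below
  contains all contributions to the coefficient of index \<open>\<alpha>\<close>.\<close>

definition ps_compose :: "'m::finite pseries \<Rightarrow> ('m \<Rightarrow> 'n::finite pseries) \<Rightarrow> 'n pseries" where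
  "ps_compose F \<Phi> = PSeries (\<lambda>\<alpha>. \<Sum>\<beta> | (\<Sum>i\<in>UNIV. \<beta> i) \<le> (\<Sum>i\<in>UNIV. \<alpha> i).
     ps_coeff F \<beta> * ps_coeff (\<Prod>i\<in>UNIV. \<Phi> i ^ \<beta> i) \<alpha>)"

definition formal_change :: "('n::finite \<Rightarrow> 'n pseries) \<Rightarrow> bool" where
  "formal_change \<Phi> \<longleftrightarrow>
     (\<forall>i. ps_const_term (\<Phi> i) = 0) \<and>
     invertible ((\<chi> i j. ps_linear_coeff (\<Phi> i) j) :: real^'n^'n)"

definition R_equiv :: "'n::finite pseries \<Rightarrow> 'n pseries \<Rightarrow> bool" where
  "R_equiv F G \<longleftrightarrow> (\<exists>\<Phi>. formal_change \<Phi> \<and> ps_compose F \<Phi> = G)"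

definition jet_R_equiv :: "nat \<Rightarrow> 'n::finite pseries \<Rightarrow> 'n pseries \<Rightarrow> bool" where
  "jet_R_equiv k F G \<longleftrightarrow>
     (\<exists>\<Phi>. formal_change \<Phi> \<and> ps_jet k (ps_compose (ps_jet k F) \<Phi>) = ps_jet k G)"

definition taylor :: "(real^3 \<Rightarrow> real) \<Rightarrow> 3 pseries" where
  "taylor f = PSeries (\<lambda>\<alpha>.
     (dir_deriv (axis 1 1) ^^ \<alpha> 1) ((dir_deriv (axis 2 1) ^^ \<alpha> 2) ((dir_deriv (axis 3 1) ^^ \<alpha> 3) f)) 0
       / (fact (\<alpha> 1) * fact (\<alpha> 2) * fact (\<alpha> 3)))"

text \<open>Formal analogue of \<^const>\<open>in_coordinates\<close>: \<open>{\<Phi>\<^sub>i, \<Phi>\<^sub>j} = Q\<^sub>i\<^sub>j \<circ> \<Phi>\<close>, the bracket on the left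
  being that of \<open>P\<close>.\<close>

definition formal_in_coordinates ::
    "(3 \<Rightarrow> 3 pseries) \<Rightarrow> (3 \<Rightarrow> 3 \<Rightarrow> 3 pseries) \<Rightarrow> (3 \<Rightarrow> 3 \<Rightarrow> 3 pseries) \<Rightarrow> bool" where
  "formal_in_coordinates \<Phi> P Q \<longleftrightarrow>
     (\<forall>i j. ps_compose (Q i j) \<Phi> =
        (\<Sum>k\<in>UNIV. \<Sum>l\<in>UNIV. P k l * ps_deriv k (\<Phi> i) * ps_deriv l (\<Phi> j)))"


section \<open>Singularity classes\<close>

abbreviation ps_x :: "2 pseries" where "ps_x \<equiv> ps_var 1"
abbreviation ps_y :: "2 pseries" where "ps_y \<equiv> ps_var 2"

text \<open>A series in \<open>x, y\<close> regarded as a series in \<open>x, y, z\<close>.\<close>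

definition ps_xyz :: "2 pseries \<Rightarrow> 3 pseries" where
  "ps_xyz F = ps_compose F (\<lambda>i. if i = 1 then ps_var 1 else ps_var 2)"

definition formal_normal_form :: "2 pseries \<Rightarrow> 2 pseries \<Rightarrow> 3 \<Rightarrow> 3 \<Rightarrow> 3 pseries" where
  "formal_normal_form f g =
     skew3 (ps_var 3)
       (ps_xyz (ps_deriv 1 f) + ps_var 3 * ps_xyz (ps_deriv 1 g))
       (ps_xyz (ps_deriv 2 f) + ps_var 3 * ps_xyz (ps_deriv 2 g))"

definition has_normal_form :: "(real^3 \<Rightarrow> real^3^3) \<Rightarrow> 2 pseries \<Rightarrow> 2 pseries \<Rightarrow> bool" where
  "has_normal_form P f g \<longleftrightarrow>
     admissible_germ P \<and>
     ps_const_term f = 0 \<and> ps_const_term g = 0 \<and>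
     ps_deriv 1 f * ps_deriv 2 g - ps_deriv 2 f * ps_deriv 1 g = 0 \<and>
     (\<exists>N \<psi> Q \<Phi>. 0 \<in> N \<and> local_coordinates N \<psi> \<and> \<psi> 0 = 0 \<and> in_coordinates N \<psi> P Q \<and>
        formal_change \<Phi> \<and>
        formal_in_coordinates \<Phi> (\<lambda>i j. taylor (\<lambda>x. Q x $ i $ j)) (formal_normal_form f g))"

definition so3_singularity :: "(real^3 \<Rightarrow> real^3^3) \<Rightarrow> bool" where
  "so3_singularity P \<longleftrightarrow>
     (\<exists>f g. has_normal_form P f g \<and> jet_R_equiv 2 f (ps_x\<^sup>2 + ps_y\<^sup>2))"

definition sl2_singularity :: "(real^3 \<Rightarrow> real^3^3) \<Rightarrow> bool" where
  "sl2_singularity P \<longleftrightarrow>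
     (\<exists>f g. has_normal_form P f g \<and>
        (jet_R_equiv 2 f (ps_x\<^sup>2 - ps_y\<^sup>2) \<or> jet_R_equiv 2 f (- ps_x\<^sup>2 - ps_y\<^sup>2)))"

text \<open>The sign \<open>s \<in> {1, -1}\<close> distinguishes the types \<open>A\<^sup>+\<close> and \<open>A\<^sup>-\<close>.\<close>

definition A_form :: "int \<Rightarrow> 2 pseries \<Rightarrow> 2 pseries \<Rightarrow> bool" where
  "A_form s f g \<longleftrightarrow> jet_R_equiv 2 f (of_int s * ps_x\<^sup>2) \<and> ps_jet 1 g = 0"

definition A_singularity :: "int \<Rightarrow> (real^3 \<Rightarrow> real^3^3) \<Rightarrow> bool" where
  "A_singularity s P \<longleftrightarrow> (\<exists>f g. has_normal_form P f g \<and> A_form s f g)"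

definition generic_A_singularity :: "int \<Rightarrow> (real^3 \<Rightarrow> real^3^3) \<Rightarrow> bool" where
  "generic_A_singularity s P \<longleftrightarrow>
     (\<exists>f g. has_normal_form P f g \<and> A_form s f g \<and>
        (\<exists>s\<^sub>1\<in>{1, -1}. \<exists>s\<^sub>2\<in>{1, -1}. R_equiv f (of_int s\<^sub>1 * ps_x\<^sup>2 + of_int s\<^sub>2 * ps_y ^ 3)))"

definition translate_to_origin :: "real^3 \<Rightarrow> (real^3 \<Rightarrow> real^3^3) \<Rightarrow> real^3 \<Rightarrow> real^3^3" where
  "translate_to_origin p P = (\<lambda>x. P (p + x))"

definition so3_singularity_at :: "(real^3 \<Rightarrow> real^3^3) \<Rightarrow> real^3 \<Rightarrow> bool" where
  "so3_singularity_at P p \<longleftrightarrow> so3_singularity (translate_to_origin p P)"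

definition sl2_singularity_at :: "(real^3 \<Rightarrow> real^3^3) \<Rightarrow> real^3 \<Rightarrow> bool" where
  "sl2_singularity_at P p \<longleftrightarrow> sl2_singularity (translate_to_origin p P)"


section \<open>Unfoldings\<close>

definition smooth_unfolding :: "real set \<Rightarrow> (real \<Rightarrow> real^3 \<Rightarrow> real^3^3) \<Rightarrow> bool" where
  "smooth_unfolding J P \<longleftrightarrow>
     open J \<and> 0 \<in> J \<and>
     smooth_on (J \<times> UNIV) (\<lambda>(\<epsilon>, x). P \<epsilon> x) \<and>
     (\<forall>\<epsilon>\<in>J. poisson_structure (P \<epsilon>))"

definition coordinate_family :: "real set \<Rightarrow> (real^3) set \<Rightarrow> (real \<Rightarrow> real^3 \<Rightarrow> real^3) \<Rightarrow> bool" where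
  "coordinate_family W N \<psi> \<longleftrightarrow>
     open W \<and> 0 \<in> W \<and> open N \<and> 0 \<in> N \<and>
     smooth_on (W \<times> N) (\<lambda>(\<epsilon>, x). \<psi> \<epsilon> x) \<and>
     (\<forall>\<epsilon>\<in>W. local_coordinates N (\<psi> \<epsilon>)) \<and>
     \<psi> 0 0 = 0"

text \<open>The bivector field \<open>H (z, s x, y\<^sup>2 + h)\<close> is only reached modulo a remainder \<open>R\<close> that is flat
  at the point \<open>p\<^sub>0\<close>. The initial coordinates \<open>\<theta> \<epsilon>\<close> serve to single out the point \<open>p\<^sub>0\<close>: it is the point with
  \<open>\<theta>\<close>-coordinates \<open>0\<close>, written \<open>p \<epsilon>\<close> in the original coordinates and hence \<open>\<Psi> \<epsilon> (p \<epsilon>)\<close> in the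
  final ones. All data are germs at \<open>\<epsilon> = 0\<close> and at the origin.\<close>

definition unfolding_normal_form ::
    "int \<Rightarrow> (real \<Rightarrow> real^3 \<Rightarrow> real^3^3) \<Rightarrow> (real \<Rightarrow> real) \<Rightarrow> bool" where
  "unfolding_normal_form s P h \<longleftrightarrow>
     (\<exists>W N M \<theta> U V p \<Psi> H R.
        coordinate_family W N \<theta> \<and>
        (\<forall>\<epsilon>\<in>W. in_coordinates N (\<theta> \<epsilon>) (P \<epsilon>) (\<lambda>y. bivector (y $ 3) (U \<epsilon> y) (V \<epsilon> y))) \<and>
        (\<forall>\<epsilon>\<in>W. p \<epsilon> \<in> N \<and> \<theta> \<epsilon> (p \<epsilon>) = 0) \<and>
        coordinate_family W N \<Psi> \<and>
        open M \<and> (\<forall>\<epsilon>\<in>W. \<Psi> \<epsilon> ` N \<subseteq> M) \<and>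
        smooth_on (W \<times> M) (\<lambda>(\<epsilon>, y). H \<epsilon> y) \<and> H 0 0 > (0::real) \<and>
        smooth_on W h \<and> h 0 = 0 \<and>
        smooth_on (W \<times> M) (\<lambda>(\<epsilon>, y). R \<epsilon> y) \<and> (\<forall>\<epsilon>\<in>W. flat_at (R \<epsilon>) (\<Psi> \<epsilon> (p \<epsilon>))) \<and>
        (\<forall>\<epsilon>\<in>W. in_coordinates N (\<Psi> \<epsilon>) (P \<epsilon>)
           (\<lambda>y. H \<epsilon> y *\<^sub>R bivector (y $ 3) (of_int s * y $ 1) ((y $ 2)\<^sup>2 + h \<epsilon>) + R \<epsilon> y)))"

definition generic_unfolding :: "int \<Rightarrow> (real \<Rightarrow> real^3 \<Rightarrow> real^3^3) \<Rightarrow> bool" where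
  "generic_unfolding s P \<longleftrightarrow> (\<exists>h. unfolding_normal_form s P h \<and> deriv h 0 \<noteq> 0)"

end

theory Submission
  imports Defs
begin

text \<open>
  Why the theorem holds. In the final coordinates the bivector field is
  \<open>H (z, s x, y\<^sup>2 + h)\<close> plus a remainder \<open>R\<close>, so up to the remainder its zeros are
  \<open>x = z = 0, y\<^sup>2 = -h(\<epsilon>)\<close>: a fold in the parameter, because \<open>h'(0) \<noteq> 0\<close>. Two things have to be
  added: the remainder must not disturb the fold, and the type of each zero must be determined in the sense of
  the definitions, that is, through a formal normal form.

  The fold. At \<open>\<epsilon> = 0\<close> the remainder is flat at the origin, which kills its derivatives in the
  space directions there. Its derivative with respect to \<open>\<epsilon>\<close> vanishes as well: \<open>R\<close> is zero along the curve of
  base points, and this curve is differentiable by the implicit function theorem applied to the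
  initial coordinates (\<open>R'_deriv\<close>). Hence the components \<open>F(\<epsilon>, x)\<close> of the bivector field have at the
  origin the same 1-jet as those of the model, and also the same derivative of the Jacobian determinant along the
  kernel direction \<open>v\<close> of \<open>\<partial>F/\<partial>x\<close>. The zero set of \<open>F\<close> is therefore a smooth curve, parametrised by the
  coordinate along \<open>v\<close>; along it both \<open>d\<epsilon>/dt\<close> and \<open>det(\<partial>F/\<partial>x)\<close> change sign exactly
  at \<open>t = 0\<close> (\<open>fold_curve\<close>). So there are no zeros for one sign of \<open>\<epsilon>\<close> and two for the other, and the
  determinant is positive at one of them and negative at the other (\<open>fold_bifurcation\<close>).

  The types. At a zero, the Poisson structure has a linear part \<open>v \<mapsto> L v\<close>, where a skew matrix
  is identified with a vector; the Jacobi identity makes an invertible \<open>L\<close> symmetric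
  (\<open>linear_part_symmetric\<close>). Up to the factor \<open>1/det J\<close>, the quadratic form of \<open>L\<close> is close to
  \<open>H diag(s, 0, 1)\<close> pulled back by the Jacobian matrix \<open>J\<close> of the coordinates, so two of its signs are known and the third is read off
  from \<open>det L\<close>, that is, from \<open>det(\<partial>F/\<partial>x)\<close> (\<open>singularity_type_at_zero\<close>). If \<open>s = 1\<close>, the form is definite at one zero and indefinite at the
  other; if \<open>s = -1\<close>, it is indefinite at both. A definite form gives the Lie algebra \<open>so(3)\<close>, an
  indefinite one \<open>sl(2)\<close> (\<open>singularity_type_of_linear_part\<close>).

  The normal form. The linear part is thus a simple Lie algebra, and the normal form follows from formal
  linearisation. In linear coordinates adapted to \<open>L\<close> one looks for formal series \<open>\<Phi>\<^sub>1, \<Phi>\<^sub>2, \<Phi>\<^sub>3\<close> with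
  \<open>{\<Phi>\<^sub>1, \<Phi>\<^sub>2} = \<Phi>\<^sub>3\<close>, \<open>{\<Phi>\<^sub>2, \<Phi>\<^sub>3} = a \<Phi>\<^sub>1\<close>, \<open>{\<Phi>\<^sub>3, \<Phi>\<^sub>1} = b \<Phi>\<^sub>2\<close>, that is, for a Levi factor of the Lie algebra of series
  without constant term. These are the relations of the normal form with \<open>f = (a x\<^sup>2 + b y\<^sup>2)/2\<close> and
  \<open>g = 0\<close>; since they are linear in the \<open>\<Phi>\<^sub>i\<close>, composition of series only occurs with linear outer series and no
  chain rule is involved. The series are built degree by degree (\<open>levi_factor\<close>). The
  obstruction in each degree is a 2-cocycle with values in homogeneous polynomials, and it is a coboundary by an
  explicit form of Whitehead's second lemma: the Casimir operator is \<open>Q \<Delta> - abk(k + 1)\<close> on polynomials of degree \<open>k\<close>, for an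
  invariant quadratic form \<open>Q\<close> and the dual Laplace operator \<open>\<Delta>\<close>, which allows an induction on \<open>k\<close> (\<open>whitehead\<close>).
\<close>

section \<open>Calculus of smooth maps\<close>

text \<open>
  The derivatives in the definition are taken at points of \<open>S\<close> but in the whole space, so openness of \<open>S\<close> is what makes
  them depend on the values on \<open>S\<close> only.
\<close>

lemma C_k_on_cong:
  assumes "open S" "\<And>x. x \<in> S \<Longrightarrow> f x = g x" "C_k_on k S f"
  shows "C_k_on k S g"
  using assms(2,3)
proof (induction k arbitrary: f g)
  case 0
  then show ?case using continuous_on_eq[of S f g] by auto
next
  case (Suc k)
  have fg: "(g has_derivative D) (at x)" if "(f has_derivative D) (at x)" "x \<in> S" for D x
    by (rule has_derivative_transform_within_open[OF that(1) \<open>open S\<close> that(2) Suc.prems(1)])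
  have d: "g differentiable (at x)" "frechet_derivative f (at x) = frechet_derivative g (at x)" if "x \<in> S" for x
  proof -
    have "(f has_derivative frechet_derivative f (at x)) (at x)"
      using Suc.prems(2) that by (simp add: frechet_derivative_works[symmetric])
    from fg[OF this that] have D: "(g has_derivative frechet_derivative f (at x)) (at x)" .
    show "g differentiable (at x)"
      using D unfolding differentiable_def by blast
    show "frechet_derivative f (at x) = frechet_derivative g (at x)"
      by (rule frechet_derivative_at[OF D])
  qed
  have "C_k_on k S (dir_deriv v g)" for v
    by (rule Suc.IH[of "dir_deriv v f", rotated]) (use Suc.prems(2) d in \<open>auto simp: dir_deriv_def\<close>)
  then show ?case
    using d by auto
qed

lemma C_k_on_mono: "open S \<Longrightarrow> C_k_on k T f \<Longrightarrow> S \<subseteq> T \<Longrightarrow> C_k_on k S f"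
  by (induction k arbitrary: f) (auto intro: continuous_on_subset)

lemma C_k_on_Suc_imp:
  assumes "C_k_on (Suc k) S f"
  shows "C_k_on k S f"
  using assms
proof (induction k arbitrary: f)
  case 0
  then show ?case
    by (auto intro!: differentiable_imp_continuous_on simp: differentiable_on_def
        intro: differentiable_at_imp_differentiable_on differentiable_at_withinI)
next
  case (Suc k)
  then show ?case by auto
qed

lemma dir_deriv_eq: "(f has_derivative D) (at x) \<Longrightarrow> dir_deriv v f x = D v"
  by (simp add: dir_deriv_def frechet_derivative_at[symmetric])

lemma C_k_on_const: "C_k_on k S (\<lambda>x. c)"
proof (induction k arbitrary: c)
  case (Suc k)
  have "dir_deriv v (\<lambda>x. c) = (\<lambda>x. 0)" for v :: 'a
    by (auto simp: fun_eq_iff intro!: dir_deriv_eq derivative_eq_intros)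
  then show ?case using Suc by simp
qed auto

lemma C_k_on_bounded_linear:
  assumes "bounded_linear L"
  shows "C_k_on k S L"
proof (cases k)
  case 0
  then show ?thesis using assms by (simp add: linear_continuous_on)
next
  case (Suc j)
  have *: "(L has_derivative L) (at x)" for x
    using assms by (rule bounded_linear_imp_has_derivative)
  have "dir_deriv v L = (\<lambda>x. L v)" for v
    by (auto simp: fun_eq_iff intro!: dir_deriv_eq *)
  then show ?thesis using Suc * by (auto simp: C_k_on_const differentiable_def)
qed

lemma C_k_on_add:
  fixes f g :: "'a::real_normed_vector \<Rightarrow> 'b::real_normed_vector"
  assumes "open S" "C_k_on k S f" "C_k_on k S g"
  shows "C_k_on k S (\<lambda>x. f x + g x)"
  using assms(2,3)
proof (induction k arbitrary: f g)
  case 0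
  then show ?case by (auto intro: continuous_intros)
next
  case (Suc k)
  have d: "((\<lambda>x. f x + g x) has_derivative (\<lambda>v. frechet_derivative f (at x) v + frechet_derivative g (at x) v)) (at x)"
    if "x \<in> S" for x
    using Suc.prems that by (auto intro!: derivative_eq_intros frechet_derivative_works[THEN iffD1])
  have "C_k_on k S (dir_deriv v (\<lambda>x. f x + g x))" for v
  proof (rule C_k_on_cong[OF \<open>open S\<close>])
    show "C_k_on k S (\<lambda>x. dir_deriv v f x + dir_deriv v g x)"
      using Suc by auto
    show "dir_deriv v f x + dir_deriv v g x = dir_deriv v (\<lambda>x. f x + g x) x" if "x \<in> S" for x
      using dir_deriv_eq[OF d[OF that]] by (simp add: dir_deriv_def)
  qed
  then show ?case using d by (auto simp: differentiable_def)
qed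

text \<open>
  The induction works for all bilinear products at once, since the product rule only involves the same product again.
\<close>

lemma C_k_on_bilinear:
  assumes "open S" "bounded_bilinear pr" "C_k_on k S f" "C_k_on k S g"
  shows "C_k_on k S (\<lambda>x. pr (f x) (g x))"
  using assms(3,4)
proof (induction k arbitrary: f g)
  case 0
  then show ?case
    using assms(2) by (auto intro: bounded_bilinear.continuous_on)
next
  case (Suc k)
  have d: "((\<lambda>x. pr (f x) (g x)) has_derivative
      (\<lambda>v. pr (f x) (frechet_derivative g (at x) v) + pr (frechet_derivative f (at x) v) (g x))) (at x)"
    if "x \<in> S" for x
    using Suc.prems that by (auto intro!: bounded_bilinear.FDERIV[OF assms(2)] frechet_derivative_works[THEN iffD1])
  have "C_k_on k S (dir_deriv v (\<lambda>x. pr (f x) (g x)))" for v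
  proof (rule C_k_on_cong[OF \<open>open S\<close>])
    have fg: "C_k_on k S f" "C_k_on k S g"
      using Suc.prems by (auto intro: C_k_on_Suc_imp simp del: C_k_on.simps)
    show "C_k_on k S (\<lambda>x. pr (f x) (dir_deriv v g x) + pr (dir_deriv v f x) (g x))"
      using Suc.prems fg by (intro C_k_on_add[OF \<open>open S\<close>] Suc.IH) auto
    show "pr (f x) (dir_deriv v g x) + pr (dir_deriv v f x) (g x) = dir_deriv v (\<lambda>x. pr (f x) (g x)) x"
      if "x \<in> S" for x
      using dir_deriv_eq[OF d[OF that]] by (simp add: dir_deriv_def)
  qed
  then show ?case using d by (auto simp: differentiable_def)
qed

lemma smooth_on_subset: "smooth_on T f \<Longrightarrow> open S \<Longrightarrow> S \<subseteq> T \<Longrightarrow> smooth_on S f"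
  unfolding smooth_on_def using C_k_on_mono by blast

lemma smooth_on_const [simp]: "smooth_on S (\<lambda>x. c)"
  by (simp add: smooth_on_def C_k_on_const)

lemma smooth_on_linear: "bounded_linear L \<Longrightarrow> smooth_on S L"
  by (simp add: smooth_on_def C_k_on_bounded_linear)

lemma smooth_on_bilinear:
  "open S \<Longrightarrow> bounded_bilinear pr \<Longrightarrow> smooth_on S f \<Longrightarrow> smooth_on S g \<Longrightarrow> smooth_on S (\<lambda>x. pr (f x) (g x))"
  by (simp add: smooth_on_def C_k_on_bilinear)

lemmas smooth_on_mult = smooth_on_bilinear[OF _ bounded_bilinear_mult]
lemmas smooth_on_scaleR = smooth_on_bilinear[OF _ bounded_bilinear_scaleR]

lemma smooth_on_add: "open S \<Longrightarrow> smooth_on S f \<Longrightarrow> smooth_on S g \<Longrightarrow> smooth_on S (\<lambda>x. f x + g x)"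
  by (simp add: smooth_on_def C_k_on_add)

lemma smooth_on_sum:
  fixes f :: "'i \<Rightarrow> 'a::real_normed_vector \<Rightarrow> 'b::real_normed_vector"
  assumes "open S" "\<And>i. i \<in> I \<Longrightarrow> smooth_on S (f i)"
  shows "smooth_on S (\<lambda>x. \<Sum>i\<in>I. f i x)"
  using assms by (induction I rule: infinite_finite_induct) (auto intro: smooth_on_add)

lemma smooth_on_differentiable: "smooth_on S f \<Longrightarrow> x \<in> S \<Longrightarrow> f differentiable (at x)"
  unfolding smooth_on_def by (auto dest: spec[of _ "Suc 0"])

lemma smooth_on_has_derivative:
  "smooth_on S f \<Longrightarrow> x \<in> S \<Longrightarrow> (f has_derivative (\<lambda>v. dir_deriv v f x)) (at x)"
  unfolding dir_deriv_def using frechet_derivative_works smooth_on_differentiable by blast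

lemma smooth_on_continuous: "smooth_on S f \<Longrightarrow> continuous_on S f"
  unfolding smooth_on_def by (auto dest: spec[of _ 0])

lemma smooth_on_dir_deriv: "smooth_on S f \<Longrightarrow> smooth_on S (dir_deriv v f)"
  unfolding smooth_on_def by (metis C_k_on.simps(2))

lemma smooth_on_bounded_linear_comp:
  assumes "open S" "bounded_linear L" "smooth_on S f"
  shows "smooth_on S (\<lambda>x. L (f x))" and "x \<in> S \<Longrightarrow> dir_deriv v (\<lambda>x. L (f x)) x = L (dir_deriv v f x)"
proof -
  have d: "((\<lambda>x. L (f x)) has_derivative (\<lambda>v. L (dir_deriv v f x))) (at x)" if "x \<in> S" "smooth_on S f" for f x
    using that by (intro bounded_linear.has_derivative[OF assms(2)] smooth_on_has_derivative)
  show "dir_deriv v (\<lambda>x. L (f x)) x = L (dir_deriv v f x)" if "x \<in> S"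
    by (rule dir_deriv_eq[OF d[OF that assms(3)]])
  show "smooth_on S (\<lambda>x. L (f x))"
    unfolding smooth_on_def
  proof
    fix k show "C_k_on k S (\<lambda>x. L (f x))"
      using assms(3)
    proof (induction k arbitrary: f)
      case 0
      then show ?case
        using smooth_on_continuous bounded_linear.continuous_on[OF assms(2)] by auto
    next
      case (Suc k)
      have "C_k_on k S (dir_deriv v (\<lambda>x. L (f x)))" for v
        by (rule C_k_on_cong[OF \<open>open S\<close> _ Suc.IH[of "dir_deriv v f"]])
          (use Suc.prems in \<open>simp_all add: dir_deriv_eq[OF d] smooth_on_dir_deriv\<close>)
      then show ?case using d Suc.prems by (auto simp: differentiable_def)
    qed
  qed
qed

text \<open>
  Expanding \<open>D g (D\<^sub>v f)\<close> in a basis of the middle space turns the chain rule into a sum of products of functions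
  that are covered by the induction hypothesis.
\<close>

lemma smooth_on_compose:
  fixes f :: "'a::real_normed_vector \<Rightarrow> 'b::euclidean_space" and g :: "'b \<Rightarrow> 'c::real_normed_vector"
  assumes "open S" "open T" "smooth_on S f" "smooth_on T g" "f ` S \<subseteq> T"
  shows "smooth_on S (\<lambda>x. g (f x))"
    and "x \<in> S \<Longrightarrow> dir_deriv v (\<lambda>x. g (f x)) x = dir_deriv (dir_deriv v f x) g (f x)"
proof -
  have d: "((\<lambda>x. g (f x)) has_derivative (\<lambda>v. dir_deriv (dir_deriv v f x) g (f x))) (at x)"
    if "x \<in> S" "smooth_on T g" for g :: "'b \<Rightarrow> 'c" and x
    using that assms(3,5)
    by (intro has_derivative_compose[of f _ x UNIV g, simplified] smooth_on_has_derivative) auto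
  show "dir_deriv v (\<lambda>x. g (f x)) x = dir_deriv (dir_deriv v f x) g (f x)" if "x \<in> S"
    by (rule dir_deriv_eq[OF d[OF that assms(4)]])
  have "C_k_on k S (\<lambda>x. g (f x))" for k
    using assms(4)
  proof (induction k arbitrary: g)
    case 0
    then show ?case
      using assms(3,5) by (auto intro: continuous_on_compose2 smooth_on_continuous)
  next
    case (Suc k)
    have "C_k_on k S (dir_deriv v (\<lambda>x. g (f x)))" for v
    proof (rule C_k_on_cong[OF \<open>open S\<close>])
      have "C_k_on k S (\<lambda>x. \<Sum>b\<in>B. (dir_deriv v f x \<bullet> b) *\<^sub>R dir_deriv b g (f x))" if "finite B" for B
        using that
      proof induction
        case (insert b B)
        have "C_k_on k S (\<lambda>x. dir_deriv v f x \<bullet> b)"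
          using smooth_on_bounded_linear_comp(1)[OF \<open>open S\<close> bounded_linear_inner_left smooth_on_dir_deriv[OF assms(3)]]
          unfolding smooth_on_def by blast
        then have "C_k_on k S (\<lambda>x. (dir_deriv v f x \<bullet> b) *\<^sub>R dir_deriv b g (f x))"
          using Suc.IH[OF smooth_on_dir_deriv[OF Suc.prems]]
          by (intro C_k_on_bilinear[OF \<open>open S\<close> bounded_bilinear_scaleR])
        with insert show ?case
          using C_k_on_add[OF \<open>open S\<close>] by simp
      qed (simp add: C_k_on_const)
      from this[of Basis] show "C_k_on k S (\<lambda>x. \<Sum>b\<in>Basis. (dir_deriv v f x \<bullet> b) *\<^sub>R dir_deriv b g (f x))"
        by simp
      fix x assume x: "x \<in> S"
      have lin: "linear (\<lambda>w. dir_deriv w g (f x))"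
        using smooth_on_has_derivative[OF Suc.prems, of "f x"] x assms(5)
        by (auto dest: has_derivative_linear)
      have "dir_deriv v (\<lambda>x. g (f x)) x = dir_deriv (\<Sum>b\<in>Basis. (dir_deriv v f x \<bullet> b) *\<^sub>R b) g (f x)"
        using dir_deriv_eq[OF d[OF x Suc.prems]] by (simp add: euclidean_representation)
      also have "\<dots> = (\<Sum>b\<in>Basis. (dir_deriv v f x \<bullet> b) *\<^sub>R dir_deriv b g (f x))"
        by (simp add: linear_sum[OF lin] linear_scale[OF lin])
      finally show "(\<Sum>b\<in>Basis. (dir_deriv v f x \<bullet> b) *\<^sub>R dir_deriv b g (f x)) = dir_deriv v (\<lambda>x. g (f x)) x"
        by simp
    qed
    then show ?case using d Suc.prems by (auto simp: differentiable_def)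
  qed
  then show "smooth_on S (\<lambda>x. g (f x))"
    by (simp add: smooth_on_def)
qed

lemma smooth_on_Pair:
  fixes f :: "'a::real_normed_vector \<Rightarrow> 'b::real_normed_vector" and g :: "'a \<Rightarrow> 'c::real_normed_vector"
  assumes "open S" "smooth_on S f" "smooth_on S g"
  shows "smooth_on S (\<lambda>x. (f x, g x))"
proof -
  have "bounded_linear (\<lambda>y :: 'b. (y, 0 :: 'c))" "bounded_linear (\<lambda>z :: 'c. (0 :: 'b, z))"
    by (intro bounded_linear_Pair bounded_linear_ident bounded_linear_zero)+
  from smooth_on_bounded_linear_comp(1)[OF assms(1) this(1) assms(2)]
    smooth_on_bounded_linear_comp(1)[OF assms(1) this(2) assms(3)]
  have "smooth_on S (\<lambda>x. (f x, 0) + (0, g x))"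
    by (rule smooth_on_add[OF assms(1)])
  then show ?thesis by simp
qed

lemma smooth_on_nth: 
  fixes f :: "'a::real_normed_vector \<Rightarrow> 'b::real_normed_vector ^ 'n"
  shows "open S \<Longrightarrow> smooth_on S f \<Longrightarrow> smooth_on S (\<lambda>x. f x $ i)"
  by (rule smooth_on_bounded_linear_comp(1)[OF _ bounded_linear_vec_nth])

lemma smooth_on_vec_lambda:
  fixes f :: "'a::real_normed_vector \<Rightarrow> real ^ 'n"
  assumes "open S" "\<And>i. smooth_on S (\<lambda>x. f x $ i)"
  shows "smooth_on S f"
proof -
  have "smooth_on S (\<lambda>x. \<Sum>i\<in>UNIV. (f x $ i) *\<^sub>R axis i (1::real))"
    using assms by (intro smooth_on_sum smooth_on_scaleR) auto
  moreover have "(\<Sum>i\<in>UNIV. (f x $ i) *\<^sub>R axis i 1) = f x" for x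
    by (simp add: vec_eq_iff axis_def if_distrib cong: if_cong)
  ultimately show ?thesis by simp
qed

lemma smooth_on_C1:
  fixes f :: "'a::euclidean_space \<Rightarrow> 'b::real_normed_vector"
  assumes "open S" "smooth_on S f"
  obtains f' :: "'a \<Rightarrow> 'a \<Rightarrow>\<^sub>L 'b"
  where "\<And>x. x \<in> S \<Longrightarrow> (f has_derivative blinfun_apply (f' x)) (at x)" "continuous_on S f'"
    "\<And>x v. x \<in> S \<Longrightarrow> blinfun_apply (f' x) v = dir_deriv v f x"
proof -
  define f' where "f' x = Blinfun (\<lambda>v. dir_deriv v f x)" for x
  have *: "blinfun_apply (f' x) = (\<lambda>v. dir_deriv v f x)" if "x \<in> S" for x
    using has_derivative_bounded_linear[OF smooth_on_has_derivative[OF assms(2) that]]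
    by (simp add: bounded_linear_Blinfun_apply f'_def)
  have "continuous_on S f'"
  proof (rule continuous_on_blinfun_componentwise)
    fix i :: 'a
    have "continuous_on S (dir_deriv i f)"
      using assms(2) smooth_on_dir_deriv smooth_on_continuous by blast
    then show "continuous_on S (\<lambda>x. blinfun_apply (f' x) i)"
      by (rule continuous_on_eq) (simp add: *)
  qed
  with * smooth_on_has_derivative[OF assms(2)] show thesis
    by (intro that[of f']) auto
qed

section \<open>Formal power series: grading and derivations\<close>

abbreviation deg :: "('n::finite \<Rightarrow> nat) \<Rightarrow> nat" where
  "deg \<alpha> \<equiv> (\<Sum>i\<in>UNIV. \<alpha> i)"

definition ps_const :: "real \<Rightarrow> 'n pseries" where
  "ps_const c = PSeries (\<lambda>\<alpha>. if \<alpha> = (\<lambda>_. 0) then c else 0)"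

definition ps_hom :: "nat \<Rightarrow> 'n::finite pseries \<Rightarrow> bool" where
  "ps_hom k F \<longleftrightarrow> (\<forall>\<alpha>. deg \<alpha> \<noteq> k \<longrightarrow> ps_coeff F \<alpha> = 0)"

text \<open>
  The powers of the maximal ideal: \<open>ps_ord k F\<close> says that \<open>F\<close> lies in the \<open>k\<close>-th one.
\<close>

definition ps_ord :: "nat \<Rightarrow> 'n::finite pseries \<Rightarrow> bool" where
  "ps_ord k F \<longleftrightarrow> (\<forall>\<alpha>. deg \<alpha> < k \<longrightarrow> ps_coeff F \<alpha> = 0)"

definition ps_part :: "nat \<Rightarrow> 'n::finite pseries \<Rightarrow> 'n pseries" where
  "ps_part k F = PSeries (\<lambda>\<alpha>. if deg \<alpha> = k then ps_coeff F \<alpha> else 0)"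

lemma ps_coeff_0 [simp]: "ps_coeff (0 :: 'n::finite pseries) \<alpha> = 0"
  and ps_coeff_add [simp]: "ps_coeff (F + G :: 'n pseries) \<alpha> = ps_coeff F \<alpha> + ps_coeff G \<alpha>"
  and ps_coeff_diff [simp]: "ps_coeff (F - G :: 'n pseries) \<alpha> = ps_coeff F \<alpha> - ps_coeff G \<alpha>"
  and ps_coeff_uminus [simp]: "ps_coeff (- F :: 'n pseries) \<alpha> = - ps_coeff F \<alpha>"
  by (simp_all add: zero_pseries_def plus_pseries_def minus_pseries_def uminus_pseries_def)

lemma ps_coeff_mult:
  "ps_coeff (F * G :: 'n::finite pseries) \<alpha> =
     (\<Sum>\<beta> | \<forall>i. \<beta> i \<le> \<alpha> i. ps_coeff F \<beta> * ps_coeff G (\<lambda>i. \<alpha> i - \<beta> i))"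
  by (simp add: times_pseries_def)

lemma ps_coeff_deriv [simp]: "ps_coeff (ps_deriv i F) \<alpha> = real (\<alpha> i + 1) * ps_coeff F (\<alpha>(i := \<alpha> i + 1))"
  by (simp add: ps_deriv_def)

lemma ps_coeff_sum [simp]: "ps_coeff (\<Sum>i\<in>I. F i :: 'n::finite pseries) \<alpha> = (\<Sum>i\<in>I. ps_coeff (F i) \<alpha>)"
  by (induction I rule: infinite_finite_induct) auto

lemma deg_upd: "deg (\<alpha>(i := \<alpha> i + 1)) = deg (\<alpha> :: 'n::finite \<Rightarrow> nat) + 1"
proof -
  have "deg (\<alpha>(i := \<alpha> i + 1)) = (\<alpha> i + 1) + (\<Sum>j\<in>UNIV - {i}. \<alpha> j)"
    by (subst sum.remove[of _ i]) auto
  also have "\<dots> = deg \<alpha> + 1"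
    by (subst (2) sum.remove[of _ i]) auto
  finally show ?thesis .
qed

lemma deg_diff: "\<forall>i. \<beta> i \<le> \<alpha> i \<Longrightarrow> deg \<beta> + deg (\<lambda>i. \<alpha> i - \<beta> i) = deg (\<alpha> :: 'n::finite \<Rightarrow> nat)"
  by (simp add: sum.distrib[symmetric])

lemma deg_eq_0: "deg \<alpha> = 0 \<longleftrightarrow> \<alpha> = (\<lambda>_. 0 :: nat)"
  by (auto simp: fun_eq_iff)

lemma ps_coeff_const: "ps_coeff (ps_const c) \<alpha> = (if \<alpha> = (\<lambda>_. 0) then c else 0)"
  by (simp add: ps_const_def)

lemma ps_coeff_const_mult [simp]: "ps_coeff (ps_const c * F :: 'n::finite pseries) \<alpha> = c * ps_coeff F \<alpha>"
proof -
  have "ps_coeff (ps_const c * F) \<alpha> =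
      (\<Sum>\<beta> | \<forall>i. \<beta> i \<le> \<alpha> i. if \<beta> = (\<lambda>_. 0) then c * ps_coeff F (\<lambda>i. \<alpha> i - \<beta> i) else 0)"
    unfolding ps_coeff_mult ps_coeff_const by (intro sum.cong) auto
  also have "\<dots> = c * ps_coeff F \<alpha>"
    by (subst sum.delta) auto
  finally show ?thesis .
qed

lemma ps_const_mult: "ps_const a * ps_const b = (ps_const (a * b) :: 'n::finite pseries)"
  by (rule pseries_eqI) (simp add: ps_coeff_const)

lemma ps_const_0 [simp]: "ps_const 0 = (0 :: 'n::finite pseries)"
  by (rule pseries_eqI) (simp add: ps_coeff_const)

lemma ps_const_1 [simp]: "ps_const 1 = (1 :: 'n::finite pseries)"
  by (rule pseries_eqI) (simp add: ps_coeff_const one_pseries_def)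

lemma ps_coeff_var: "ps_coeff (ps_var i) \<alpha> = (if \<alpha> = (\<lambda>j. if j = i then 1 else 0) then 1 else 0)"
  by (simp add: ps_var_def)

lemma deg_unit: "deg (\<lambda>j::'n::finite. if j = i then 1 else 0) = 1"
  by simp

lemma ps_coeff_var_mult:
  "ps_coeff (ps_var i * F :: 'n::finite pseries) \<alpha> = (if \<alpha> i = 0 then 0 else ps_coeff F (\<alpha>(i := \<alpha> i - 1)))"
proof -
  have "ps_coeff (ps_var i * F) \<alpha> =
      (\<Sum>\<beta> | \<forall>i. \<beta> i \<le> \<alpha> i. if \<beta> = (\<lambda>j. if j = i then 1 else 0) then ps_coeff F (\<lambda>i. \<alpha> i - \<beta> i) else 0)"
    unfolding ps_coeff_mult ps_coeff_var by (intro sum.cong) auto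
  also have "\<dots> = (if \<alpha> i = 0 then 0 else ps_coeff F (\<lambda>k. \<alpha> k - (if k = i then 1 else 0)))"
    by (subst sum.delta) auto
  also have "(\<lambda>k. \<alpha> k - (if k = i then 1 else 0)) = \<alpha>(i := \<alpha> i - 1)"
    by auto
  finally show ?thesis .
qed

lemma ps_deriv_add [simp]: "ps_deriv i (F + G :: 'n::finite pseries) = ps_deriv i F + ps_deriv i G"
  and ps_deriv_diff [simp]: "ps_deriv i (F - G :: 'n pseries) = ps_deriv i F - ps_deriv i G"
  and ps_deriv_uminus [simp]: "ps_deriv i (- F :: 'n pseries) = - ps_deriv i F"
  and ps_deriv_0 [simp]: "ps_deriv i (0 :: 'n pseries) = 0"
  by (auto intro!: pseries_eqI simp: algebra_simps)

lemma ps_deriv_const [simp]: "ps_deriv i (ps_const c :: 'n::finite pseries) = 0"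
  by (auto intro!: pseries_eqI simp: ps_coeff_const fun_eq_iff)

lemma ps_deriv_var: "ps_deriv i (ps_var j :: 'n::finite pseries) = (if i = j then 1 else 0)"
proof (rule pseries_eqI)
  fix \<alpha> :: "'n \<Rightarrow> nat"
  have "\<alpha>(i := \<alpha> i + 1) = (\<lambda>k. if k = j then 1 else 0) \<longleftrightarrow> i = j \<and> \<alpha> = (\<lambda>_. 0)"
    by (auto simp: fun_eq_iff split: if_splits)
  then show "ps_coeff (ps_deriv i (ps_var j)) \<alpha> = ps_coeff (if i = j then 1 else 0) \<alpha>"
    by (auto simp: ps_coeff_var one_pseries_def)
qed

lemma ps_deriv_commute: "ps_deriv i (ps_deriv j F) = ps_deriv j (ps_deriv i F)"
  by (cases "i = j") (auto intro!: pseries_eqI simp: fun_upd_twist)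

text \<open>
  In the coefficient of \<open>\<alpha>\<close>, the factor \<open>\<alpha>\<^sub>i + 1\<close> coming from the derivative is split as \<open>\<beta>\<^sub>i + (\<alpha>\<^sub>i + 1 - \<beta>\<^sub>i)\<close> for each
  term \<open>\<beta>\<close> of the product; the two resulting sums are those of the two terms of the product rule.
\<close>

lemma ps_deriv_mult [simp]:
  "ps_deriv i (F * G :: 'n::finite pseries) = ps_deriv i F * G + F * ps_deriv i G"
proof (rule pseries_eqI)
  fix \<alpha> :: "'n \<Rightarrow> nat"
  let ?\<alpha> = "\<alpha>(i := \<alpha> i + 1)"
  let ?f = "ps_coeff F" and ?g = "ps_coeff G"
  let ?S = "{\<beta>. \<forall>j. \<beta> j \<le> ?\<alpha> j}" and ?T = "{\<beta>. \<forall>j. \<beta> j \<le> \<alpha> j}"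
  have "ps_coeff (ps_deriv i (F * G)) \<alpha> =
      (\<Sum>\<beta>\<in>?S. (real (\<beta> i) + real (?\<alpha> i - \<beta> i)) * (?f \<beta> * ?g (\<lambda>j. ?\<alpha> j - \<beta> j)))"
    unfolding ps_coeff_deriv ps_coeff_mult sum_distrib_left
  proof (rule sum.cong[OF refl])
    fix \<beta> assume "\<beta> \<in> ?S"
    then have "\<beta> i \<le> ?\<alpha> i" by blast
    then have "real (\<beta> i) + real (?\<alpha> i - \<beta> i) = real (\<alpha> i + 1)"
      by (simp add: of_nat_diff)
    then show "real (\<alpha> i + 1) * (?f \<beta> * ?g (\<lambda>j. ?\<alpha> j - \<beta> j)) =
        (real (\<beta> i) + real (?\<alpha> i - \<beta> i)) * (?f \<beta> * ?g (\<lambda>j. ?\<alpha> j - \<beta> j))"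
      by simp
  qed
  also have "\<dots> = (\<Sum>\<beta>\<in>?S. real (\<beta> i) * (?f \<beta> * ?g (\<lambda>j. ?\<alpha> j - \<beta> j)))
      + (\<Sum>\<beta>\<in>?S. real (?\<alpha> i - \<beta> i) * (?f \<beta> * ?g (\<lambda>j. ?\<alpha> j - \<beta> j)))"
    by (simp add: distrib_right sum.distrib)
  also have "(\<Sum>\<beta>\<in>?S. real (\<beta> i) * (?f \<beta> * ?g (\<lambda>j. ?\<alpha> j - \<beta> j))) =
      (\<Sum>\<beta>\<in>{\<beta>\<in>?S. \<beta> i > 0}. real (\<beta> i) * (?f \<beta> * ?g (\<lambda>j. ?\<alpha> j - \<beta> j)))"
    by (rule sum.mono_neutral_right) auto
  also have "\<dots> = (\<Sum>\<beta>\<in>?T. real (\<beta> i + 1) * ?f (\<beta>(i := \<beta> i + 1)) * ?g (\<lambda>j. \<alpha> j - \<beta> j))"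
  proof (rule sum.reindex_bij_witness[where i = "\<lambda>\<beta>. \<beta>(i := \<beta> i + 1)" and j = "\<lambda>\<beta>. \<beta>(i := \<beta> i - 1)"], goal_cases)
    case (1 a) then show ?case by (auto simp: fun_eq_iff)
  next
    case (2 a) then show ?case by (auto split: if_splits)
  next
    case (3 b) then show ?case by (auto simp: fun_eq_iff)
  next
    case (4 b) then show ?case by auto
  next
    case (5 a)
    then have "(\<lambda>j. ?\<alpha> j - a j) = (\<lambda>j. \<alpha> j - (a(i := a i - 1)) j)" by (auto simp: fun_eq_iff)
    moreover from 5 have "real (a i - Suc 0) + 1 = real (a i)" by auto
    ultimately show ?case using 5 by (simp add: ac_simps)
  qed
  also have "\<dots> = ps_coeff (ps_deriv i F * G) \<alpha>"
    by (simp add: ps_coeff_mult)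
  also have "(\<Sum>\<beta>\<in>?S. real (?\<alpha> i - \<beta> i) * (?f \<beta> * ?g (\<lambda>j. ?\<alpha> j - \<beta> j))) =
      (\<Sum>\<beta>\<in>?T. ?f \<beta> * (real (\<alpha> i - \<beta> i + 1) * ?g ((\<lambda>j. \<alpha> j - \<beta> j)(i := \<alpha> i - \<beta> i + 1))))"
  proof (rule sum.mono_neutral_cong_right)
    show "finite ?S" by (rule finite_exponents_le)
    show "?T \<subseteq> ?S" by (auto intro: le_SucI)
    show "\<forall>\<beta>\<in>?S - ?T. real (?\<alpha> i - \<beta> i) * (?f \<beta> * ?g (\<lambda>j. ?\<alpha> j - \<beta> j)) = 0"
    proof
      fix \<beta> assume \<beta>: "\<beta> \<in> ?S - ?T"
      then obtain j where "\<not> \<beta> j \<le> \<alpha> j" by auto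
      moreover from \<beta> have "\<beta> j \<le> ?\<alpha> j" by blast
      ultimately have "j = i" "\<beta> i = \<alpha> i + 1" by (auto split: if_splits)
      then show "real (?\<alpha> i - \<beta> i) * (?f \<beta> * ?g (\<lambda>j. ?\<alpha> j - \<beta> j)) = 0" by simp
    qed
    fix \<beta> assume "\<beta> \<in> ?T"
    then have "\<beta> i \<le> \<alpha> i" by blast
    then have "?\<alpha> i - \<beta> i = \<alpha> i - \<beta> i + 1" "(\<lambda>j. ?\<alpha> j - \<beta> j) = (\<lambda>j. \<alpha> j - \<beta> j)(i := \<alpha> i - \<beta> i + 1)"
      by (auto simp: fun_eq_iff)
    then show "real (?\<alpha> i - \<beta> i) * (?f \<beta> * ?g (\<lambda>j. ?\<alpha> j - \<beta> j)) =
        ?f \<beta> * (real (\<alpha> i - \<beta> i + 1) * ?g ((\<lambda>j. \<alpha> j - \<beta> j)(i := \<alpha> i - \<beta> i + 1)))"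
      by (simp only: ac_simps)
  qed
  also have "\<dots> = ps_coeff (F * ps_deriv i G) \<alpha>"
    by (simp add: ps_coeff_mult)
  finally show "ps_coeff (ps_deriv i (F * G)) \<alpha> = ps_coeff (ps_deriv i F * G + F * ps_deriv i G) \<alpha>"
    by simp
qed

lemma ps_hom_simps [simp]: "ps_hom k 0" "ps_hom k F \<Longrightarrow> ps_hom k G \<Longrightarrow> ps_hom k (F + G)"
  "ps_hom k F \<Longrightarrow> ps_hom k G \<Longrightarrow> ps_hom k (F - G)" "ps_hom k F \<Longrightarrow> ps_hom k (- F)"
  "ps_hom k F \<Longrightarrow> ps_hom k (ps_const c * F)"
  by (auto simp: ps_hom_def)

lemma ps_ord_simps [simp]: "ps_ord k 0" "ps_ord k F \<Longrightarrow> ps_ord k G \<Longrightarrow> ps_ord k (F + G)"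
  "ps_ord k F \<Longrightarrow> ps_ord k G \<Longrightarrow> ps_ord k (F - G)" "ps_ord k F \<Longrightarrow> ps_ord k (- F)"
  "ps_ord k F \<Longrightarrow> ps_ord k (ps_const c * F)" "ps_ord 0 F"
  by (auto simp: ps_ord_def)

lemma ps_hom_mult:
  assumes "ps_hom k F" "ps_hom l (G :: 'n::finite pseries)"
  shows "ps_hom (k + l) (F * G)"
  unfolding ps_hom_def ps_coeff_mult
proof (intro allI impI sum.neutral ballI)
  fix \<alpha> \<beta> :: "'n \<Rightarrow> nat" assume "deg \<alpha> \<noteq> k + l" "\<beta> \<in> {\<beta>. \<forall>i. \<beta> i \<le> \<alpha> i}"
  then have "deg \<beta> \<noteq> k \<or> deg (\<lambda>i. \<alpha> i - \<beta> i) \<noteq> l" using deg_diff[of \<beta> \<alpha>] by auto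
  with assms show "ps_coeff F \<beta> * ps_coeff G (\<lambda>i. \<alpha> i - \<beta> i) = 0"
    by (auto simp: ps_hom_def)
qed

lemma ps_ord_mult:
  assumes "ps_ord k F" "ps_ord l (G :: 'n::finite pseries)"
  shows "ps_ord (k + l) (F * G)"
  unfolding ps_ord_def ps_coeff_mult
proof (intro allI impI sum.neutral ballI)
  fix \<alpha> \<beta> :: "'n \<Rightarrow> nat" assume "deg \<alpha> < k + l" "\<beta> \<in> {\<beta>. \<forall>i. \<beta> i \<le> \<alpha> i}"
  then have "deg \<beta> < k \<or> deg (\<lambda>i. \<alpha> i - \<beta> i) < l" using deg_diff[of \<beta> \<alpha>] by auto
  with assms show "ps_coeff F \<beta> * ps_coeff G (\<lambda>i. \<alpha> i - \<beta> i) = 0"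
    by (auto simp: ps_ord_def)
qed

lemma ps_hom_deriv: "ps_hom k F \<Longrightarrow> ps_hom (k - 1) (ps_deriv i F)"
  unfolding ps_hom_def ps_coeff_deriv using deg_upd[of _ i] by (metis add_diff_cancel_right' mult_zero_right)

lemma ps_hom_0_deriv: "ps_hom 0 F \<Longrightarrow> ps_deriv i F = 0"
  unfolding ps_hom_def using deg_upd[of _ i]
  by (intro pseries_eqI) (metis add_eq_0_iff_both_eq_0 mult_zero_right one_neq_zero ps_coeff_0 ps_coeff_deriv)

lemma ps_ord_deriv: "ps_ord k F \<Longrightarrow> ps_ord (k - 1) (ps_deriv i F)"
  unfolding ps_ord_def ps_coeff_deriv using deg_upd[of _ i] by (metis less_diff_conv mult_zero_right)

lemma ps_ord_mono: "ps_ord k F \<Longrightarrow> l \<le> k \<Longrightarrow> ps_ord l F"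
  by (auto simp: ps_ord_def)

lemma ps_hom_var: "ps_hom 1 (ps_var i)"
  by (auto simp: ps_hom_def ps_coeff_var)

lemma ps_hom_ord: "ps_hom k F \<Longrightarrow> ps_ord k F"
  by (auto simp: ps_hom_def ps_ord_def)

lemma ps_hom_ord_0: "ps_hom k F \<Longrightarrow> ps_ord (Suc k) F \<Longrightarrow> F = 0"
  by (rule pseries_eqI) (metis lessI ps_coeff_0 ps_hom_def ps_ord_def)

lemma ps_ord_0: "(\<And>k. ps_ord k F) \<Longrightarrow> F = 0"
  by (rule pseries_eqI) (metis lessI ps_coeff_0 ps_ord_def)

lemma ps_hom_part: "ps_hom k (ps_part k F)"
  by (simp add: ps_hom_def ps_part_def)

lemma ps_ord_part: "ps_ord k F \<Longrightarrow> ps_ord (Suc k) (F - ps_part k F)"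
  by (auto simp: ps_ord_def ps_part_def less_Suc_eq)

lemma ps_euler:
  assumes "ps_hom k (F :: 'n::finite pseries)"
  shows "(\<Sum>i\<in>UNIV. ps_var i * ps_deriv i F) = ps_const (real k) * F"
proof (rule pseries_eqI)
  fix \<alpha> :: "'n \<Rightarrow> nat"
  have "ps_coeff (ps_var i * ps_deriv i F) \<alpha> = real (\<alpha> i) * ps_coeff F \<alpha>" for i
    by (auto simp: ps_coeff_var_mult)
  then have "ps_coeff (\<Sum>i\<in>UNIV. ps_var i * ps_deriv i F) \<alpha> = real (deg \<alpha>) * ps_coeff F \<alpha>"
    by (simp add: sum_distrib_right)
  also have "\<dots> = ps_coeff (ps_const (real k) * F) \<alpha>"
    using assms by (auto simp: ps_hom_def)
  finally show "ps_coeff (\<Sum>i\<in>UNIV. ps_var i * ps_deriv i F) \<alpha> = ps_coeff (ps_const (real k) * F) \<alpha>" .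
qed

section \<open>Brackets of formal series and Whitehead's lemma\<close>

abbreviation X1 :: "3 pseries" where "X1 \<equiv> ps_var 1"
abbreviation X2 :: "3 pseries" where "X2 \<equiv> ps_var 2"
abbreviation X3 :: "3 pseries" where "X3 \<equiv> ps_var 3"
abbreviation D1 :: "3 pseries \<Rightarrow> 3 pseries" where "D1 \<equiv> ps_deriv 1"
abbreviation D2 :: "3 pseries \<Rightarrow> 3 pseries" where "D2 \<equiv> ps_deriv 2"
abbreviation D3 :: "3 pseries \<Rightarrow> 3 pseries" where "D3 \<equiv> ps_deriv 3"

lemmas D_commute = ps_deriv_commute[of 2 1] ps_deriv_commute[of 3 1] ps_deriv_commute[of 3 2]

text \<open>
  The bracket of the bivector field with \<open>{x,y} = p\<close>, \<open>{y,z} = q\<close>, \<open>{z,x} = r\<close>.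
\<close>

definition ps_bracket :: "3 pseries \<Rightarrow> 3 pseries \<Rightarrow> 3 pseries \<Rightarrow> 3 pseries \<Rightarrow> 3 pseries \<Rightarrow> 3 pseries" where
  "ps_bracket p q r F G = p * (D1 F * D2 G - D2 F * D1 G) + q * (D2 F * D3 G - D3 F * D2 G)
     + r * (D3 F * D1 G - D1 F * D3 G)"

lemma ps_bracket_simps:
  "ps_bracket p q r (F + F') G = ps_bracket p q r F G + ps_bracket p q r F' G"
  "ps_bracket p q r F (G + G') = ps_bracket p q r F G + ps_bracket p q r F G'"
  "ps_bracket p q r (F - F') G = ps_bracket p q r F G - ps_bracket p q r F' G"
  "ps_bracket p q r F (G - G') = ps_bracket p q r F G - ps_bracket p q r F G'"
  "ps_bracket p q r F (ps_const c * G) = ps_const c * ps_bracket p q r F G"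
  "ps_bracket p q r F F = 0"
  by (simp_all add: ps_bracket_def algebra_simps)

lemma ps_bracket_antisym: "ps_bracket p q r G F = - ps_bracket p q r F G"
  by (simp add: ps_bracket_def algebra_simps)

text \<open>
  The hypothesis is the Jacobi identity for the three coordinates. The terms of the Jacobiator with first derivatives
  of \<open>p, q, r\<close> are this expression times the determinant of the gradients of \<open>F, G, H\<close>; the terms with second
  derivatives of \<open>F, G, H\<close> cancel.
\<close>

lemma ps_bracket_jacobi:
  assumes "p * D2 q - r * D3 q + q * D3 r - p * D1 r + r * D1 p - q * D2 p = 0"
  shows "ps_bracket p q r F (ps_bracket p q r G H) + ps_bracket p q r G (ps_bracket p q r H F)
     + ps_bracket p q r H (ps_bracket p q r F G) = 0"
proof -
  define V where "V F w = p * (D1 F * w 2 - D2 F * w 1) + q * (D2 F * w 3 - D3 F * w 2) + r * (D3 F * w 1 - D1 F * w 3)"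
    for F and w :: "3 \<Rightarrow> 3 pseries"
  define B where "B G H i = ps_bracket (ps_deriv i p) (ps_deriv i q) (ps_deriv i r) G H" for G H i
  define C where "C G H i = ps_bracket p q r (ps_deriv i G) H + ps_bracket p q r G (ps_deriv i H)" for G H i
  have split: "ps_bracket p q r F (ps_bracket p q r G H) = V F (B G H) + V F (C G H)" for F G H
  proof -
    have "ps_deriv i (ps_bracket p q r G H) = B G H i + C G H i" for i
      by (simp add: ps_bracket_def B_def C_def ps_deriv_commute[of _ i] algebra_simps)
    then show ?thesis
      unfolding ps_bracket_def[of p q r F] V_def by (simp add: algebra_simps)
  qed
  have "V F (B G H) + V G (B H F) + V H (B F G) =
     (p * D2 q - r * D3 q + q * D3 r - p * D1 r + r * D1 p - q * D2 p) *
     (D1 F * (D2 G * D3 H - D3 G * D2 H) + D2 F * (D3 G * D1 H - D1 G * D3 H)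
       + D3 F * (D1 G * D2 H - D2 G * D1 H))"
    unfolding V_def B_def ps_bracket_def by (simp add: algebra_simps)
  then have B: "V F (B G H) + V G (B H F) + V H (B F G) = 0"
    unfolding assms by simp
  have C: "V F (C G H) + V G (C H F) + V H (C F G) = 0"
    unfolding V_def C_def ps_bracket_def by (simp add: D_commute algebra_simps)
  have "ps_bracket p q r F (ps_bracket p q r G H) + ps_bracket p q r G (ps_bracket p q r H F)
     + ps_bracket p q r H (ps_bracket p q r F G) =
    (V F (B G H) + V G (B H F) + V H (B F G)) + (V F (C G H) + V G (C H F) + V H (C F G))"
    unfolding split by (simp only: ac_simps)
  then show ?thesis
    unfolding B C by simp
qed

lemma ps_ord_bracket:
  assumes "ps_ord 1 p" "ps_ord 1 q" "ps_ord 1 r" "ps_ord k F" "ps_ord l G" "k \<ge> 1" "l \<ge> 1" "n < k + l"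
  shows "ps_ord n (ps_bracket p q r F G)"
proof -
  have "ps_ord (1 + ((k - 1) + (l - 1))) (a * (ps_deriv i F * ps_deriv j G - ps_deriv j F * ps_deriv i G))"
    if "ps_ord 1 a" for a i j
    using assms that by (intro ps_ord_mult ps_ord_simps ps_ord_deriv)
  then have "ps_ord (1 + ((k - 1) + (l - 1))) (ps_bracket p q r F G)"
    unfolding ps_bracket_def using assms(1-3) by (intro ps_ord_simps)
  then show ?thesis by (rule ps_ord_mono) (use assms(6-8) in simp)
qed

text \<open>
  The Hamiltonian derivations of the coordinates for the linear Poisson structure \<open>{x,y} = z\<close>, \<open>{y,z} = a x\<close>,
  \<open>{z,x} = b y\<close>. They represent its Lie algebra; for \<open>a = b = 1\<close> they are the infinitesimal rotations.
\<close>

definition rot1 :: "real \<Rightarrow> 3 pseries \<Rightarrow> 3 pseries" where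
  "rot1 b F = X3 * D2 F - ps_const b * X2 * D3 F"

definition rot2 :: "real \<Rightarrow> 3 pseries \<Rightarrow> 3 pseries" where
  "rot2 a F = ps_const a * X1 * D3 F - X3 * D1 F"

definition rot3 :: "real \<Rightarrow> real \<Rightarrow> 3 pseries \<Rightarrow> 3 pseries" where
  "rot3 a b F = ps_const b * X2 * D1 F - ps_const a * X1 * D2 F"

lemma rot_simps:
  "rot1 b (F + G) = rot1 b F + rot1 b G" "rot1 b (F - G) = rot1 b F - rot1 b G" "rot1 b (- F) = - rot1 b F"
  "rot2 a (F + G) = rot2 a F + rot2 a G" "rot2 a (F - G) = rot2 a F - rot2 a G" "rot2 a (- F) = - rot2 a F"
  "rot3 a b (F + G) = rot3 a b F + rot3 a b G" "rot3 a b (F - G) = rot3 a b F - rot3 a b G"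
  "rot3 a b (- F) = - rot3 a b F"
  "rot1 b (ps_const c * F) = ps_const c * rot1 b F" "rot2 a (ps_const c * F) = ps_const c * rot2 a F"
  "rot3 a b (ps_const c * F) = ps_const c * rot3 a b F"
  "rot1 b 0 = 0" "rot2 a 0 = 0" "rot3 a b 0 = 0"
  by (simp_all add: rot1_def rot2_def rot3_def algebra_simps)

lemma rot_commutators:
  "rot1 b (rot2 a F) - rot2 a (rot1 b F) = rot3 a b F"
  "rot2 a (rot3 a b F) - rot3 a b (rot2 a F) = ps_const a * rot1 b F"
  "rot3 a b (rot1 b F) - rot1 b (rot3 a b F) = ps_const b * rot2 a F"
  by (simp_all add: rot1_def rot2_def rot3_def D_commute ps_deriv_var algebra_simps)

text \<open>
  The quadratic Casimir function of the linear Poisson structure, and below it the second order operator given by the dual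
  quadratic form, scaled by \<open>a b\<close>. Both commute with the rotations.
\<close>

definition quadric :: "real \<Rightarrow> real \<Rightarrow> 3 pseries" where
  "quadric a b = ps_const a * X1 * X1 + ps_const b * X2 * X2 + X3 * X3"

definition laplace :: "real \<Rightarrow> real \<Rightarrow> 3 pseries \<Rightarrow> 3 pseries" where
  "laplace a b F = ps_const b * D1 (D1 F) + ps_const a * D2 (D2 F) + ps_const a * ps_const b * D3 (D3 F)"

lemma rot_quadric:
  "rot1 b (quadric a b * F) = quadric a b * rot1 b F"
  "rot2 a (quadric a b * F) = quadric a b * rot2 a F"
  "rot3 a b (quadric a b * F) = quadric a b * rot3 a b F"
  by (simp_all add: rot1_def rot2_def rot3_def quadric_def ps_deriv_var algebra_simps)

lemma rot_laplace:
  "rot1 b (laplace a b F) = laplace a b (rot1 b F)"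
  "rot2 a (laplace a b F) = laplace a b (rot2 a F)"
  "rot3 a b (laplace a b F) = laplace a b (rot3 a b F)"
  by (simp_all add: rot1_def rot2_def rot3_def laplace_def D_commute ps_deriv_var algebra_simps)

lemma laplace_simps: "laplace a b (F + G) = laplace a b F + laplace a b G" "laplace a b 0 = 0"
  by (simp_all add: laplace_def algebra_simps)

lemma euler3:
  assumes "ps_hom k F"
  shows "X1 * D1 F + X2 * D2 F + X3 * D3 F = ps_const (real k) * F"
  using ps_euler[OF assms] by (simp add: sum_3)

text \<open>
  Expanding the squares gives \<open>Q \<Delta> - a b (E E + E)\<close>, where \<open>E\<close> is the Euler field, as in the decomposition of the Laplace operator of
  Euclidean space into its radial and angular parts; and \<open>E\<close> is multiplication by \<open>k\<close> in degree \<open>k\<close>.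
\<close>

lemma casimir:
  assumes "ps_hom k F"
  shows "ps_const a * rot1 b (rot1 b F) + ps_const b * rot2 a (rot2 a F) + rot3 a b (rot3 a b F)
    = quadric a b * laplace a b F - ps_const (a * b * (real k * (real k + 1))) * F"
proof -
  define E where "E G = X1 * D1 G + X2 * D2 G + X3 * D3 G" for G
  have "ps_const a * rot1 b (rot1 b F) + ps_const b * rot2 a (rot2 a F) + rot3 a b (rot3 a b F)
    = quadric a b * laplace a b F - ps_const a * ps_const b * (E (E F) + E F)"
    by (simp add: rot1_def rot2_def rot3_def laplace_def quadric_def E_def D_commute ps_deriv_var algebra_simps)
  also have "E F = ps_const (real k) * F"
    using euler3[OF assms] by (simp add: E_def)
  also have "E (ps_const (real k) * F) = ps_const (real k) * (ps_const (real k) * F)"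
    using euler3[OF ps_hom_simps(5)[OF assms]] by (simp add: E_def)
  also have "ps_const a * ps_const b * (ps_const (real k) * (ps_const (real k) * F) + ps_const (real k) * F)
    = ps_const (a * b * (real k * (real k + 1))) * F"
    by (rule pseries_eqI) (simp only: mult.assoc distrib_left ps_coeff_const_mult ps_coeff_add, simp add: algebra_simps)
  finally show ?thesis .
qed

text \<open>
  Whitehead's second lemma: a 2-cocycle \<open>e\<close> with values in homogeneous polynomials is a coboundary. Write \<open>d\<close> for the
  coboundary operator of the conclusion. The cochain \<open>(b1, b2, b3)\<close> in the proof has the coboundary \<open>- C e\<close>, where \<open>C\<close>
  is the Casimir operator acting on each component, and by \<open>casimir\<close> this is \<open>\<kappa> e - Q \<Delta> e\<close> with a scalar \<open>\<kappa>\<close> that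
  is nonzero for \<open>k > 0\<close>. The components of \<open>\<Delta> e\<close> have degree \<open>k - 2\<close> and satisfy the cocycle condition again, and a solution
  for \<open>\<Delta> e\<close> times the invariant \<open>Q\<close> is a solution for \<open>Q \<Delta> e\<close>.
\<close>

lemma whitehead:
  fixes a b :: real
  assumes ab: "a \<noteq> 0" "b \<noteq> 0"
    and "ps_hom k e1" "ps_hom k e2" "ps_hom k e3"
    and "rot1 b e1 + rot2 a e2 + rot3 a b e3 = 0"
  shows "\<exists>a1 a2 a3. ps_hom k a1 \<and> ps_hom k a2 \<and> ps_hom k a3 \<and>
    rot2 a a3 - rot3 a b a2 - ps_const a * a1 = e1 \<and>
    rot3 a b a1 - rot1 b a3 - ps_const b * a2 = e2 \<and>
    rot1 b a2 - rot2 a a1 - a3 = e3"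
  using assms(3-)
proof (induction k arbitrary: e1 e2 e3 rule: less_induct)
  case (less k)
  note hom = less.prems(1-3) and closed = less.prems(4)
  have mult_hom: "ps_hom n (ps_var i * ps_deriv j F)" if "ps_hom n F" for n i j and F :: "3 pseries"
  proof (cases "n = 0")
    case True then show ?thesis using ps_hom_0_deriv[of F] that by simp
  next
    case False then show ?thesis using ps_hom_mult[OF ps_hom_var[of i] ps_hom_deriv[OF that, of j]] by simp
  qed
  have rot_hom: "ps_hom n (rot1 b F)" "ps_hom n (rot2 a F)" "ps_hom n (rot3 a b F)" if "ps_hom n F" for n F
    using mult_hom[OF that] by (auto simp: rot1_def rot2_def rot3_def mult.assoc)
  show ?case
  proof (cases "k = 0")
    case True
    have D: "ps_deriv i e1 = 0" "ps_deriv i e2 = 0" "ps_deriv i e3 = 0" for i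
      using hom ps_hom_0_deriv True by auto
    have inv: "ps_const c * (ps_const (1 / c) * F) = F" if "c \<noteq> 0" for c and F :: "3 pseries"
      by (rule pseries_eqI) (use that in simp)
    have "rot1 b (ps_const c * e) = 0" "rot2 a (ps_const c * e) = 0" "rot3 a b (ps_const c * e) = 0"
      if "e \<in> {e1, e2, e3}" for c e
      using that by (auto simp: rot1_def rot2_def rot3_def D)
    note rot0 = this this[of _ 1, simplified]
    show ?thesis
      by (rule exI[of _ "- (ps_const (1 / a) * e1)"], rule exI[of _ "- (ps_const (1 / b) * e2)"], rule exI[of _ "- e3"], intro conjI)
        (use hom in \<open>simp_all add: rot0 rot_simps inv ab\<close>)
  next
    case False
    \<comment> \<open>the eigenvalue part of the Casimir operator; it vanishes for \<open>k = 0\<close>, the case treated above\<close>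
    define \<kappa> where "\<kappa> = a * b * (real k * (real k + 1))"
    have \<kappa>: "\<kappa> \<noteq> 0" using ab False by (simp add: \<kappa>_def add_nonneg_eq_0_iff)
    have lap_hom: "ps_hom (k - 2) (laplace a b F)" if "ps_hom k F" for F
    proof -
      have "ps_hom (k - 2) (ps_deriv i (ps_deriv i F))" for i
        using ps_hom_deriv[OF ps_hom_deriv[OF that]] by (simp add: numeral_2_eq_2)
      then show ?thesis by (simp add: laplace_def mult.assoc)
    qed
    \<comment> \<open>a solution for the cocycle of the Laplacians; for \<open>k = 1\<close> the Laplacians are zero\<close>
    obtain a1 a2 a3 where A: "ps_hom k (quadric a b * a1)" "ps_hom k (quadric a b * a2)" "ps_hom k (quadric a b * a3)"
      "rot2 a a3 - rot3 a b a2 - ps_const a * a1 = laplace a b e1"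
      "rot3 a b a1 - rot1 b a3 - ps_const b * a2 = laplace a b e2"
      "rot1 b a2 - rot2 a a1 - a3 = laplace a b e3"
    proof (cases "k = 1")
      case True
      have "ps_deriv i (ps_deriv j e1) = 0" "ps_deriv i (ps_deriv j e2) = 0" "ps_deriv i (ps_deriv j e3) = 0" for i j
        using hom True by (auto intro!: ps_hom_0_deriv dest: ps_hom_deriv)
      then show thesis by (intro that[of 0 0 0]) (simp_all add: rot_simps laplace_def)
    next
      case k1: False
      have "rot1 b (laplace a b e1) + rot2 a (laplace a b e2) + rot3 a b (laplace a b e3) = 0"
        using closed by (simp only: rot_laplace laplace_simps(1)[symmetric] laplace_simps(2))
      with less.IH[of "k - 2"] lap_hom hom False obtain a1 a2 a3 where
        A: "ps_hom (k - 2) a1" "ps_hom (k - 2) a2" "ps_hom (k - 2) a3"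
      "rot2 a a3 - rot3 a b a2 - ps_const a * a1 = laplace a b e1"
      "rot3 a b a1 - rot1 b a3 - ps_const b * a2 = laplace a b e2"
      "rot1 b a2 - rot2 a a1 - a3 = laplace a b e3"
        by (metis diff_less gr0I zero_less_numeral)
      have "ps_hom (1 + 1) (quadric a b)"
        unfolding quadric_def mult.assoc by (intro ps_hom_simps ps_hom_mult ps_hom_var)
      then have "ps_hom k (quadric a b * F)" if "ps_hom (k - 2) F" for F
      proof -
        have "k = 1 + 1 + (k - 2)" using k1 False by simp
        with ps_hom_mult[OF \<open>ps_hom (1 + 1) (quadric a b)\<close> that] show ?thesis by metis
      qed
      with A show thesis by (intro that) auto
    qed
    \<comment> \<open>the curl of the cocycle, with weights adapted to the structure constants\<close>
    define b1 where "b1 = ps_const b * rot2 a e3 - rot3 a b e2"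
    define b2 where "b2 = rot3 a b e1 - ps_const a * rot1 b e3"
    define b3 where "b3 = ps_const a * rot1 b e2 - ps_const b * rot2 a e1"
    note cas = casimir[of k _ a b, folded \<kappa>_def]
    have c12: "rot2 a (rot1 b F) = rot1 b (rot2 a F) - rot3 a b F" for F
      using rot_commutators(1)[of b a F] by (simp add: algebra_simps)
    have c23: "rot3 a b (rot2 a F) = rot2 a (rot3 a b F) - ps_const a * rot1 b F" for F
      using rot_commutators(2)[of a b F] by (simp add: algebra_simps)
    have c31: "rot1 b (rot3 a b F) = rot3 a b (rot1 b F) - ps_const b * rot2 a F" for F
      using rot_commutators(3)[of a b F] by (simp add: algebra_simps)
    have e1: "rot1 b e1 = - rot2 a e2 - rot3 a b e3" and e2: "rot2 a e2 = - rot1 b e1 - rot3 a b e3"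
      and e3: "rot3 a b e3 = - rot1 b e1 - rot2 a e2"
      using closed by (simp_all add: algebra_simps eq_neg_iff_add_eq_0)
    have B1: "rot2 a b3 - rot3 a b b2 - ps_const a * b1 = ps_const \<kappa> * e1 - quadric a b * laplace a b e1"
    proof -
      have "rot2 a b3 - rot3 a b b2 - ps_const a * b1 = ps_const a * rot1 b (rot1 b e1 + rot2 a e2 + rot3 a b e3)
        - (ps_const a * rot1 b (rot1 b e1) + ps_const b * rot2 a (rot2 a e1) + rot3 a b (rot3 a b e1))"
        by (simp add: b1_def b2_def b3_def rot_simps c12 c31 algebra_simps)
      then show ?thesis by (simp add: closed cas[OF hom(1)] rot_simps)
    qed
    have B2: "rot3 a b b1 - rot1 b b3 - ps_const b * b2 = ps_const \<kappa> * e2 - quadric a b * laplace a b e2"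
    proof -
      have "rot3 a b b1 - rot1 b b3 - ps_const b * b2 = ps_const b * rot2 a (rot1 b e1 + rot2 a e2 + rot3 a b e3)
        - (ps_const a * rot1 b (rot1 b e2) + ps_const b * rot2 a (rot2 a e2) + rot3 a b (rot3 a b e2))"
        by (simp add: b1_def b2_def b3_def rot_simps c12 c23 algebra_simps)
      then show ?thesis by (simp add: closed cas[OF hom(2)] rot_simps)
    qed
    have B3: "rot1 b b2 - rot2 a b1 - b3 = ps_const \<kappa> * e3 - quadric a b * laplace a b e3"
    proof -
      have "rot1 b b2 - rot2 a b1 - b3 = rot3 a b (rot1 b e1 + rot2 a e2 + rot3 a b e3)
        - (ps_const a * rot1 b (rot1 b e3) + ps_const b * rot2 a (rot2 a e3) + rot3 a b (rot3 a b e3))"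
        by (simp add: b1_def b2_def b3_def rot_simps c23 c31 algebra_simps)
      then show ?thesis by (simp add: closed cas[OF hom(3)] rot_simps)
    qed
    define f where "f u v = ps_const (1 / \<kappa>) * (quadric a b * u + v)" for u v
    have inv: "ps_const (1 / \<kappa>) * (ps_const \<kappa> * F) = F" for F :: "3 pseries"
      by (rule pseries_eqI) (use \<kappa> in simp)
    have lin: "g1 (f a2 b2) - g2 (f a1 b1) - ps_const c * f a3 b3 = ps_const (1 / \<kappa>) *
        (quadric a b * (g1 a2 - g2 a1 - ps_const c * a3) + (g1 b2 - g2 b1 - ps_const c * b3))"
      if "\<And>F G. g1 (F + G) = g1 F + g1 G" "\<And>c F. g1 (ps_const c * F) = ps_const c * g1 F"
        "\<And>F. g1 (quadric a b * F) = quadric a b * g1 F"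
        "\<And>F G. g2 (F + G) = g2 F + g2 G" "\<And>c F. g2 (ps_const c * F) = ps_const c * g2 F"
        "\<And>F. g2 (quadric a b * F) = quadric a b * g2 F" for g1 g2 c a1 a2 a3 b1 b2 b3
      unfolding f_def that by (simp add: algebra_simps)
    show ?thesis
    proof (intro exI conjI)
      show "ps_hom k (f a1 b1)" "ps_hom k (f a2 b2)" "ps_hom k (f a3 b3)"
        using hom A(1-3) rot_hom by (simp_all add: f_def b1_def b2_def b3_def)
      show "rot2 a (f a3 b3) - rot3 a b (f a2 b2) - ps_const a * f a1 b1 = e1"
        by (subst lin) (simp_all add: rot_simps rot_quadric A B1 inv)
      show "rot3 a b (f a1 b1) - rot1 b (f a3 b3) - ps_const b * f a2 b2 = e2"
        by (subst lin) (simp_all add: rot_simps rot_quadric A B2 inv)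
      show "rot1 b (f a2 b2) - rot2 a (f a1 b1) - f a3 b3 = e3"
        using lin[of "rot1 b" "rot2 a" a2 b2 a1 b1 1 a3 b3] by (simp add: rot_simps rot_quadric A B3 inv)
    qed
  qed
qed

section \<open>Levi factors of formal Poisson algebras\<close>

text \<open>
  A formal Poisson structure whose linear part is \<open>{x,y} = z\<close>, \<open>{y,z} = a x\<close>, \<open>{z,x} = b y\<close>.
\<close>

locale levi_lift =
  fixes a b :: real and p q r :: "3 pseries"
  assumes a0: "a \<noteq> 0" and b0: "b \<noteq> 0"
    and p: "ps_ord 2 (p - X3)" and q: "ps_ord 2 (q - ps_const a * X1)" and r: "ps_ord 2 (r - ps_const b * X2)"
    and jacobi: "p * D2 q - r * D3 q + q * D3 r - p * D1 r + r * D1 p - q * D2 p = 0"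
begin

abbreviation "br \<equiv> ps_bracket p q r"

lemma ord_X: "ps_ord 1 (ps_var i)"
  by (rule ps_hom_ord[OF ps_hom_var])

lemma ord1: "ps_ord 1 p" "ps_ord 1 q" "ps_ord 1 r"
proof -
  have *: "ps_ord 1 F" if "ps_ord 2 (F - G)" "ps_ord 1 G" for F G :: "3 pseries"
    using ps_ord_simps(2)[OF ps_ord_mono[OF that(1), of 1] that(2)] by simp
  show "ps_ord 1 p" "ps_ord 1 q" "ps_ord 1 r"
    by (rule *[OF p ord_X] *[OF q ps_ord_simps(5)[OF ord_X]] *[OF r ps_ord_simps(5)[OF ord_X]])+
qed

lemma ord_br: "ps_ord k F \<Longrightarrow> ps_ord l G \<Longrightarrow> k \<ge> 1 \<Longrightarrow> l \<ge> 1 \<Longrightarrow> n < k + l \<Longrightarrow> ps_ord n (br F G)"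
  by (rule ps_ord_bracket[OF ord1])

lemma ord_mult_D: "ps_ord 2 F \<Longrightarrow> ps_ord n G \<Longrightarrow> ps_ord (Suc n) (F * ps_deriv i G)"
  using ps_ord_mult[of 2 F "n - 1" "ps_deriv i G"] ps_ord_deriv[of n G i] by (auto elim: ps_ord_mono)

text \<open>
  To lowest order, bracketing with a series that starts with a coordinate is the corresponding rotation, because
  the other terms of that series and of \<open>p, q, r\<close> raise the order.
\<close>

lemma br_rot:
  assumes "ps_ord n G" "n \<ge> 1"
  shows "ps_ord 2 (F - X1) \<Longrightarrow> ps_ord (Suc n) (br F G - rot1 b G)"
    and "ps_ord 2 (F - X2) \<Longrightarrow> ps_ord (Suc n) (br F G - rot2 a G)"
    and "ps_ord 2 (F - X3) \<Longrightarrow> ps_ord (Suc n) (br F G - rot3 a b G)"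
proof -
  note * = p q r assms ord_br[of 2 "F - ps_var _" n G "Suc n"]
  have "br F G - rot1 b G = br (F - X1) G + ((p - X3) * D2 G - (r - ps_const b * X2) * D3 G)"
    by (simp add: ps_bracket_simps(3)) (simp add: ps_bracket_def rot1_def ps_deriv_var algebra_simps)
  then show "ps_ord 2 (F - X1) \<Longrightarrow> ps_ord (Suc n) (br F G - rot1 b G)"
    using * by (auto intro!: ps_ord_simps ord_mult_D simp del: ps_ord_simps)
  have "br F G - rot2 a G = br (F - X2) G + ((q - ps_const a * X1) * D3 G - (p - X3) * D1 G)"
    by (simp add: ps_bracket_simps(3)) (simp add: ps_bracket_def rot2_def ps_deriv_var algebra_simps)
  then show "ps_ord 2 (F - X2) \<Longrightarrow> ps_ord (Suc n) (br F G - rot2 a G)"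
    using * by (auto intro!: ps_ord_simps ord_mult_D simp del: ps_ord_simps)
  have "br F G - rot3 a b G = br (F - X3) G + ((r - ps_const b * X2) * D1 G - (q - ps_const a * X1) * D2 G)"
    by (simp add: ps_bracket_simps(3)) (simp add: ps_bracket_def rot3_def ps_deriv_var algebra_simps)
  then show "ps_ord 2 (F - X3) \<Longrightarrow> ps_ord (Suc n) (br F G - rot3 a b G)"
    using * by (auto intro!: ps_ord_simps ord_mult_D simp del: ps_ord_simps)
qed

lemma rot_ord:
  assumes "ps_ord n G" 
  shows "ps_ord n (rot1 b G)" "ps_ord n (rot2 a G)" "ps_ord n (rot3 a b G)"
proof -
  have "ps_ord n (ps_var i * ps_deriv j G)" for i j
    using ps_ord_mult[OF ord_X[of i] ps_ord_deriv[OF assms, of j]] by (rule ps_ord_mono) simp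
  then show "ps_ord n (rot1 b G)" "ps_ord n (rot2 a G)" "ps_ord n (rot3 a b G)"
    by (simp_all add: rot1_def rot2_def rot3_def mult.assoc)
qed

text \<open>
  The errors \<open>E\<^sub>i\<close> in the three relations satisfy \<open>{F\<^sub>1,E\<^sub>1} + {F\<^sub>2,E\<^sub>2} + {F\<^sub>3,E\<^sub>3} = 0\<close> by the Jacobi identity. The parts
  of degree \<open>n\<close> of the errors therefore form a cocycle, and a cochain whose coboundary is minus this
  cocycle corrects the \<open>F\<^sub>i\<close> so that the errors start one degree later.
\<close>

lemma lift_step:
  assumes n: "n \<ge> 2"
    and F: "ps_ord 2 (F1 - X1)" "ps_ord 2 (F2 - X2)" "ps_ord 2 (F3 - X3)"
    and E: "ps_ord n (br F2 F3 - ps_const a * F1)" "ps_ord n (br F3 F1 - ps_const b * F2)" "ps_ord n (br F1 F2 - F3)"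
  obtains a1 a2 a3 where "ps_ord n a1" "ps_ord n a2" "ps_ord n a3"
    "ps_ord (Suc n) (br (F2 + a2) (F3 + a3) - ps_const a * (F1 + a1))"
    "ps_ord (Suc n) (br (F3 + a3) (F1 + a1) - ps_const b * (F2 + a2))"
    "ps_ord (Suc n) (br (F1 + a1) (F2 + a2) - (F3 + a3))"
proof -
  define E1 where "E1 = br F2 F3 - ps_const a * F1"
  define E2 where "E2 = br F3 F1 - ps_const b * F2"
  define E3 where "E3 = br F1 F2 - F3"
  have n1: "n \<ge> 1" using n by simp
  have "br F1 E1 + br F2 E2 + br F3 E3 = br F1 (br F2 F3) + br F2 (br F3 F1) + br F3 (br F1 F2)"
    by (simp add: E1_def E2_def E3_def ps_bracket_simps)
  then have sum0: "br F1 E1 + br F2 E2 + br F3 E3 = 0"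
    using ps_bracket_jacobi[OF jacobi] by simp
  define e1 where "e1 = ps_part n E1"
  define e2 where "e2 = ps_part n E2"
  define e3 where "e3 = ps_part n E3"
  have e: "ps_hom n e1" "ps_hom n e2" "ps_hom n e3"
    by (simp_all add: e1_def e2_def e3_def ps_hom_part)
  have d: "ps_ord (Suc n) (E1 - e1)" "ps_ord (Suc n) (E2 - e2)" "ps_ord (Suc n) (E3 - e3)"
    unfolding e1_def e2_def e3_def using E[folded E1_def E2_def E3_def] by (auto intro: ps_ord_part)
  have "ps_ord (Suc n) (rot1 b e1 + rot2 a e2 + rot3 a b e3)"
  proof -
    have "rot1 b e1 + rot2 a e2 + rot3 a b e3 = - (rot1 b (E1 - e1) + rot2 a (E2 - e2) + rot3 a b (E3 - e3))
      - ((br F1 E1 - rot1 b E1) + (br F2 E2 - rot2 a E2) + (br F3 E3 - rot3 a b E3))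
      + (br F1 E1 + br F2 E2 + br F3 E3)"
      by (simp add: rot_simps)
    then show ?thesis
      unfolding sum0
      using rot_ord d br_rot(1)[OF E(1)[folded E1_def] n1 F(1)] br_rot(2)[OF E(2)[folded E2_def] n1 F(2)]
        br_rot(3)[OF E(3)[folded E3_def] n1 F(3)] by simp
  qed
  moreover have "ps_hom n (rot1 b e1 + rot2 a e2 + rot3 a b e3)"
  proof -
    have "ps_hom n (ps_var i * ps_deriv j G)" if "ps_hom n G" for i j and G :: "3 pseries"
      using ps_hom_mult[OF ps_hom_var[of i] ps_hom_deriv[OF that, of j]] n by simp
    then show ?thesis using e by (simp add: rot1_def rot2_def rot3_def mult.assoc)
  qed
  ultimately have "rot1 b e1 + rot2 a e2 + rot3 a b e3 = 0"
    by (intro ps_hom_ord_0)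
  moreover have "rot1 b (- e1) + rot2 a (- e2) + rot3 a b (- e3) = - (rot1 b e1 + rot2 a e2 + rot3 a b e3)"
    by (simp add: rot_simps)
  ultimately have "rot1 b (- e1) + rot2 a (- e2) + rot3 a b (- e3) = 0"
    by simp
  from whitehead[OF a0 b0 _ _ _ this, of n] e
  obtain a1 a2 a3 where h: "ps_hom n a1" "ps_hom n a2" "ps_hom n a3"
    and A: "rot2 a a3 - rot3 a b a2 - ps_const a * a1 = - e1"
    "rot3 a b a1 - rot1 b a3 - ps_const b * a2 = - e2"
    "rot1 b a2 - rot2 a a1 - a3 = - e3"
    by auto
  note o = h[THEN ps_hom_ord]
  \<comment> \<open>the bracket of two corrections has order at least \<open>2 n - 1\<close>, which exceeds \<open>n\<close> because \<open>n \<ge> 2\<close>\<close>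
  have quad: "ps_ord (Suc n) (br u v)" if "ps_ord n u" "ps_ord n v" for u v
    using ord_br[OF that] n by simp
  have step: "br (F + u) (G + v) - (H + w) = (E - e) + (br F v - g v) - (br G u - h u) + br u v"
    if "E = br F G - H" "g v - h u - w = - e" for F G H u v w E e g h
  proof -
    have "w = g v - h u + e" using that(2) by (simp add: algebra_simps)
    then show ?thesis by (simp add: that(1) ps_bracket_simps ps_bracket_antisym[of _ _ _ u G])
  qed
  show thesis
  proof (rule that[OF o])
    show "ps_ord (Suc n) (br (F2 + a2) (F3 + a3) - ps_const a * (F1 + a1))"
      unfolding distrib_left step[where g = "rot2 a" and h = "rot3 a b", OF E1_def A(1)]
      using d(1) br_rot(2)[OF o(3) n1 F(2)] br_rot(3)[OF o(2) n1 F(3)] quad[OF o(2,3)] by simp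
    show "ps_ord (Suc n) (br (F3 + a3) (F1 + a1) - ps_const b * (F2 + a2))"
      unfolding distrib_left step[where g = "rot3 a b" and h = "rot1 b", OF E2_def A(2)]
      using d(2) br_rot(3)[OF o(1) n1 F(3)] br_rot(1)[OF o(3) n1 F(1)] quad[OF o(3,1)] by simp
    show "ps_ord (Suc n) (br (F1 + a1) (F2 + a2) - (F3 + a3))"
      unfolding step[where g = "rot1 b" and h = "rot2 a", OF E3_def A(3)]
      using d(3) br_rot(1)[OF o(2) n1 F(1)] br_rot(2)[OF o(1) n1 F(2)] quad[OF o(1,2)] by simp
  qed
qed

end

text \<open>
  Consecutive terms agree below degree \<open>n + 2\<close>, so the coefficient of \<open>\<alpha>\<close> does not change any more from index \<open>deg \<alpha>\<close>
  on; this is why the diagonal choice of coefficients is the limit.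
\<close>

lemma ps_limit:
  fixes F :: "nat \<Rightarrow> 'n::finite pseries"
  assumes "\<And>n. ps_ord (n + 2) (F (Suc n) - F n)"
  shows "ps_ord (n + 2) (PSeries (\<lambda>\<alpha>. ps_coeff (F (deg \<alpha>)) \<alpha>) - F n)"
proof -
  have mono: "ps_ord (m + 2) (F (m + k) - F m)" for m k
  proof (induction k)
    case (Suc k)
    have eq: "F (m + Suc k) - F m = (F (Suc (m + k)) - F (m + k)) + (F (m + k) - F m)" by simp
    show ?case
      unfolding eq by (rule ps_ord_simps(2)[OF ps_ord_mono[OF assms[of "m + k"]] Suc]) simp
  qed simp
  show ?thesis
    unfolding ps_ord_def
  proof (intro allI impI)
    fix \<alpha> :: "'n \<Rightarrow> nat" assume \<alpha>: "deg \<alpha> < n + 2"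
    have "ps_coeff (F (deg \<alpha>)) \<alpha> = ps_coeff (F n) \<alpha>"
    proof (cases "n \<le> deg \<alpha>")
      case True
      then show ?thesis using mono[of n "deg \<alpha> - n"] \<alpha> by (auto simp: ps_ord_def)
    next
      case False
      then show ?thesis using mono[of "deg \<alpha>" "n - deg \<alpha>"] by (auto simp: ps_ord_def)
    qed
    then show "ps_coeff (PSeries (\<lambda>\<alpha>. ps_coeff (F (deg \<alpha>)) \<alpha>) - F n) \<alpha> = 0" by simp
  qed
qed

context levi_lift
begin

lemma levi_factor:
  obtains F1 F2 F3 where "ps_ord 2 (F1 - X1)" "ps_ord 2 (F2 - X2)" "ps_ord 2 (F3 - X3)"
    "br F1 F2 = F3" "br F2 F3 = ps_const a * F1" "br F3 F1 = ps_const b * F2"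
proof -
  \<comment> \<open>after \<open>n\<close> steps the errors have order \<open>n + 2\<close>: the coordinates themselves have errors of order 2\<close>
  define good where "good n = (\<lambda>(F1, F2, F3). ps_ord 2 (F1 - X1) \<and> ps_ord 2 (F2 - X2) \<and> ps_ord 2 (F3 - X3) \<and>
    ps_ord (n + 2) (br F2 F3 - ps_const a * F1) \<and> ps_ord (n + 2) (br F3 F1 - ps_const b * F2) \<and>
    ps_ord (n + 2) (br F1 F2 - F3))" for n
  define close :: "nat \<Rightarrow> 3 pseries \<times> 3 pseries \<times> 3 pseries \<Rightarrow> 3 pseries \<times> 3 pseries \<times> 3 pseries \<Rightarrow> bool"
    where "close n = (\<lambda>(F1, F2, F3) (G1, G2, G3). ps_ord (n + 2) (G1 - F1) \<and> ps_ord (n + 2) (G2 - F2)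
    \<and> ps_ord (n + 2) (G3 - F3))" for n
  have "\<exists>F. \<forall>n. good n (F n) \<and> close n (F n) (F (Suc n))"
  proof (rule dependent_nat_choice)
    have "good 0 (X1, X2, X3)"
      using p q r by (simp add: good_def ps_bracket_def ps_deriv_var numeral_2_eq_2)
    then show "\<exists>x. good 0 x" ..
    fix F n assume "good n F"
    then obtain F1 F2 F3 where F: "F = (F1, F2, F3)"
      "ps_ord 2 (F1 - X1)" "ps_ord 2 (F2 - X2)" "ps_ord 2 (F3 - X3)"
      "ps_ord (n + 2) (br F2 F3 - ps_const a * F1)" "ps_ord (n + 2) (br F3 F1 - ps_const b * F2)"
      "ps_ord (n + 2) (br F1 F2 - F3)"
      by (cases F) (auto simp: good_def)
    from lift_step[OF _ this(2-7)] obtain a1 a2 a3 where A: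
      "ps_ord (n + 2) a1" "ps_ord (n + 2) a2" "ps_ord (n + 2) a3"
      "ps_ord (Suc (n + 2)) (br (F2 + a2) (F3 + a3) - ps_const a * (F1 + a1))"
      "ps_ord (Suc (n + 2)) (br (F3 + a3) (F1 + a1) - ps_const b * (F2 + a2))"
      "ps_ord (Suc (n + 2)) (br (F1 + a1) (F2 + a2) - (F3 + a3))"
      by (metis le_add2)
    have "ps_ord 2 (G + u - x)" if "ps_ord 2 (G - x)" "ps_ord (n + 2) u" for G u x :: "3 pseries"
      using ps_ord_simps(2)[OF that(1) ps_ord_mono[OF that(2), of 2]] by (simp add: algebra_simps)
    with A F have "good (Suc n) (F1 + a1, F2 + a2, F3 + a3)" "close n F (F1 + a1, F2 + a2, F3 + a3)"
      by (auto simp: good_def close_def)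
    then show "\<exists>G. good (Suc n) G \<and> close n F G" by blast
  qed
  then obtain F where F: "\<And>n. good n (F n)" "\<And>n. close n (F n) (F (Suc n))" by blast
  define F1 F2 F3 where "F1 n = fst (F n)" and "F2 n = fst (snd (F n))" and "F3 n = snd (snd (F n))" for n
  have F_eq: "F n = (F1 n, F2 n, F3 n)" for n
    by (simp add: F1_def F2_def F3_def)
  note good = F(1)[unfolded F_eq good_def prod.case] and close = F(2)[unfolded F_eq close_def prod.case]
  define L where "L G = PSeries (\<lambda>\<alpha>. ps_coeff (G (deg \<alpha>)) \<alpha>)" for G :: "nat \<Rightarrow> 3 pseries"
  have lim: "ps_ord (n + 2) (L F1 - F1 n)" "ps_ord (n + 2) (L F2 - F2 n)" "ps_ord (n + 2) (L F3 - F3 n)" for n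
    unfolding L_def by (rule ps_limit; use close in blast)+
  have X: "ps_ord 2 (L F1 - X1)" "ps_ord 2 (L F2 - X2)" "ps_ord 2 (L F3 - X3)"
  proof -
    have *: "ps_ord 2 (G - x)" if "ps_ord (0 + 2) (G - H)" "ps_ord 2 (H - x)" for G H x :: "3 pseries"
      using ps_ord_simps(2)[of 2 "G - H" "H - x"] that by (simp add: numeral_2_eq_2)
    show "ps_ord 2 (L F1 - X1)" "ps_ord 2 (L F2 - X2)" "ps_ord 2 (L F3 - X3)"
      using lim[of 0] good[of 0] * by blast+
  qed
  have one: "ps_ord 1 G" if "ps_ord 2 (G - ps_var i)" for G :: "3 pseries" and i
    using ps_ord_simps(2)[OF ps_ord_mono[OF that, of 1] ord_X[of i]] by simp
  have zero: "br G H = K"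
    if "\<And>n. ps_ord (n + 2) (G - G' n)" "\<And>n. ps_ord (n + 2) (H - H' n)" "\<And>n. ps_ord (n + 2) (K - K' n)"
      "\<And>n. ps_ord (n + 2) (br (G' n) (H' n) - K' n)" "ps_ord 1 H" "\<And>n. ps_ord 1 (G' n)"
    for G H K and G' H' K' :: "nat \<Rightarrow> 3 pseries"
  proof -
    have "ps_ord n (br G H - K)" for n
    proof -
      have eq: "br G H - K = br (G - G' n) H + br (G' n) (H - H' n) + (br (G' n) (H' n) - K' n) - (K - K' n)"
        by (simp add: ps_bracket_simps)
      have "ps_ord (n + 2) (br G H - K)"
        unfolding eq
        by (rule ps_ord_simps(3)[OF ps_ord_simps(2)[OF ps_ord_simps(2)[OF
              ord_br[OF that(1)[of n] that(5)] ord_br[OF that(6)[of n] that(2)[of n]]] that(4)[of n]] that(3)[of n]])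
          simp_all
      then show ?thesis by (rule ps_ord_mono) simp
    qed
    then show ?thesis using ps_ord_0[of "br G H - K"] by simp
  qed
  have scale: "ps_ord (n + 2) (ps_const c * G - ps_const c * G')" if "ps_ord (n + 2) (G - G')" for c n and G G' :: "3 pseries"
    using ps_ord_simps(5)[OF that, of c] by (simp add: right_diff_distrib)
  show thesis
  proof (rule that[OF X])
    show "br (L F1) (L F2) = L F3"
      by (rule zero[of _ F1 _ F2 _ F3]) (use lim good X in \<open>blast intro: one\<close>)+
    show "br (L F2) (L F3) = ps_const a * L F1"
      by (rule zero[of _ F2 _ F3 _ "\<lambda>n. ps_const a * F1 n"]) (use lim good X in \<open>blast intro: one scale\<close>)+
    show "br (L F3) (L F1) = ps_const b * L F2"
      by (rule zero[of _ F3 _ F1 _ "\<lambda>n. ps_const b * F2 n"]) (use lim good X in \<open>blast intro: one scale\<close>)+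
  qed
qed

end

section \<open>Taylor series and substitution\<close>

lemma smooth_line_derivative:
  assumes "smooth_on UNIV f"
  shows "((\<lambda>s. f (x + s *\<^sub>R v)) has_vector_derivative dir_deriv v f (x + s *\<^sub>R v)) (at s)"
proof -
  have "((\<lambda>s. x + s *\<^sub>R v) has_derivative (\<lambda>h. h *\<^sub>R v)) (at s)"
    by (auto intro!: derivative_eq_intros)
  from has_derivative_compose[OF this smooth_on_has_derivative[OF assms UNIV_I]]
  have "((\<lambda>s. f (x + s *\<^sub>R v)) has_derivative (\<lambda>h. dir_deriv (h *\<^sub>R v) f (x + s *\<^sub>R v))) (at s)" .
  moreover have "dir_deriv (h *\<^sub>R v) f y = h *\<^sub>R dir_deriv v f y" for h y
    using linear_scale[OF has_derivative_linear[OF smooth_on_has_derivative[OF assms]]] by blast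
  ultimately show ?thesis by (simp add: has_vector_derivative_def)
qed

text \<open>
  The classical argument with the second difference \<open>S\<close>, which is symmetric in the two directions: by
  the mean value theorem it is \<open>h\<^sup>2\<close> times either mixed derivative at some point near \<open>x\<close>, and the mixed
  derivatives are continuous.
\<close>

lemma dir_deriv_commute:
  fixes f :: "'a::real_normed_vector \<Rightarrow> real"
  assumes f: "smooth_on UNIV f"
  shows "dir_deriv v (dir_deriv w f) = dir_deriv w (dir_deriv v f)"
proof
  fix x
  have line: "((\<lambda>s. g (x + s *\<^sub>R v)) has_real_derivative dir_deriv v g (x + s *\<^sub>R v)) (at s)"
    if "smooth_on UNIV g" for g :: "'a \<Rightarrow> real" and x v s
    using smooth_line_derivative[OF that] by (simp add: has_real_derivative_iff_has_vector_derivative)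
  define S where "S h v w = f (x + h *\<^sub>R v + h *\<^sub>R w) - f (x + h *\<^sub>R v) - f (x + h *\<^sub>R w) + f x" for h v w
  have mixed: "\<exists>s t. 0 < s \<and> s < h \<and> 0 < t \<and> t < h \<and>
      S h v w = h * (h * dir_deriv w (dir_deriv v f) (x + s *\<^sub>R v + t *\<^sub>R w))" if h: "h > 0" for h v w
  proof -
    have "\<exists>s>0. s < h \<and> (f (x + h *\<^sub>R w + h *\<^sub>R v) - f (x + h *\<^sub>R v)) - (f (x + h *\<^sub>R w + 0 *\<^sub>R v) - f (x + 0 *\<^sub>R v)) =
        (h - 0) * (dir_deriv v f (x + h *\<^sub>R w + s *\<^sub>R v) - dir_deriv v f (x + s *\<^sub>R v))"
      by (rule MVT2) (use h line[OF f] in \<open>auto intro!: derivative_intros\<close>)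
    then obtain s where s: "0 < s" "s < h"
      "S h v w = h * (dir_deriv v f (x + s *\<^sub>R v + h *\<^sub>R w) - dir_deriv v f (x + s *\<^sub>R v))"
      by (auto simp: S_def algebra_simps)
    have "\<exists>t>0. t < h \<and> dir_deriv v f (x + s *\<^sub>R v + h *\<^sub>R w) - dir_deriv v f (x + s *\<^sub>R v + 0 *\<^sub>R w) =
        (h - 0) * dir_deriv w (dir_deriv v f) (x + s *\<^sub>R v + t *\<^sub>R w)"
      by (rule MVT2) (use h line[OF smooth_on_dir_deriv[OF f]] in auto)
    then obtain t where "0 < t" "t < h" "dir_deriv v f (x + s *\<^sub>R v + h *\<^sub>R w) - dir_deriv v f (x + s *\<^sub>R v) =
        h * dir_deriv w (dir_deriv v f) (x + s *\<^sub>R v + t *\<^sub>R w)"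
      by auto
    with s show ?thesis by metis
  qed
  define small where "small r \<longleftrightarrow> (\<forall>n. 0 < r n \<and> r n < inverse (real (Suc n)))" for r
  have lim: "((\<lambda>n. g (x + s n *\<^sub>R y + t n *\<^sub>R z)) \<longlonglongrightarrow> g x)"
    if "continuous_on UNIV g" "small s" "small t" for g :: "'a \<Rightarrow> real" and s t y z
  proof -
    have "r \<longlonglongrightarrow> 0" if "small r" for r
    proof (rule real_tendsto_sandwich[OF _ _ tendsto_const LIMSEQ_inverse_real_of_nat])
      show "\<forall>\<^sub>F n in sequentially. 0 \<le> r n" "\<forall>\<^sub>F n in sequentially. r n \<le> inverse (real (Suc n))"
        using that unfolding small_def by (intro always_eventually allI less_imp_le; blast)+
    qed
    then have "(\<lambda>n. x + s n *\<^sub>R y + t n *\<^sub>R z) \<longlonglongrightarrow> x + 0 *\<^sub>R y + 0 *\<^sub>R z"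
      using that by (intro tendsto_intros) auto
    then show ?thesis
      using that(1) by (intro isCont_tendsto_compose[of x g]) (auto simp: continuous_on_eq_continuous_at)
  qed
  have pos: "inverse (real (Suc n)) > 0" for n by simp
  define D where "D s t v w n = dir_deriv w (dir_deriv v f) (x + s n *\<^sub>R v + t n *\<^sub>R w)" for s t v w and n :: nat
  have pick: "\<exists>s t. small s \<and> small t \<and>
      (\<forall>n. S (inverse (real (Suc n))) v w = inverse (real (Suc n)) * (inverse (real (Suc n)) * D s t v w n))" for v w
    unfolding small_def D_def using mixed[OF pos, of _ v w] by metis
  obtain s t where st: "small s" "small t"
    "\<And>n. S (inverse (real (Suc n))) v w = inverse (real (Suc n)) * (inverse (real (Suc n)) * D s t v w n)"
    using pick[of v w] by blast
  obtain s' t' where st': "small s'" "small t'"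
    "\<And>n. S (inverse (real (Suc n))) w v = inverse (real (Suc n)) * (inverse (real (Suc n)) * D s' t' w v n)"
    using pick[of w v] by blast
  have S_sym: "S h v w = S h w v" for h
    by (simp add: S_def algebra_simps)
  have cont: "continuous_on UNIV (dir_deriv v (dir_deriv w f))" "continuous_on UNIV (dir_deriv w (dir_deriv v f))"
    using f by (auto intro!: smooth_on_continuous smooth_on_dir_deriv)
  have "D s t v w n = D s' t' w v n" for n
    using st(3)[of n] st'(3)[of n] pos[of n] S_sym by (metis less_irrefl mult_left_cancel)
  moreover have "D s t v w \<longlonglongrightarrow> dir_deriv w (dir_deriv v f) x"
    unfolding D_def by (rule lim[OF cont(2) st(1,2)])
  moreover have "D s' t' w v \<longlonglongrightarrow> dir_deriv v (dir_deriv w f) x"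
    unfolding D_def by (rule lim[OF cont(1) st'(1,2)])
  ultimately show "dir_deriv v (dir_deriv w f) x = dir_deriv w (dir_deriv v f) x"
    using LIMSEQ_unique[of "D s t v w"] by (metis ext)
qed

lemma smooth_funpow: "smooth_on UNIV f \<Longrightarrow> smooth_on UNIV ((dir_deriv v ^^ n) f)"
  by (induction n) (auto intro: smooth_on_dir_deriv)

lemma dir_deriv_funpow_commute:
  fixes f :: "'a::real_normed_vector \<Rightarrow> real"
  shows "smooth_on UNIV f \<Longrightarrow> dir_deriv w ((dir_deriv v ^^ n) f) = (dir_deriv v ^^ n) (dir_deriv w f)"
  by (induction n) (auto simp: smooth_funpow dir_deriv_commute[of _ w v])

lemma taylor_deriv:
  assumes "smooth_on UNIV f"
  shows "ps_deriv i (taylor f) = taylor (dir_deriv (axis i 1) f)"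
proof (rule pseries_eqI)
  fix \<alpha> :: "3 \<Rightarrow> nat"
  note simps = taylor_def funpow_swap1 dir_deriv_funpow_commute smooth_funpow assms fact_reduce
  show "ps_coeff (ps_deriv i (taylor f)) \<alpha> = ps_coeff (taylor (dir_deriv (axis i 1) f)) \<alpha>"
    using exhaust_3[of i] by (elim disjE) (simp_all add: simps divide_simps del: of_nat_Suc)
qed

lemma taylor_const_term: "ps_coeff (taylor f) (\<lambda>_. 0) = f 0"
  by (simp add: taylor_def)

text \<open>
  A coinduction principle: two series agree if their constant terms agree and this property is passed on to all
  derivatives.
\<close>

lemma ps_eq_by_derivs:
  fixes R :: "'n::finite pseries \<Rightarrow> 'n pseries \<Rightarrow> bool"
  assumes "R F G"
    and const: "\<And>F G. R F G \<Longrightarrow> ps_coeff F (\<lambda>_. 0) = ps_coeff G (\<lambda>_. 0)"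
    and deriv: "\<And>F G i. R F G \<Longrightarrow> R (ps_deriv i F) (ps_deriv i G)"
  shows "F = G"
proof (rule pseries_eqI)
  fix \<alpha> :: "'n \<Rightarrow> nat"
  show "ps_coeff F \<alpha> = ps_coeff G \<alpha>"
    using assms(1)
  proof (induction "deg \<alpha>" arbitrary: F G \<alpha>)
    case 0
    then have "\<alpha> = (\<lambda>_. 0)" by (auto simp: deg_eq_0)
    with 0 const show ?case by simp
  next
    case (Suc n)
    then obtain i where i: "\<alpha> i \<noteq> 0" by (metis deg_eq_0 nat.distinct(1))
    define \<beta> where "\<beta> = \<alpha>(i := \<alpha> i - 1)"
    have \<alpha>: "\<alpha> = \<beta>(i := \<beta> i + 1)" using i by (auto simp: \<beta>_def)
    have "n = deg \<beta>" using Suc(2) deg_upd[of \<beta> i] \<alpha> by simp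
    from Suc(1)[OF this deriv[OF Suc(3), of i]]
    have "real (\<beta> i + 1) * ps_coeff F \<alpha> = real (\<beta> i + 1) * ps_coeff G \<alpha>"
      unfolding ps_coeff_deriv \<alpha>[symmetric] .
    then show ?case by simp
  qed
qed

lemma taylor_lincomb:
  assumes "smooth_on UNIV f" "smooth_on UNIV g"
  shows "taylor (\<lambda>x. c * f x + d * g x) = ps_const c * taylor f + ps_const d * taylor g"
proof (rule ps_eq_by_derivs[where R = "\<lambda>F G. \<exists>f g. smooth_on UNIV f \<and> smooth_on UNIV g \<and>
      F = taylor (\<lambda>x. c * f x + d * g x) \<and> G = ps_const c * taylor f + ps_const d * taylor g"], goal_cases)
  case 1
  then show ?case using assms by blast
next
  case (2 F G)
  then show ?case by (auto simp: taylor_const_term)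
next
  case (3 F G i)
  then obtain f g where fg: "smooth_on UNIV f" "smooth_on UNIV g"
    "F = taylor (\<lambda>x. c * f x + d * g x)" "G = ps_const c * taylor f + ps_const d * taylor g"
    by blast
  have "smooth_on UNIV (\<lambda>x. c * f x + d * g x)"
    using fg by (intro smooth_on_add smooth_on_mult) auto
  moreover have "dir_deriv (axis i 1) (\<lambda>x. c * f x + d * g x) = (\<lambda>x. c * dir_deriv (axis i 1) f x + d * dir_deriv (axis i 1) g x)"
    by (rule ext, rule dir_deriv_eq)
      (use fg smooth_on_has_derivative in \<open>auto intro!: derivative_eq_intros\<close>)
  ultimately show ?case
    using fg
    by (intro exI[of _ "dir_deriv (axis i 1) f"] exI[of _ "dir_deriv (axis i 1) g"])
      (auto simp: taylor_deriv smooth_on_dir_deriv)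
qed

lemma ps_const_minus_1: "ps_const (-1) * F = - (F :: 'n::finite pseries)"
  by (rule pseries_eqI) simp

lemma taylor_add: "smooth_on UNIV f \<Longrightarrow> smooth_on UNIV g \<Longrightarrow> taylor (\<lambda>x. f x + g x) = taylor f + taylor g"
  using taylor_lincomb[of f g 1 1] by simp

lemma taylor_uminus: "smooth_on UNIV f \<Longrightarrow> taylor (\<lambda>x. - f x) = - taylor f"
  using taylor_lincomb[of f f "-1" 0] by (simp add: ps_const_minus_1)

lemma taylor_0: "taylor (\<lambda>x. 0) = 0"
  using taylor_lincomb[of "\<lambda>_. 0" "\<lambda>_. 0" 0 0] by simp

text \<open>
  Both sides have the same constant term and, by the product rule for functions and for series, derivatives that
  are treated by induction on the degree.
\<close>

lemma taylor_mult:
  assumes "smooth_on UNIV f" "smooth_on UNIV g"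
  shows "taylor (\<lambda>x. f x * g x) = taylor f * taylor g"
proof (rule pseries_eqI)
  fix \<alpha> :: "3 \<Rightarrow> nat"
  show "ps_coeff (taylor (\<lambda>x. f x * g x)) \<alpha> = ps_coeff (taylor f * taylor g) \<alpha>"
    using assms
  proof (induction "deg \<alpha>" arbitrary: f g \<alpha>)
    case 0
    then have "\<alpha> = (\<lambda>_. 0)" by (auto simp: deg_eq_0)
    moreover have "{\<beta> :: 3 \<Rightarrow> nat. \<forall>i. \<beta> i = 0} = {\<lambda>_. 0}" by auto
    ultimately show ?case by (simp add: ps_coeff_mult taylor_const_term)
  next
    case (Suc n)
    then obtain i where i: "\<alpha> i \<noteq> 0" by (metis deg_eq_0 nat.distinct(1))
    define \<beta> where "\<beta> = \<alpha>(i := \<alpha> i - 1)"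
    have \<alpha>: "\<alpha> = \<beta>(i := \<beta> i + 1)" using i by (auto simp: \<beta>_def)
    have n: "n = deg \<beta>" using Suc(2) deg_upd[of \<beta> i] \<alpha> by simp
    let ?D = "dir_deriv (axis i 1)"
    note sm = Suc(3,4) Suc(3,4)[THEN smooth_on_dir_deriv, of "axis i 1"]
    have "?D (\<lambda>x. f x * g x) = (\<lambda>x. f x * ?D g x + ?D f x * g x)"
      by (rule ext, rule dir_deriv_eq) (intro bounded_bilinear.FDERIV[OF bounded_bilinear_mult]
          smooth_on_has_derivative[OF Suc(3)] smooth_on_has_derivative[OF Suc(4)] UNIV_I)
    then have "ps_deriv i (taylor (\<lambda>x. f x * g x)) = taylor (\<lambda>x. f x * ?D g x) + taylor (\<lambda>x. ?D f x * g x)"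
      using sm by (simp add: taylor_deriv smooth_on_mult taylor_add)
    then have "ps_coeff (ps_deriv i (taylor (\<lambda>x. f x * g x))) \<beta> = ps_coeff (ps_deriv i (taylor f * taylor g)) \<beta>"
      using Suc(1)[OF n sm(1,4)] Suc(1)[OF n sm(3,2)] sm by (simp add: taylor_deriv)
    then have "real (\<beta> i + 1) * ps_coeff (taylor (\<lambda>x. f x * g x)) \<alpha> = real (\<beta> i + 1) * ps_coeff (taylor f * taylor g) \<alpha>"
      unfolding ps_coeff_deriv \<alpha>[symmetric] .
    then show ?case by simp
  qed
qed

lemma ps_ord_1I: "ps_coeff F (\<lambda>_. 0) = 0 \<Longrightarrow> ps_ord 1 F"
  by (simp add: ps_ord_def deg_eq_0[unfolded sum_eq_0_iff[OF finite]] fun_eq_iff) (metis (full_types) ext)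

lemma ps_ord_2I:
  assumes "ps_coeff F (\<lambda>_. 0) = 0" "\<And>i. ps_coeff (ps_deriv i F) (\<lambda>_. 0) = 0"
  shows "ps_ord 2 (F :: 'n::finite pseries)"
  unfolding ps_ord_def
proof (intro allI impI)
  fix \<alpha> :: "'n \<Rightarrow> nat" assume \<alpha>: "deg \<alpha> < 2"
  show "ps_coeff F \<alpha> = 0"
  proof (cases "deg \<alpha> = 0")
    case True
    with assms show ?thesis by (simp only: deg_eq_0)
  next
    case False
    then obtain i where i: "\<alpha> i \<noteq> 0" by (metis deg_eq_0)
    define \<beta> where "\<beta> = \<alpha>(i := \<alpha> i - 1)"
    have \<alpha>': "\<alpha> = \<beta>(i := \<beta> i + 1)" using i by (auto simp: \<beta>_def)
    have "deg \<beta> = 0" using \<alpha> deg_upd[of \<beta> i] \<alpha>' by simp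
    then have "\<beta> = (\<lambda>_. 0)" by (simp only: deg_eq_0)
    with assms(2)[of i] \<alpha>' show ?thesis by simp
  qed
qed

lemma ps_compose_simps:
  "ps_compose (F + G) \<Phi> = ps_compose F \<Phi> + ps_compose G \<Phi>"
  "ps_compose (ps_const c * F) \<Phi> = ps_const c * ps_compose F \<Phi>"
  "ps_compose (- F) \<Phi> = - ps_compose F \<Phi>"
  "ps_compose 0 \<Phi> = 0"
  by (auto intro!: pseries_eqI simp: ps_compose_def distrib_right mult.assoc sum.distrib sum_distrib_left sum_negf)

lemma ps_ord_power: "ps_ord 1 F \<Longrightarrow> ps_ord n (F ^ n)"
proof (induction n)
  case (Suc n)
  then show ?case using ps_ord_mult[of 1 F n "F ^ n"] by simp
qed simp

lemma ps_ord_prod: "finite I \<Longrightarrow> (\<And>i. i \<in> I \<Longrightarrow> ps_ord (k i) (F i)) \<Longrightarrow> ps_ord (sum k I) (prod F I)"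
  by (induction I rule: finite_induct) (auto intro: ps_ord_mult)

lemma finite_deg_le: "finite {\<beta> :: 'm::finite \<Rightarrow> nat. deg \<beta> \<le> n}"
proof (rule finite_subset)
  show "{\<beta> :: 'm \<Rightarrow> nat. deg \<beta> \<le> n} \<subseteq> {\<beta>. \<forall>i. \<beta> i \<le> (\<lambda>_. n) i}"
    using member_le_sum[of _ UNIV "_ :: 'm \<Rightarrow> nat"] by (auto intro: order_trans)
qed simp

text \<open>
  The coefficients that the truncation in the definition of \<open>ps_compose\<close> omits are zero, because a product of \<open>deg \<gamma>\<close> series
  without constant term has order \<open>deg \<gamma>\<close>.
\<close>

lemma ps_compose_monomial:
  assumes "\<And>i. ps_const_term (\<Phi> i) = 0"
  shows "ps_compose (PSeries (\<lambda>\<beta>. if \<beta> = \<gamma> then 1 else 0)) \<Phi> = (\<Prod>i\<in>UNIV. \<Phi> i ^ \<gamma> i)"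
proof (rule pseries_eqI)
  fix \<alpha>
  have "ps_ord (deg \<gamma>) (\<Prod>i\<in>UNIV. \<Phi> i ^ \<gamma> i)"
    using assms by (intro ps_ord_prod ps_ord_power ps_ord_1I) (auto simp: ps_const_term_def)
  then have z: "deg \<alpha> < deg \<gamma> \<Longrightarrow> ps_coeff (\<Prod>i\<in>UNIV. \<Phi> i ^ \<gamma> i) \<alpha> = 0"
    by (simp add: ps_ord_def)
  have "ps_coeff (ps_compose (PSeries (\<lambda>\<beta>. if \<beta> = \<gamma> then 1 else 0)) \<Phi>) \<alpha> =
     (\<Sum>\<beta> | deg \<beta> \<le> deg \<alpha>. if \<beta> = \<gamma> then ps_coeff (\<Prod>i\<in>UNIV. \<Phi> i ^ \<gamma> i) \<alpha> else 0)"
    by (auto simp: ps_compose_def intro!: sum.cong)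
  also have "\<dots> = ps_coeff (\<Prod>i\<in>UNIV. \<Phi> i ^ \<gamma> i) \<alpha>"
    using z by (auto simp: sum.delta[OF finite_deg_le])
  finally show "ps_coeff (ps_compose (PSeries (\<lambda>\<beta>. if \<beta> = \<gamma> then 1 else 0)) \<Phi>) \<alpha> = ps_coeff (\<Prod>i\<in>UNIV. \<Phi> i ^ \<gamma> i) \<alpha>" .
qed

lemma ps_compose_var_power:
  fixes \<Phi> :: "'m::finite \<Rightarrow> 'n::finite pseries"
  assumes "\<And>i. ps_const_term (\<Phi> i) = 0"
  shows "ps_compose (ps_var i ^ n) \<Phi> = \<Phi> i ^ n"
proof -
  have "ps_var i ^ n = PSeries (\<lambda>\<beta>. if \<beta> = (\<lambda>j. if j = i then n else 0) then 1 else 0)"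
  proof (induction n)
    case 0
    show ?case by (simp add: one_pseries_def)
  next
    case (Suc n)
    show ?case
      unfolding power_Suc Suc
      by (rule pseries_eqI) (auto simp: ps_coeff_var_mult fun_eq_iff split: if_splits)
  qed
  then have "ps_compose (ps_var i ^ n) \<Phi> = (\<Prod>j\<in>UNIV. \<Phi> j ^ (if j = i then n else 0))"
    using ps_compose_monomial[OF assms] by simp
  also have "\<dots> = (\<Prod>j\<in>UNIV. if j = i then \<Phi> i ^ n else 1)"
    by (intro prod.cong) auto
  finally show ?thesis by (simp add: prod.delta)
qed

lemma ps_compose_var:
  "(\<And>i. ps_const_term (\<Phi> i) = 0) \<Longrightarrow> ps_compose (ps_var i) \<Phi> = \<Phi> i"
  using ps_compose_var_power[of \<Phi> i 1] by simp

section \<open>The normal form at a zero with simple linear part\<close>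

definition ps_quadratic :: "real \<Rightarrow> real \<Rightarrow> 2 pseries" where
  "ps_quadratic a b = ps_const a * ps_x\<^sup>2 + ps_const b * ps_y\<^sup>2"

lemma sum_skew3:
  "(\<Sum>k\<in>UNIV. \<Sum>l\<in>UNIV. skew3 p q r k l * ps_deriv k F * ps_deriv l G) = ps_bracket p q r F G"
  by (simp add: sum_3 skew3_def ps_bracket_def algebra_simps)

lemma skew_matrix_eq:
  fixes A :: "real^3^3"
  assumes "transpose A = - A"
  shows "A = bivector (A $ 1 $ 2) (A $ 2 $ 3) (A $ 3 $ 1)"
proof -
  have "A $ j $ i = - A $ i $ j" for i j
    using arg_cong[OF assms, of "\<lambda>B. B $ i $ j"] by (simp add: transpose_def)
  note this[of 1 1] this[of 2 2] this[of 3 3] this[of 1 2] this[of 2 3] this[of 3 1]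
  then show ?thesis
    by (simp add: vec_eq_iff forall_3 bivector_def skew3_def)
qed

text \<open>
  The change \<open>\<Phi>\<close> consists of the generators of a Levi factor. The Taylor series of the
  brackets satisfy the formal Jacobi identity because taking Taylor series is compatible with products and derivatives.
\<close>

lemma levi_normal_form:
  fixes Q :: "real^3 \<Rightarrow> real^3^3" and a b :: real
  assumes sm: "\<And>i j. smooth_on UNIV (\<lambda>y. Q y $ i $ j)"
    and skew: "\<And>y. transpose (Q y) = - Q y"
    and jacobi: "\<And>i j k y. (\<Sum>l\<in>UNIV. Q y $ i $ l * dir_deriv (axis l 1) (\<lambda>y. Q y $ j $ k) y
       + Q y $ j $ l * dir_deriv (axis l 1) (\<lambda>y. Q y $ k $ i) y
       + Q y $ k $ l * dir_deriv (axis l 1) (\<lambda>y. Q y $ i $ j) y) = 0"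
    and Q0: "Q 0 = 0"
    and lin: "\<And>v i j. dir_deriv v (\<lambda>y. Q y $ i $ j) 0 = bivector (v $ 3) (a * v $ 1) (b * v $ 2) $ i $ j"
    and ab: "a \<noteq> 0" "b \<noteq> 0"
  shows "\<exists>\<Phi>. formal_change \<Phi> \<and> formal_in_coordinates \<Phi> (\<lambda>i j. taylor (\<lambda>y. Q y $ i $ j))
    (formal_normal_form (ps_quadratic (a / 2) (b / 2)) 0)"
proof -
  define T where "T i j = taylor (\<lambda>y. Q y $ i $ j)" for i j
  define p q r where "p = T 1 2" and "q = T 2 3" and "r = T 3 1"
  have neg: "Q y $ j $ i = - Q y $ i $ j" for y i j
    using arg_cong[OF skew[of y], of "\<lambda>B. B $ i $ j"] by (simp add: transpose_def)
  have T_skew: "T j i = - T i j" for i j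
    unfolding T_def by (subst neg) (rule taylor_uminus[OF sm])
  have T_diag: "T i i = 0" for i
  proof -
    have "(\<lambda>y. Q y $ i $ i) = (\<lambda>y. 0)" using neg[of _ i i] by auto
    then show ?thesis by (simp add: T_def taylor_0)
  qed
  have T_eq: "T = skew3 p q r"
  proof (intro ext)
    fix i j show "T i j = skew3 p q r i j"
      using exhaust_3[of i] exhaust_3[of j]
      by (elim disjE) (simp_all add: skew3_def p_def q_def r_def T_diag T_skew[of 2 1] T_skew[of 3 2] T_skew[of 1 3])
  qed
  have T_deriv: "ps_deriv l (T i j) = taylor (dir_deriv (axis l 1) (\<lambda>y. Q y $ i $ j))" for i j l
    unfolding T_def by (rule taylor_deriv[OF sm])
  have "(\<Sum>l\<in>UNIV. T 1 l * ps_deriv l (T 2 3) + T 2 l * ps_deriv l (T 3 1) + T 3 l * ps_deriv l (T 1 2)) =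
    taylor (\<lambda>y. \<Sum>l\<in>UNIV. Q y $ 1 $ l * dir_deriv (axis l 1) (\<lambda>y. Q y $ 2 $ 3) y
       + Q y $ 2 $ l * dir_deriv (axis l 1) (\<lambda>y. Q y $ 3 $ 1) y
       + Q y $ 3 $ l * dir_deriv (axis l 1) (\<lambda>y. Q y $ 1 $ 2) y)"
    unfolding T_deriv unfolding T_def sum_3
    by (simp add: taylor_add taylor_mult smooth_on_add smooth_on_mult smooth_on_dir_deriv sm)
  then have "(\<Sum>l\<in>UNIV. T 1 l * ps_deriv l (T 2 3) + T 2 l * ps_deriv l (T 3 1) + T 3 l * ps_deriv l (T 1 2)) = 0"
    unfolding jacobi taylor_0 .
  then have jac: "p * D2 q - r * D3 q + q * D3 r - p * D1 r + r * D1 p - q * D2 p = 0"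
    unfolding T_eq sum_3 by (simp add: skew3_def algebra_simps)
  have ord2: "ps_ord 2 (T i j - ps_const c * ps_var k)"
    if "\<And>l. dir_deriv (axis l 1) (\<lambda>y. Q y $ i $ j) 0 = (if l = k then c else 0)" for i j c k
  proof (rule ps_ord_2I)
    show "ps_coeff (T i j - ps_const c * ps_var k) (\<lambda>_. 0) = 0"
      using Q0 by (simp add: T_def taylor_const_term ps_coeff_var fun_eq_iff)
    show "ps_coeff (ps_deriv l (T i j - ps_const c * ps_var k)) (\<lambda>_. 0) = 0" for l
      using that[of l]
      by (simp add: T_deriv taylor_const_term ps_deriv_var one_pseries_def del: ps_coeff_deriv)
  qed
  interpret levi_lift a b p q r
  proof
    show "ps_ord 2 (p - X3)"
      using ord2[of 1 2 3 1] unfolding p_def by (simp add: lin bivector_def skew3_def axis_def)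
    show "ps_ord 2 (q - ps_const a * X1)"
      unfolding q_def by (rule ord2) (simp add: lin bivector_def skew3_def axis_def)
    show "ps_ord 2 (r - ps_const b * X2)"
      unfolding r_def by (rule ord2) (simp add: lin bivector_def skew3_def axis_def)
  qed (use ab jac in auto)
  obtain F1 F2 F3 where F: "ps_ord 2 (F1 - X1)" "ps_ord 2 (F2 - X2)" "ps_ord 2 (F3 - X3)"
    "br F1 F2 = F3" "br F2 F3 = ps_const a * F1" "br F3 F1 = ps_const b * F2"
    by (rule levi_factor)
  define \<Phi> :: "3 \<Rightarrow> 3 pseries" where "\<Phi> i = (if i = 1 then F1 else if i = 2 then F2 else F3)" for i
  have \<Phi>: "\<Phi> 1 = F1" "\<Phi> 2 = F2" "\<Phi> 3 = F3"
    by (simp_all add: \<Phi>_def)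
  have \<Phi>_ord: "ps_ord 2 (\<Phi> i - ps_var i)" for i
    using exhaust_3[of i] F by (auto simp: \<Phi>)
  have const0: "ps_const_term (\<Phi> i) = 0" for i
    using \<Phi>_ord[of i] by (auto simp: ps_ord_def ps_const_term_def ps_coeff_var fun_eq_iff dest!: spec[of _ "\<lambda>_. 0"])
  have lincoeff: "ps_linear_coeff (\<Phi> i) j = (if i = j then 1 else 0)" for i j
  proof -
    have "ps_coeff (\<Phi> i - ps_var i) (\<lambda>k. if k = j then 1 else 0) = 0"
      using \<Phi>_ord[of i] deg_unit[of j] unfolding ps_ord_def by (metis one_less_numeral_iff semiring_norm(76))
    then show ?thesis
      by (auto simp: ps_linear_coeff_def ps_coeff_var fun_eq_iff)
  qed
  have "formal_change \<Phi>"
  proof -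
    have "(\<chi> i j. ps_linear_coeff (\<Phi> i) j) = (mat 1 :: real^3^3)"
      by (simp add: lincoeff mat_def vec_eq_iff)
    then show ?thesis
      using const0 by (auto simp: formal_change_def invertible_def intro!: exI[of _ "mat 1"])
  qed
  moreover have "formal_in_coordinates \<Phi> T (formal_normal_form (ps_quadratic (a / 2) (b / 2)) 0)"
    (is "formal_in_coordinates \<Phi> T (formal_normal_form ?f 0)")
  proof -
    have half: "ps_const (c / 2) * (2 * G) = ps_const c * G" for c and G :: "2 pseries"
      by (rule pseries_eqI) (subst mult_2, simp only: ps_coeff_const_mult ps_coeff_add, simp)
    have f12: "ps_deriv 1 ?f = ps_const a * ps_x" "ps_deriv 2 ?f = ps_const b * ps_y"
      by (simp_all add: ps_quadratic_def power2_eq_square ps_deriv_var half)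
    have const_var: "ps_const_term (ps_var i :: 3 pseries) = 0" for i
      by (simp add: ps_const_term_def ps_coeff_var fun_eq_iff)
    have xyz: "ps_xyz (ps_const a * ps_x) = ps_const a * X1" "ps_xyz (ps_const b * ps_y) = ps_const b * X2" "ps_xyz 0 = 0"
      by (simp_all add: ps_xyz_def ps_compose_simps ps_compose_var const_var)
    have nf: "formal_normal_form ?f 0 = skew3 X3 (ps_const a * X1) (ps_const b * X2)"
      by (simp only: formal_normal_form_def f12 xyz ps_deriv_0 mult_zero_right add_0_right)
    have "ps_compose (skew3 X3 (ps_const a * X1) (ps_const b * X2) i j) \<Phi> = br (\<Phi> i) (\<Phi> j)" for i j
      using exhaust_3[of i] exhaust_3[of j]
      by (elim disjE)
        (simp_all add: skew3_def ps_compose_simps ps_compose_var const0 \<Phi> F(4-6) ps_bracket_simps(6)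
          ps_bracket_antisym[of p q r F2 F1] ps_bracket_antisym[of p q r F3 F2] ps_bracket_antisym[of p q r F1 F3])
    then show ?thesis
      unfolding formal_in_coordinates_def nf T_eq sum_skew3 by blast
  qed
  ultimately show ?thesis
    unfolding T_def by blast
qed

lemma dir_deriv_nth2:
  fixes Q :: "real^3 \<Rightarrow> real^3^3"
  assumes "smooth_on UNIV Q"
  shows "smooth_on UNIV (\<lambda>y. Q y $ i $ j)" "dir_deriv v (\<lambda>y. Q y $ i $ j) y = dir_deriv v Q y $ i $ j"
proof -
  have "bounded_linear (\<lambda>M :: real^3^3. M $ i $ j)"
    by (intro bounded_linear_compose[OF bounded_linear_vec_nth bounded_linear_vec_nth])
  from smooth_on_bounded_linear_comp[OF open_UNIV this assms]
  show "smooth_on UNIV (\<lambda>y. Q y $ i $ j)" "dir_deriv v (\<lambda>y. Q y $ i $ j) y = dir_deriv v Q y $ i $ j"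
    by auto
qed

lemma linear_conjugation: "bounded_linear (\<lambda>M :: real^3^3. A ** M ** transpose A)"
proof -
  have "linear (\<lambda>M :: real^3^3. A ** M ** transpose A)"
    by (rule linearI) (simp_all add: vec_eq_iff matrix_matrix_mult_def sum_3 algebra_simps)
  then show ?thesis by (simp add: linear_conv_bounded_linear)
qed

text \<open>
  The Jacobi identity for the new structure is the one for the old structure and the linear functions \<open>f i\<close>, which are the new
  coordinates.
\<close>

lemma poisson_change_linear_coordinates:
  fixes P :: "real^3 \<Rightarrow> real^3^3" and A :: "real^3^3"
  assumes P: "poisson_structure P" and A: "A' ** A = mat 1" "A ** A' = mat 1"
    and Q: "\<And>y. Q y = A ** P (q + A' *v y) ** transpose A"
  shows "smooth_on UNIV Q" and "transpose (Q y) = - Q y"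
    and "dir_deriv v Q y = A ** dir_deriv (A' *v v) P (q + A' *v y) ** transpose A"
    and "(\<Sum>l\<in>UNIV. Q y $ i $ l * dir_deriv (axis l 1) (\<lambda>y. Q y $ j $ k) y
       + Q y $ j $ l * dir_deriv (axis l 1) (\<lambda>y. Q y $ k $ i) y
       + Q y $ k $ l * dir_deriv (axis l 1) (\<lambda>y. Q y $ i $ j) y) = 0"
proof -
  have smP: "smooth_on UNIV P" and skP: "transpose (P x) = - P x" for x
    using P by (auto simp: poisson_structure_def)
  define R where "R x = A ** P x ** transpose A" for x
  have smR: "smooth_on UNIV R" and dR: "dir_deriv v R x = A ** dir_deriv v P x ** transpose A" for v x
    unfolding R_def using smooth_on_bounded_linear_comp[OF open_UNIV linear_conjugation smP] by auto
  let ?T = "\<lambda>y. q + A' *v y"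
  have bl: "bounded_linear (\<lambda>y. A' *v y)"
    by (rule matrix_vector_mul_bounded_linear)
  have smT: "smooth_on UNIV ?T"
    by (intro smooth_on_add smooth_on_linear[OF bl]) auto
  have dT: "dir_deriv v ?T y = A' *v v" for v y
    by (rule dir_deriv_eq) (auto intro!: derivative_eq_intros bounded_linear_imp_has_derivative[OF bl])
  have QR: "Q = (\<lambda>y. R (?T y))" by (simp add: fun_eq_iff Q R_def)
  show smQ: "smooth_on UNIV Q"
    unfolding QR by (rule smooth_on_compose(1)[OF open_UNIV open_UNIV smT smR]) simp
  have dQ: "dir_deriv v Q y = dir_deriv (A' *v v) R (?T y)" for v y
    unfolding QR by (subst smooth_on_compose(2)[OF open_UNIV open_UNIV smT smR]) (simp_all add: dT)
  then show "dir_deriv v Q y = A ** dir_deriv (A' *v v) P (q + A' *v y) ** transpose A"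
    by (simp add: dR)
  show "transpose (Q y) = - Q y"
    by (simp add: Q matrix_transpose_mul skP matrix_mul_assoc)
      (metis (no_types) linear_neg[OF bounded_linear.linear[OF linear_conjugation]])
  define f where "f i x = (A *v x) $ i" for i and x :: "real^3"
  have blf: "bounded_linear (f i)" for i
    unfolding f_def by (intro bounded_linear_compose[OF bounded_linear_vec_nth matrix_vector_mul_bounded_linear])
  have smf: "smooth_on UNIV (f i)" for i
    by (rule smooth_on_linear[OF blf])
  have df: "dir_deriv v (f i) x = f i v" for v i x
    by (rule dir_deriv_eq) (rule bounded_linear_imp_has_derivative[OF blf])
  have f_axis: "f i (axis k 1) = A $ i $ k" for i k
    by (simp add: f_def matrix_vector_mul_component inner_axis)
  have b1: "bracket P (f j) (f k) x = R x $ j $ k" for j k x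
    unfolding bracket_def df f_axis R_def
    by (simp add: matrix_matrix_mult_def transpose_def sum_3 algebra_simps)
  have b2: "bracket P (f i) (\<lambda>x. R x $ j $ k) (?T y) =
      (\<Sum>l\<in>UNIV. Q y $ i $ l * dir_deriv (axis l 1) (\<lambda>y. Q y $ j $ k) y)" for i j k
  proof -
    define D where "D v = dir_deriv v R (?T y) $ j $ k" for v
    have "linear (\<lambda>v. dir_deriv v R (?T y))"
      using smooth_on_has_derivative[OF smR] has_derivative_linear by blast
    then have lin: "linear D"
      unfolding D_def linear_iff by simp
    have e: "(\<Sum>m\<in>UNIV. A $ m $ l *\<^sub>R (A' *v axis m 1)) = axis l 1" for l
    proof -
      have "(\<Sum>m\<in>UNIV. A $ m $ l *\<^sub>R (A' *v axis m 1)) = A' *v (\<Sum>m\<in>UNIV. A $ m $ l *\<^sub>R axis m 1)"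
        by (simp add: linear_sum[OF matrix_vector_mul_linear] linear_scale[OF matrix_vector_mul_linear])
      also have "(\<Sum>m\<in>UNIV. A $ m $ l *\<^sub>R axis m 1) = A *v axis l 1"
        by (simp add: vec_eq_iff axis_def if_distrib matrix_vector_mult_def cong: if_cong)
      finally show ?thesis by (simp add: matrix_vector_mul_assoc A)
    qed
    have De: "D (axis l 1) = (\<Sum>m\<in>UNIV. A $ m $ l * D (A' *v axis m 1))" for l
      unfolding e[of l, symmetric] by (simp add: linear_sum[OF lin] linear_scale[OF lin])
    have "bracket P (f i) (\<lambda>x. R x $ j $ k) (?T y) =
        (\<Sum>a\<in>UNIV. \<Sum>l\<in>UNIV. P (?T y) $ a $ l * A $ i $ a * D (axis l 1))"
      unfolding bracket_def df f_axis dir_deriv_nth2(2)[OF smR] D_def ..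
    also have "\<dots> = (\<Sum>m\<in>UNIV. R (?T y) $ i $ m * D (A' *v axis m 1))"
      unfolding De R_def by (simp add: matrix_matrix_mult_def transpose_def sum_3 algebra_simps)
    finally show ?thesis
      by (simp add: dir_deriv_nth2(2)[OF smQ] dQ D_def) (simp add: QR)
  qed
  have "bracket P (f i) (bracket P (f j) (f k)) (?T y) + bracket P (f j) (bracket P (f k) (f i)) (?T y)
      + bracket P (f k) (bracket P (f i) (f j)) (?T y) = 0"
    using P smf unfolding poisson_structure_def by blast
  moreover have "bracket P (f j) (f k) = (\<lambda>x. R x $ j $ k)" for j k
    using b1 by (rule ext)
  ultimately show "(\<Sum>l\<in>UNIV. Q y $ i $ l * dir_deriv (axis l 1) (\<lambda>y. Q y $ j $ k) y
       + Q y $ j $ l * dir_deriv (axis l 1) (\<lambda>y. Q y $ k $ i) y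
       + Q y $ k $ l * dir_deriv (axis l 1) (\<lambda>y. Q y $ i $ j) y) = 0"
    by (simp add: b2 sum.distrib)
qed

lemma bivector_eq_0: "bivector a b c = 0 \<longleftrightarrow> a = 0 \<and> b = 0 \<and> c = 0"
  by (auto simp: vec_eq_iff bivector_def skew3_def forall_3)

text \<open>
  The smooth part of the change of coordinates is a translation followed by the linear map \<open>A\<close>; everything else is done by the
  formal change. The germ is admissible because its linear part vanishes only at the origin, whereas the excluded linear structure
  vanishes on the whole third axis.
\<close>

lemma has_normal_form_at:
  fixes P :: "real^3 \<Rightarrow> real^3^3" and A :: "real^3^3"
  assumes P: "poisson_structure P" and q: "P q = 0" and A: "invertible A"
    and ab: "a \<noteq> 0" "b \<noteq> 0"
    and lin: "\<And>v. A ** dir_deriv v P q ** transpose A = bivector ((A *v v) $ 3) (a * (A *v v) $ 1) (b * (A *v v) $ 2)"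
  shows "has_normal_form (translate_to_origin q P) (ps_quadratic (a / 2) (b / 2)) 0"
proof -
  let ?P = "translate_to_origin q P"
  obtain A' where A': "A' ** A = mat 1" "A ** A' = mat 1"
    using A by (auto simp: invertible_def)
  define Q where "Q y = A ** P (q + A' *v y) ** transpose A" for y
  note Q = poisson_change_linear_coordinates[OF P A' Q_def]
  have AA': "A *v (A' *v v) = v" "A' *v (A *v v) = v" for v
    by (simp_all add: matrix_vector_mul_assoc A')
  have "Q 0 = 0" by (simp add: Q_def q)
  then obtain \<Phi> where \<Phi>: "formal_change \<Phi>" "formal_in_coordinates \<Phi> (\<lambda>i j. taylor (\<lambda>y. Q y $ i $ j))
    (formal_normal_form (ps_quadratic (a / 2) (b / 2)) 0)"
    using levi_normal_form[of Q a b, OF dir_deriv_nth2(1)[OF Q(1)] Q(2) Q(4)] ab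
    by (auto simp: dir_deriv_nth2(2)[OF Q(1)] Q(3) lin AA')
  have smP: "smooth_on UNIV P"
    using P by (auto simp: poisson_structure_def)
  have dP: "(?P has_derivative (\<lambda>v. dir_deriv v P q)) (at 0)"
  proof -
    have "((\<lambda>x. q + x) has_derivative (\<lambda>v. v)) (at 0)"
      by (auto intro!: derivative_eq_intros)
    from has_derivative_compose[OF this, of P "\<lambda>v. dir_deriv v P q"] smooth_on_has_derivative[OF smP, of q]
    show ?thesis by (simp add: translate_to_origin_def)
  qed
  have inj: "v = 0" if "dir_deriv v P q = 0" for v
  proof -
    have "bivector ((A *v v) $ 3) (a * (A *v v) $ 1) (b * (A *v v) $ 2) = 0"
      using lin[of v] that by simp
    from this[unfolded bivector_eq_0] have "A *v v = 0" using ab by (auto simp: vec_eq_iff forall_3)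
    then show ?thesis using AA'(2)[of v] by simp
  qed
  have admissible: "admissible_germ ?P"
    unfolding admissible_germ_def frechet_derivative_at[OF dP, symmetric]
  proof (intro conjI notI)
    show "?P 0 = 0" by (simp add: translate_to_origin_def q)
    assume "(\<lambda>v. dir_deriv v P q) = (\<lambda>x. 0)"
    then have "axis 1 1 = (0 :: real^3)" using inj by metis
    then show False by (simp add: axis_eq_0_iff)
  next
    assume "linear_isomorphic (\<lambda>v. dir_deriv v P q) (\<lambda>x. bivector 0 (x $ 2) (- (x $ 1)))"
    then obtain B :: "real^3^3" where B: "invertible B"
      "\<And>x. bivector 0 ((B *v x) $ 2) (- ((B *v x) $ 1)) = B ** dir_deriv x P q ** transpose B"
      by (auto simp: linear_isomorphic_def)
    obtain B' where B': "B' ** B = mat 1" "B ** B' = mat 1"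
      using B(1) by (auto simp: invertible_def)
    define v where "v = B' *v axis 3 1"
    have Bv: "B *v v = axis 3 1"
      by (simp add: v_def matrix_vector_mul_assoc B')
    have "B ** dir_deriv v P q ** transpose B = 0"
      using B(2)[of v] bivector_eq_0[of 0 0 0] by (simp add: Bv axis_def)
    then have "B' ** (B ** dir_deriv v P q ** transpose B) ** transpose B' = 0" by simp
    also have "B' ** (B ** dir_deriv v P q ** transpose B) ** transpose B' =
        (B' ** B) ** dir_deriv v P q ** transpose (B' ** B)"
      by (simp add: matrix_mul_assoc matrix_transpose_mul)
    finally have "dir_deriv v P q = 0" by (simp add: B')
    then have "v = 0" by (rule inj)
    with Bv show False by (simp add: axis_eq_0_iff)
  qed
  have coords: "local_coordinates UNIV (\<lambda>x. A *v x)" "in_coordinates UNIV (\<lambda>x. A *v x) ?P Q"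
  proof -
    have bl: "bounded_linear (\<lambda>x. A *v x)" by (rule matrix_vector_mul_bounded_linear)
    have jac: "jacobian (\<lambda>x. A *v x) x = A" for x
      unfolding jacobian_def frechet_derivative_at[OF bounded_linear_imp_has_derivative[OF bl], symmetric]
      by (simp add: matrix_of_matrix_vector_mul)
    show "local_coordinates UNIV (\<lambda>x. A *v x)"
      unfolding local_coordinates_def jac
      using A smooth_on_linear[OF bl] by (auto intro!: inj_on_inverseI[where g = "\<lambda>x. A' *v x"] simp: AA')
    show "in_coordinates UNIV (\<lambda>x. A *v x) ?P Q"
      unfolding in_coordinates_def jac by (simp add: Q_def AA' translate_to_origin_def)
  qed
  have const: "ps_const_term (ps_quadratic (a / 2) (b / 2)) = 0"
    by (simp add: ps_quadratic_def ps_const_term_def power2_eq_square ps_coeff_var_mult)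
  show ?thesis
    unfolding has_normal_form_def
    using admissible const coords \<Phi>
    by (auto simp: ps_const_term_def intro!: exI[of _ UNIV] exI[of _ "\<lambda>x. A *v x"] exI[of _ Q] exI[of _ \<Phi>])
qed

text \<open>
  Scaling of the variables, possibly combined with their exchange.
\<close>

lemma jet_R_equiv_quadratic:
  assumes "\<Phi> = (\<lambda>i::2. if i = 1 then ps_const u * ps_var k else ps_const v * ps_var l)"
    and "{k, l} = {1, 2}" and "u \<noteq> 0" "v \<noteq> 0"
    and "ps_const (\<alpha> * u\<^sup>2) * (ps_var k)\<^sup>2 + ps_const (\<beta> * v\<^sup>2) * (ps_var l)\<^sup>2 = g"
  shows "jet_R_equiv 2 (ps_quadratic \<alpha> \<beta>) g"
proof -
  let ?f = "ps_quadratic \<alpha> \<beta>"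
  have sq: "ps_hom 2 ((ps_var i)\<^sup>2 :: 2 pseries)" for i
    using ps_hom_mult[OF ps_hom_var ps_hom_var, of i i] by (simp add: power2_eq_square numeral_2_eq_2)
  have jet: "ps_jet 2 F = F" if "ps_hom 2 F" for F :: "2 pseries"
    by (rule pseries_eqI) (use that in \<open>auto simp: ps_jet_def ps_hom_def\<close>)
  have const: "ps_const_term (\<Phi> i) = 0" for i
    by (simp add: assms(1) ps_const_term_def ps_coeff_var fun_eq_iff)
  have "ps_compose ?f \<Phi> = ps_const \<alpha> * (\<Phi> 1)\<^sup>2 + ps_const \<beta> * (\<Phi> 2)\<^sup>2"
    by (simp add: ps_quadratic_def ps_compose_simps ps_compose_var_power const)
  also have "\<dots> = g"
    unfolding assms(5)[symmetric]
    by (simp add: assms(1) power2_eq_square ps_const_mult[symmetric] ac_simps)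
  finally have "ps_compose (ps_jet 2 ?f) \<Phi> = g"
    using sq by (simp add: jet ps_quadratic_def)
  moreover have "formal_change \<Phi>"
  proof -
    have "k = 1 \<and> l = 2 \<or> k = 2 \<and> l = 1"
      using assms(2) by (auto simp: doubleton_eq_iff)
    then have "det (\<chi> i j. ps_linear_coeff (\<Phi> i) j :: real^2^2) \<noteq> 0"
      using assms(3,4)
      by (elim disjE; elim conjE) (simp_all add: det_2 assms(1) ps_linear_coeff_def ps_coeff_var fun_eq_iff forall_2)
    then show ?thesis
      by (simp add: formal_change_def const invertible_det_nz)
  qed
  ultimately show ?thesis
    unfolding jet_R_equiv_def by auto
qed

lemma quadratic_scale: "c \<noteq> 0 \<Longrightarrow> \<exists>u. u \<noteq> 0 \<and> c / 2 * u\<^sup>2 = sgn (c::real)"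
  by (rule exI[of _ "sqrt (2 / \<bar>c\<bar>)"]) (auto simp: sgn_if)

lemma singularity_type:
  fixes P :: "real^3 \<Rightarrow> real^3^3" and A :: "real^3^3"
  assumes "poisson_structure P" "P q = 0" "invertible A"
    and ab: "a \<noteq> 0" "b \<noteq> 0"
    and "\<And>v. A ** dir_deriv v P q ** transpose A = bivector ((A *v v) $ 3) (a * (A *v v) $ 1) (b * (A *v v) $ 2)"
  shows "a > 0 \<Longrightarrow> b > 0 \<Longrightarrow> so3_singularity_at P q"
    and "\<not> (a > 0 \<and> b > 0) \<Longrightarrow> sl2_singularity_at P q"
proof -
  note nf = has_normal_form_at[OF assms]
  let ?f = "ps_quadratic (a / 2) (b / 2)"
  obtain u v where uv: "u \<noteq> 0" "a / 2 * u\<^sup>2 = sgn a" "v \<noteq> 0" "b / 2 * v\<^sup>2 = sgn b"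
    using quadratic_scale ab by metis
  have eq1: "jet_R_equiv 2 ?f (ps_const (sgn a) * ps_x\<^sup>2 + ps_const (sgn b) * ps_y\<^sup>2)"
    by (rule jet_R_equiv_quadratic[OF refl _ uv(1,3), of 1 2]) (simp_all only: uv)
  have eq2: "jet_R_equiv 2 ?f (ps_const (sgn a) * ps_y\<^sup>2 + ps_const (sgn b) * ps_x\<^sup>2)"
    by (rule jet_R_equiv_quadratic[OF refl _ uv(1,3), of 2 1]) (simp_all only: uv insert_commute)
  note m = ps_const_minus_1
  show "so3_singularity_at P q" if "a > 0" "b > 0"
    unfolding so3_singularity_at_def so3_singularity_def using nf eq1 that by auto
  show "sl2_singularity_at P q" if neg: "\<not> (a > 0 \<and> b > 0)"
  proof -
    consider "a > 0" "b < 0" | "a < 0" "b > 0" | "a < 0" "b < 0" using neg ab by (metis not_less_iff_gr_or_eq)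
    then have "jet_R_equiv 2 ?f (ps_x\<^sup>2 - ps_y\<^sup>2) \<or> jet_R_equiv 2 ?f (- ps_x\<^sup>2 - ps_y\<^sup>2)"
      using eq1 eq2 by cases (simp_all add: m)
    with nf show ?thesis
      unfolding sl2_singularity_at_def sl2_singularity_def by blast
  qed
qed

section \<open>The type in terms of the linear part\<close>

text \<open>
  The identification of vectors with skew matrices: the components of \<open>p\<close> are the brackets \<open>{y,z}, {z,x}, {x,y}\<close>.
\<close>

definition bivector_of :: "real^3 \<Rightarrow> real^3^3" where
  "bivector_of p = bivector (p $ 3) (p $ 1) (p $ 2)"

lemma bivector_of_nth [simp]:
  "bivector_of p $ 1 $ 2 = p $ 3" "bivector_of p $ 2 $ 3 = p $ 1" "bivector_of p $ 3 $ 1 = p $ 2"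
  "bivector_of p $ 2 $ 1 = - p $ 3" "bivector_of p $ 3 $ 2 = - p $ 1" "bivector_of p $ 1 $ 3 = - p $ 2"
  "bivector_of p $ i $ i = 0"
  by (auto simp: bivector_of_def bivector_def skew3_def)

lemma conjugate_bivector_of:
  fixes A :: "real^3^3"
  shows "(A ** bivector_of p ** transpose A) $ i $ j = p \<bullet> cross3 (A $ i) (A $ j)"
proof -
  have "(A ** bivector_of p ** transpose A) $ i $ j = (\<Sum>k\<in>UNIV. \<Sum>l\<in>UNIV. A $ i $ l * bivector_of p $ l $ k * A $ j $ k)"
    by (simp add: matrix_matrix_mult_def transpose_def sum_distrib_right)
  then show ?thesis
    by (simp add: sum_3 cross3_simps)
qed

text \<open>
  Let \<open>w\<close> be the vector of the differences of opposite entries of \<open>M\<close>, which is the curl of the linear vector field \<open>M\<close> up to sign.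
  The Jacobi identity, differentiated at the zero \<open>q\<close> in the direction \<open>v\<close>, says that \<open>M v\<close> is orthogonal to \<open>w\<close>. As \<open>M\<close> is
  surjective, \<open>w = 0\<close>.
\<close>

lemma linear_part_symmetric:
  fixes P :: "real^3 \<Rightarrow> real^3^3" and M :: "real^3^3"
  assumes P: "poisson_structure P" and q: "P q = 0"
    and M: "\<And>v. dir_deriv v P q = bivector_of (M *v v)" and det: "det M \<noteq> 0"
  shows "transpose M = M"
proof -
  define Q where "Q y = P (q + y)" for y
  have QI: "Q y = mat 1 ** P (q + mat 1 *v y) ** transpose (mat 1)" for y
    by (simp add: Q_def)
  have [simp]: "(mat 1 :: real^3^3) ** mat 1 = mat 1" by simp
  note Q = poisson_change_linear_coordinates[of P "mat 1" "mat 1", OF P _ _ QI, simplified]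
  have Q0: "Q 0 = 0" by (simp add: Q_def q)
  have dQ: "dir_deriv v (\<lambda>y. Q y $ i $ j) 0 = bivector_of (M *v v) $ i $ j" for v i j
    by (simp add: dir_deriv_nth2(2)[OF Q(1)] Q(3) M)
  have prod: "((\<lambda>y. Q y $ i $ l * dir_deriv w (\<lambda>y. Q y $ j $ k) y) has_derivative
      (\<lambda>v. bivector_of (M *v v) $ i $ l * bivector_of (M *v w) $ j $ k)) (at 0)" for i l j k w
  proof -
    have "((\<lambda>y. Q y $ i $ l * dir_deriv w (\<lambda>y. Q y $ j $ k) y) has_derivative
      (\<lambda>v. Q 0 $ i $ l * dir_deriv v (dir_deriv w (\<lambda>y. Q y $ j $ k)) 0
        + dir_deriv v (\<lambda>y. Q y $ i $ l) 0 * dir_deriv w (\<lambda>y. Q y $ j $ k) 0)) (at 0)"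
      by (intro bounded_bilinear.FDERIV[OF bounded_bilinear_mult] smooth_on_has_derivative[of UNIV]
          smooth_on_dir_deriv dir_deriv_nth2(1)[OF Q(1)] UNIV_I)
    then show ?thesis by (simp add: Q0 dQ)
  qed
  define m where "m v i = (M *v v) $ i" for v i
  have "((\<lambda>y. \<Sum>l\<in>UNIV. Q y $ 1 $ l * dir_deriv (axis l 1) (\<lambda>y. Q y $ 2 $ 3) y
       + Q y $ 2 $ l * dir_deriv (axis l 1) (\<lambda>y. Q y $ 3 $ 1) y
       + Q y $ 3 $ l * dir_deriv (axis l 1) (\<lambda>y. Q y $ 1 $ 2) y) has_derivative
     (\<lambda>v. \<Sum>l\<in>UNIV. bivector_of (M *v v) $ 1 $ l * bivector_of (M *v axis l 1) $ 2 $ 3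
       + bivector_of (M *v v) $ 2 $ l * bivector_of (M *v axis l 1) $ 3 $ 1
       + bivector_of (M *v v) $ 3 $ l * bivector_of (M *v axis l 1) $ 1 $ 2)) (at 0)"
    by (intro has_derivative_sum has_derivative_add prod)
  then have "((\<lambda>y. 0 :: real) has_derivative
     (\<lambda>v. \<Sum>l\<in>UNIV. bivector_of (M *v v) $ 1 $ l * bivector_of (M *v axis l 1) $ 2 $ 3
       + bivector_of (M *v v) $ 2 $ l * bivector_of (M *v axis l 1) $ 3 $ 1
       + bivector_of (M *v v) $ 3 $ l * bivector_of (M *v axis l 1) $ 1 $ 2)) (at (0 :: real^3))"
    unfolding Q(4) .
  from has_derivative_unique[OF this has_derivative_const]
  have jac: "m v 1 * (M $ 2 $ 3 - M $ 3 $ 2) + m v 2 * (M $ 3 $ 1 - M $ 1 $ 3) + m v 3 * (M $ 1 $ 2 - M $ 2 $ 1) = 0" for v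
    by (simp add: fun_eq_iff sum_3 m_def matrix_vector_mul_component inner_axis algebra_simps)
  obtain M' where M': "M ** M' = mat 1"
    using det by (auto simp: invertible_det_nz[symmetric] invertible_def)
  define w :: "real^3" where "w = vector [M $ 2 $ 3 - M $ 3 $ 2, M $ 3 $ 1 - M $ 1 $ 3, M $ 1 $ 2 - M $ 2 $ 1]"
  have "M *v (M' *v w) = w"
    by (simp add: matrix_vector_mul_assoc M')
  then have "m (M' *v w) i = w $ i" for i by (simp add: m_def)
  with jac[of "M' *v w"] have "w $ 1 * w $ 1 + w $ 2 * w $ 2 + w $ 3 * w $ 3 = 0"
    by (simp add: w_def)
  then have "w \<bullet> w = 0" by (simp add: inner_vec_def sum_3)
  then have "w $ 1 = 0" "w $ 2 = 0" "w $ 3 = 0" by simp_all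
  then show ?thesis by (simp add: w_def vec_eq_iff forall_3 transpose_def)
qed

text \<open>
  With \<open>u\<^sub>1 = M w\<^sub>1\<close>, \<open>u\<^sub>2 = M w\<^sub>2\<close> and \<open>u\<^sub>3 = det M (w\<^sub>1 \<times> w\<^sub>2)\<close>, regarded as linear functions, the linear brackets are
  \<open>{u\<^sub>1,u\<^sub>2} = u\<^sub>3\<close>, \<open>{u\<^sub>2,u\<^sub>3} = a u\<^sub>1\<close>, \<open>{u\<^sub>3,u\<^sub>1} = b u\<^sub>2\<close>, where \<open>a\<close> and \<open>b\<close> are \<open>det M\<close> times the values
  of the quadratic form of \<open>M\<close> at \<open>w\<^sub>2\<close> and at \<open>w\<^sub>1\<close>. So an orthogonal pair of vectors for this form diagonalises the Lie algebra,
  and the signs of \<open>a\<close> and \<open>b\<close> are both positive exactly if the form is definite.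
\<close>

lemma singularity_type_of_linear_part:
  fixes P :: "real^3 \<Rightarrow> real^3^3" and M :: "real^3^3"
  assumes P: "poisson_structure P" and q: "P q = 0"
    and M: "\<And>v. dir_deriv v P q = bivector_of (M *v v)" and det: "det M \<noteq> 0"
    and w: "w1 \<bullet> (M *v w2) = 0" "w1 \<bullet> (M *v w1) \<noteq> 0" "w2 \<bullet> (M *v w2) \<noteq> 0"
  shows "det M * (w1 \<bullet> (M *v w1)) > 0 \<Longrightarrow> det M * (w2 \<bullet> (M *v w2)) > 0 \<Longrightarrow> so3_singularity_at P q"
    and "\<not> (det M * (w1 \<bullet> (M *v w1)) > 0 \<and> det M * (w2 \<bullet> (M *v w2)) > 0) \<Longrightarrow> sl2_singularity_at P q"
proof -
  have sym: "transpose M = M"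
    by (rule linear_part_symmetric[OF P q M det])
  have adj: "(M *v x) \<bullet> y = x \<bullet> (M *v y)" for x y
    by (metis dot_lmul_matrix sym transpose_matrix_vector)
  define n1 n2 where "n1 = w1 \<bullet> (M *v w1)" and "n2 = w2 \<bullet> (M *v w2)"
  define u1 u2 u3 where "u1 = M *v w1" and "u2 = M *v w2" and "u3 = det M *\<^sub>R cross3 w1 w2"
  define A :: "real^3^3" where "A = vector [u1, u2, u3]"
  have A_nth: "A $ 1 = u1" "A $ 2 = u2" "A $ 3 = u3"
    by (simp_all add: A_def)
  have Av: "(A *v v) $ i = (A $ i) \<bullet> v" for v i
    by (simp add: matrix_vector_mul_component)
  have c12: "M *v cross3 u1 u2 = u3"
    unfolding u1_def u2_def u3_def using cross_matrix_mult[of M w1 w2] by (simp add: sym)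
  have c23: "cross3 u2 u3 = (det M * n2) *\<^sub>R w1"
    using w(1) by (simp add: u2_def u3_def cross_mult_right Lagrange n2_def adj inner_commute)
  have "w2 \<bullet> (M *v w1) = 0"
    using w(1) adj[of w2 w1] by (simp add: inner_commute)
  then have c31: "cross3 u3 u1 = (det M * n1) *\<^sub>R w2"
    by (simp add: u1_def u3_def cross_mult_left cross_skew[of "cross3 w1 w2"] Lagrange n1_def adj inner_commute)
  have lin: "A ** dir_deriv v P q ** transpose A =
      bivector ((A *v v) $ 3) ((det M * n2) * (A *v v) $ 1) ((det M * n1) * (A *v v) $ 2)" for v
  proof -
    have *: "(A ** dir_deriv v P q ** transpose A) $ i $ j = v \<bullet> (M *v cross3 (A $ i) (A $ j))" for i j
      unfolding M conjugate_bivector_of adj ..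
    have e12: "v \<bullet> (M *v cross3 u1 u2) = u3 \<bullet> v" by (simp add: c12 inner_commute)
    have e23: "v \<bullet> (M *v cross3 u2 u3) = (det M * n2) * (u1 \<bullet> v)"
      unfolding c23 by (simp add: matrix_vector_mult_scaleR u1_def inner_commute)
    have e31: "v \<bullet> (M *v cross3 u3 u1) = (det M * n1) * (u2 \<bullet> v)"
      unfolding c31 by (simp add: matrix_vector_mult_scaleR u2_def inner_commute)
    have neg: "v \<bullet> (M *v cross3 x y) = - (v \<bullet> (M *v cross3 y x))" for x y
      by (subst cross_skew) (simp add: linear_neg[OF matrix_vector_mul_linear])
    show ?thesis
      by (simp add: vec_eq_iff forall_3 * Av A_nth bivector_def skew3_def e12 e23 e31 neg[of u2 u1] neg[of u3 u2] neg[of u1 u3])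
  qed
  have "det A = u1 \<bullet> cross3 u2 u3"
    by (simp add: A_def dot_cross_det)
  also have "\<dots> = det M * n2 * n1"
    unfolding c23 by (simp add: u1_def n1_def inner_commute)
  finally have "invertible A"
    using det w by (simp add: invertible_det_nz n1_def n2_def)
  note type = singularity_type[OF P q this _ _ lin]
  show "so3_singularity_at P q" if "det M * (w1 \<bullet> (M *v w1)) > 0" "det M * (w2 \<bullet> (M *v w2)) > 0"
    using that det w by (intro type) (auto simp: n1_def n2_def)
  show "sl2_singularity_at P q" if "\<not> (det M * (w1 \<bullet> (M *v w1)) > 0 \<and> det M * (w2 \<bullet> (M *v w2)) > 0)"
    using that det w by (intro type) (auto simp: n1_def n2_def)
qed

section \<open>Folds of zero sets\<close>

definition rank_one_update :: "real^3^3 \<Rightarrow> real^3 \<Rightarrow> real^3 \<Rightarrow> real^3^3" where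
  "rank_one_update M u v = (\<chi> i j. M $ i $ j + u $ i * v $ j)"

lemma rank_one_update_vector: "rank_one_update M u v *v x = M *v x + (v \<bullet> x) *\<^sub>R u"
  by (simp add: rank_one_update_def vec_eq_iff matrix_vector_mult_def sum_3 inner_vec_def algebra_simps)

text \<open>
  The determinant is affine along rank one perturbations. This gives Cramer's rule in the form in which it is used for the zero curve.
\<close>

lemma det_rank_one_update:
  "det (rank_one_update M (e *\<^sub>R u) v) = det M + e * (det (rank_one_update M u v) - det M)"
  by (simp add: rank_one_update_def det_3 algebra_simps)

lemma det_0_if_kernel: "M *v x = 0 \<Longrightarrow> x \<noteq> 0 \<Longrightarrow> det (M :: real^3^3) = 0"
  by (metis invertible_det_nz invertible_def matrix_left_invertible_ker)

lemma smooth_on_diff: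
  fixes f g :: "'a::real_normed_vector \<Rightarrow> real"
  assumes "open S" "smooth_on S f" "smooth_on S g"
  shows "smooth_on S (\<lambda>x. f x - g x)"
  using smooth_on_add[OF assms(1,2) smooth_on_mult[OF assms(1) smooth_on_const assms(3), of "-1"]] by simp

lemma smooth_on_det:
  fixes M :: "'a::real_normed_vector \<Rightarrow> real^3^3"
  assumes "open S" "\<And>i j. smooth_on S (\<lambda>x. M x $ i $ j)"
  shows "smooth_on S (\<lambda>x. det (M x))"
  unfolding det_3 using assms by (intro smooth_on_add smooth_on_diff smooth_on_mult)

definition space_jacobian :: "(real \<times> (real^3) \<Rightarrow> real^3) \<Rightarrow> real \<times> (real^3) \<Rightarrow> real^3^3" where
  "space_jacobian F z = matrix (\<lambda>x. dir_deriv (0, x) F z)"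

lemma dir_deriv_linear:
  assumes "smooth_on S F" "z \<in> S"
  shows "linear (\<lambda>w. dir_deriv w F z)"
  using smooth_on_has_derivative[OF assms] by (rule has_derivative_linear)

lemma space_jacobian_vector:
  assumes "smooth_on S F" "z \<in> S"
  shows "space_jacobian F z *v x = dir_deriv (0, x) F z"
proof -
  have "linear (\<lambda>x. dir_deriv (0, x) F z)"
    using linear_compose[OF _ dir_deriv_linear[OF assms], of "\<lambda>x. (0, x)"]
    by (simp add: o_def linear_iff)
  then show ?thesis unfolding space_jacobian_def by (simp add: matrix_works)
qed

lemma dir_deriv_split:
  assumes "smooth_on S (F :: real \<times> (real^3) \<Rightarrow> real^3)" "z \<in> S"
  shows "dir_deriv (e, x) F z = space_jacobian F z *v x + e *\<^sub>R dir_deriv (1, 0) F z"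
proof -
  note lin = dir_deriv_linear[OF assms]
  have "dir_deriv ((0, x) + e *\<^sub>R (1, 0)) F z = dir_deriv (0, x) F z + e *\<^sub>R dir_deriv (1, 0) F z"
    by (simp only: linear_add[OF lin] linear_scale[OF lin])
  then show ?thesis by (simp add: space_jacobian_vector[OF assms])
qed

lemma smooth_on_space_jacobian:
  assumes "open S" "smooth_on S F"
  shows "smooth_on S (\<lambda>z. space_jacobian F z $ i $ j)"
proof -
  have "space_jacobian F z $ i $ j = dir_deriv (0, axis j 1) F z $ i" for z
    by (simp add: space_jacobian_def matrix_def)
  then show ?thesis
    using smooth_on_nth[OF assms(1) smooth_on_dir_deriv[OF assms(2)]] by simp
qed

lemma derivative_sign:
  assumes "(f has_real_derivative k) (at 0)" "f 0 = 0" "k \<noteq> 0"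
  shows "\<exists>\<delta>>0. \<forall>t. t \<noteq> 0 \<longrightarrow> \<bar>t\<bar> < \<delta> \<longrightarrow> f t * k * t > 0"
proof -
  have "((\<lambda>h. f h / h) \<longlongrightarrow> k) (at 0)"
    using assms(1,2) by (simp add: DERIV_def)
  then have "((\<lambda>h. f h / h * k) \<longlongrightarrow> k * k) (at 0)"
    by (intro tendsto_intros)
  moreover have "k * k > 0" using assms(3) by (metis not_real_square_gt_zero)
  ultimately have "eventually (\<lambda>h. f h / h * k > 0) (at 0)"
    by (rule order_tendstoD)
  then obtain \<delta> where \<delta>: "\<delta> > 0" "\<And>t. t \<noteq> 0 \<Longrightarrow> \<bar>t\<bar> < \<delta> \<Longrightarrow> f t / t * k > 0"
    by (auto simp: eventually_at dist_real_def)
  show ?thesis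
  proof (intro exI[of _ \<delta>] conjI allI impI)
    fix t assume t: "t \<noteq> 0" "\<bar>t\<bar> < \<delta>"
    have "f t * k * t = (f t / t * k) * (t * t)" using t by simp
    also have "t * t > 0" using t by (metis not_real_square_gt_zero)
    then have "f t / t * k * (t * t) > 0" by (rule mult_pos_pos[OF \<delta>(2)[OF t]])
    finally show "f t * k * t > 0" .
  qed (rule \<delta>)
qed

text \<open>
  The inverse function theorem in terms of directional derivatives.
\<close>

lemma smooth_local_inverse:
  fixes G :: "'a::euclidean_space \<Rightarrow> 'a"
  assumes \<Omega>: "open \<Omega>" "z0 \<in> \<Omega>" and G: "smooth_on \<Omega> G" and inj: "\<And>w. dir_deriv w G z0 = 0 \<Longrightarrow> w = 0"
  obtains N V g where "open N" "N \<subseteq> \<Omega>" "z0 \<in> N" "open V" "G z0 \<in> V" "\<And>z. z \<in> N \<Longrightarrow> g (G z) = z"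
    "\<And>y. y \<in> V \<Longrightarrow> G (g y) = y \<and> g y \<in> N"
    "\<And>y. y \<in> V \<Longrightarrow> (g has_derivative (\<lambda>w. dir_deriv w g y)) (at y)"
    "\<And>y w. y \<in> V \<Longrightarrow> dir_deriv (dir_deriv w g y) G (g y) = w"
proof -
  obtain G' where G': "\<And>x. x \<in> \<Omega> \<Longrightarrow> (G has_derivative blinfun_apply (G' x)) (at x)" "continuous_on \<Omega> G'"
    "\<And>x w. x \<in> \<Omega> \<Longrightarrow> blinfun_apply (G' x) w = dir_deriv w G x"
    by (rule smooth_on_C1[OF \<Omega>(1) G]) (rule that)
  have "inj (blinfun_apply (G' z0))"
    unfolding linear_injective_0[OF bounded_linear.linear[OF blinfun.bounded_linear_right]]
    using inj by (simp add: G'(3) \<Omega>(2))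
  then obtain h where h: "linear h" "h \<circ> blinfun_apply (G' z0) = id"
    using linear_injective_left_inverse[OF bounded_linear.linear[OF blinfun.bounded_linear_right]] by blast
  have hG: "h (blinfun_apply (G' z0) i) = i" for i using h(2) by (metis comp_apply id_apply)
  have "bounded_linear h" using h(1) by (simp add: linear_conv_bounded_linear)
  then have "Blinfun h o\<^sub>L G' z0 = id_blinfun"
    by (intro blinfun_eqI) (simp add: bounded_linear_Blinfun_apply hG)
  from inverse_function_theorem[OF \<Omega>(1) G'(1,2) \<Omega>(2) this]
  obtain N V g g' where N: "open N" "N \<subseteq> \<Omega>" "z0 \<in> N" "open V" "G z0 \<in> V" "homeomorphism N V G g"
    and g': "\<And>y. y \<in> V \<Longrightarrow> (g has_derivative g' y) (at y)"
    "\<And>y. y \<in> V \<Longrightarrow> g' y = inv (blinfun_apply (G' (g y)))"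
    "\<And>y. y \<in> V \<Longrightarrow> bij (blinfun_apply (G' (g y)))"
    by blast
  have gG: "g (G z) = z" if "z \<in> N" for z using N(6) that by (auto simp: homeomorphism_def)
  have Gg: "G (g y) = y" "g y \<in> N" if "y \<in> V" for y using N(6) that by (auto simp: homeomorphism_def)
  have dg: "dir_deriv w g y = g' y w" if "y \<in> V" for y w
    by (rule dir_deriv_eq[OF g'(1)[OF that]])
  have "dir_deriv (dir_deriv w g y) G (g y) = w" if "y \<in> V" for y w
  proof -
    have "blinfun_apply (G' (g y)) (g' y w) = w"
      using g'(2,3)[OF that] by (simp add: bij_is_surj surj_f_inv_f)
    moreover have "g y \<in> \<Omega>" using Gg(2)[OF that] N(2) by blast
    ultimately show ?thesis by (simp add: G'(3) dg[OF that])
  qed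
  moreover have "(g has_derivative (\<lambda>w. dir_deriv w g y)) (at y)" if "y \<in> V" for y
    using g'(1)[OF that] by (simp add: dg[OF that])
  ultimately show thesis
    by (intro that[OF N(1-5) gG]) (use Gg in auto)
qed

lemma smooth_implicit_curve:
  fixes f :: "real \<times> (real^3) \<Rightarrow> real^3"
  assumes \<Omega>: "open \<Omega>" "(0, 0) \<in> \<Omega>" and f: "smooth_on \<Omega> f" "f (0, 0) = 0" and inv: "det (space_jacobian f (0, 0)) \<noteq> 0"
  obtains \<gamma> \<delta> D where "\<delta> > 0" "\<And>\<epsilon>. \<bar>\<epsilon>\<bar> < \<delta> \<Longrightarrow> (\<epsilon>, \<gamma> \<epsilon>) \<in> \<Omega> \<and> f (\<epsilon>, \<gamma> \<epsilon>) = 0" "(\<gamma> has_derivative D) (at 0)"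
proof -
  define G where "G z = (fst z, f z)" for z
  have smG: "smooth_on \<Omega> G"
    unfolding G_def by (intro smooth_on_Pair \<Omega> f smooth_on_linear bounded_linear_fst)
  have dG: "dir_deriv w G (0, 0) = (fst w, dir_deriv w f (0, 0))" for w
    unfolding G_def
    by (rule dir_deriv_eq)
      (intro has_derivative_Pair bounded_linear_imp_has_derivative bounded_linear_fst smooth_on_has_derivative[OF f(1) \<Omega>(2)])
  have inj: "w = 0" if "dir_deriv w G (0, 0) = 0" for w
  proof -
    have w: "fst w = 0" "dir_deriv (0, snd w) f (0, 0) = 0"
      using that unfolding dG by (cases w; auto simp: zero_prod_def)+
    then have "space_jacobian f (0, 0) *v snd w = 0"
      by (simp add: space_jacobian_vector[OF f(1) \<Omega>(2)])
    then have "snd w = 0" using det_0_if_kernel inv by blast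
    with w(1) show ?thesis by (simp add: prod_eq_iff)
  qed
  from smooth_local_inverse[OF \<Omega> smG inj] obtain N V g where N: "N \<subseteq> \<Omega>" "open V" "G (0, 0) \<in> V"
    "\<And>y. y \<in> V \<Longrightarrow> G (g y) = y \<and> g y \<in> N"
    "\<And>y. y \<in> V \<Longrightarrow> (g has_derivative (\<lambda>w. dir_deriv w g y)) (at y)"
    by metis
  have G0: "G (0, 0) = (0, 0)" by (simp add: G_def f)
  obtain r where r: "r > 0" "ball (0, 0) r \<subseteq> V" using N(2,3) G0 by (metis open_contains_ball)
  have V: "(t, 0) \<in> V" if "\<bar>t\<bar> < r" for t
    using r(2) that by (auto simp: subset_iff dist_prod_def)
  have g: "(\<epsilon>, snd (g (\<epsilon>, 0))) \<in> \<Omega> \<and> f (\<epsilon>, snd (g (\<epsilon>, 0))) = 0" if "\<bar>\<epsilon>\<bar> < r" for \<epsilon>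
  proof -
    have *: "G (g (\<epsilon>, 0)) = (\<epsilon>, 0)" "g (\<epsilon>, 0) \<in> \<Omega>" using N(1) N(4)[OF V[OF that]] by auto
    have "g (\<epsilon>, 0) = (\<epsilon>, snd (g (\<epsilon>, 0)))"
      using *(1) by (simp add: G_def prod_eq_iff)
    with * show ?thesis by (metis G_def snd_conv)
  qed
  have "((\<lambda>t. (t, 0)) has_derivative (\<lambda>h. (h, 0 :: real^3))) (at (0 :: real))"
    by (auto intro!: derivative_eq_intros)
  from has_derivative_snd[OF has_derivative_compose[OF this N(5)[OF V]]] r(1)
  have "((\<lambda>\<epsilon>. snd (g (\<epsilon>, 0))) has_derivative (\<lambda>h. snd (dir_deriv (h, 0) g (0, 0)))) (at 0)"
    by simp
  with r(1) g show thesis by (rule that)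
qed

text \<open>
  The map \<open>G(\<epsilon>, x) = (v \<bullet> x, F(\<epsilon>, x))\<close> is a local diffeomorphism, and the zeros of \<open>F\<close> form the curve \<open>\<gamma>(t) = G\<^sup>-\<^sup>1(t, 0)\<close>.
  Its velocity \<open>(e, \<xi>)\<close> satisfies \<open>F\<^sub>x \<xi> + e F\<^sub>\<epsilon> = 0\<close> and \<open>v \<bullet> \<xi> = 1\<close>, so \<open>F\<^sub>x + e F\<^sub>\<epsilon> v\<^sup>T\<close> is singular and \<open>det F\<^sub>x = - e \<rho>\<close> with
  \<open>\<rho> = det(F\<^sub>x + F\<^sub>\<epsilon> v\<^sup>T) - det F\<^sub>x\<close>. As \<open>\<rho>\<close> is nonzero at the origin, the velocity \<open>e\<close> of the parameter has the sign of the
  determinant up to a constant sign, and the determinant changes sign at \<open>t = 0\<close> since its derivative there is nonzero.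
\<close>

lemma fold_curve:
  fixes F :: "real \<times> (real^3) \<Rightarrow> real^3"
  assumes \<Omega>: "open \<Omega>" "(0, 0) \<in> \<Omega>" and F: "smooth_on \<Omega> F" and F0: "F (0, 0) = 0"
    and v: "v \<noteq> 0" "dir_deriv (0, v) F (0, 0) = 0"
    and ker: "\<And>e x. dir_deriv (e, x) F (0, 0) = 0 \<Longrightarrow> e = 0 \<and> (\<exists>c. x = c *\<^sub>R v)"
    and fold: "((\<lambda>s. det (space_jacobian F (0, s *\<^sub>R v))) has_real_derivative c) (at 0)" "c \<noteq> 0"
  obtains N \<gamma> \<tau> \<sigma> \<kappa> e where "open N" "(0, 0) \<in> N" "N \<subseteq> \<Omega>" "\<tau> > 0" "\<sigma> = 1 \<or> \<sigma> = -1" "\<kappa> \<noteq> 0" "\<gamma> 0 = (0, 0)"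
    "\<And>t. \<bar>t\<bar> < \<tau> \<Longrightarrow> F (\<gamma> t) = 0 \<and> v \<bullet> snd (\<gamma> t) = t"
    "\<And>z. z \<in> N \<Longrightarrow> F z = 0 \<Longrightarrow> z = \<gamma> (v \<bullet> snd z)"
    "\<And>t. \<bar>t\<bar> < \<tau> \<Longrightarrow> isCont \<gamma> t"
    "\<And>t. \<bar>t\<bar> < \<tau> \<Longrightarrow> ((\<lambda>t. fst (\<gamma> t)) has_real_derivative e t) (at t)"
    "\<And>t. t \<noteq> 0 \<Longrightarrow> \<bar>t\<bar> < \<tau> \<Longrightarrow> \<sigma> * e t * t > 0"
    "\<And>t. t \<noteq> 0 \<Longrightarrow> \<bar>t\<bar> < \<tau> \<Longrightarrow> det (space_jacobian F (\<gamma> t)) * \<kappa> * t > 0"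
proof -
  let ?M = "space_jacobian F"
  let ?d = "\<lambda>z. det (?M z)"
  let ?Fe = "dir_deriv (1, 0) F"
  have smd: "smooth_on \<Omega> ?d"
    by (intro smooth_on_det smooth_on_space_jacobian \<Omega> F)
  define \<rho> where "\<rho> z = det (rank_one_update (?M z) (?Fe z) v) - ?d z" for z
  have sm\<rho>: "smooth_on \<Omega> \<rho>"
    unfolding \<rho>_def
  proof (rule smooth_on_diff[OF \<Omega>(1) _ smd], rule smooth_on_det[OF \<Omega>(1)])
    fix i j
    have "smooth_on \<Omega> (\<lambda>z. ?M z $ i $ j + ?Fe z $ i * v $ j)"
      by (intro smooth_on_add[OF \<Omega>(1) smooth_on_space_jacobian[OF \<Omega>(1) F]]
          smooth_on_mult[OF \<Omega>(1) smooth_on_nth[OF \<Omega>(1) smooth_on_dir_deriv[OF F]] smooth_on_const])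
    then show "smooth_on \<Omega> (\<lambda>z. rank_one_update (?M z) (?Fe z) v $ i $ j)"
      by (simp add: rank_one_update_def)
  qed
  have d0: "?d (0, 0) = 0"
    using v by (intro det_0_if_kernel[of _ v]) (simp_all add: space_jacobian_vector[OF F \<Omega>(2)])
  have \<rho>0: "\<rho> (0, 0) \<noteq> 0"
  proof
    assume "\<rho> (0, 0) = 0"
    then have "det (rank_one_update (?M (0, 0)) (?Fe (0, 0)) v) = 0" by (simp add: \<rho>_def d0)
    then obtain x where x: "x \<noteq> 0" "rank_one_update (?M (0, 0)) (?Fe (0, 0)) v *v x = 0"
      by (metis invertible_det_nz invertible_left_inverse matrix_left_invertible_ker)
    then have "dir_deriv (v \<bullet> x, x) F (0, 0) = 0"
      by (simp add: rank_one_update_vector dir_deriv_split[OF F \<Omega>(2), of "v \<bullet> x" x])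
    from ker[OF this] obtain c where "v \<bullet> x = 0" "x = c *\<^sub>R v" by blast
    with x v(1) show False by simp
  qed
  define G where "G z = (v \<bullet> snd z, F z)" for z
  have bl: "bounded_linear (\<lambda>z :: real \<times> (real^3). v \<bullet> snd z)"
    by (intro bounded_linear_inner_right_comp bounded_linear_snd)
  have smG: "smooth_on \<Omega> G"
    unfolding G_def by (intro smooth_on_Pair \<Omega> F smooth_on_linear[OF bl])
  have dG: "dir_deriv w G z = (v \<bullet> snd w, dir_deriv w F z)" if "z \<in> \<Omega>" for w z
    unfolding G_def
    by (rule dir_deriv_eq)
      (intro has_derivative_Pair bounded_linear_imp_has_derivative[OF bl] smooth_on_has_derivative[OF F that])
  have inj: "w = 0" if "dir_deriv w G (0, 0) = 0" for w
  proof -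
    have w: "v \<bullet> snd w = 0" "dir_deriv (fst w, snd w) F (0, 0) = 0"
      using that by (simp_all add: \<Omega>(2) dG zero_prod_def)
    from ker[OF w(2)] obtain c where "fst w = 0" "snd w = c *\<^sub>R v" by blast
    with w v(1) show "w = 0" by (simp add: prod_eq_iff)
  qed
  obtain N V g where N: "open N" "N \<subseteq> \<Omega>" "(0, 0) \<in> N" "open V" "G (0, 0) \<in> V"
    and gG: "\<And>z. z \<in> N \<Longrightarrow> g (G z) = z" and Gg: "\<And>y. y \<in> V \<Longrightarrow> G (g y) = y \<and> g y \<in> N"
    and g': "\<And>y. y \<in> V \<Longrightarrow> (g has_derivative (\<lambda>w. dir_deriv w g y)) (at y)"
    "\<And>y w. y \<in> V \<Longrightarrow> dir_deriv (dir_deriv w g y) G (g y) = w"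
    by (rule smooth_local_inverse[OF \<Omega> smG inj]) (assumption, rule that)
  have G0: "G (0, 0) = (0, 0)" by (simp add: G_def F0)
  define \<gamma> where "\<gamma> t = g (t, 0)" for t
  have \<gamma>_eq: "\<gamma> = (\<lambda>t. g (t, 0))" by (simp add: fun_eq_iff \<gamma>_def)
  define e where "e t = fst (dir_deriv (1, 0) g (t, 0))" for t
  define \<xi> where "\<xi> t = snd (dir_deriv (1, 0) g (t, 0))" for t
  obtain \<tau>1 where \<tau>1: "\<tau>1 > 0" "\<And>t. \<bar>t\<bar> < \<tau>1 \<Longrightarrow> (t, 0) \<in> V"
  proof -
    obtain r where r: "r > 0" "ball (0, 0) r \<subseteq> V" using N(4,5) G0 by (metis open_contains_ball)
    have "(t, 0) \<in> V" if "\<bar>t\<bar> < r" for t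
      using r(2) that by (auto simp: subset_iff dist_prod_def)
    with r(1) that show thesis by blast
  qed
  have \<gamma>0: "\<gamma> 0 = (0, 0)" using gG[OF N(3)] by (simp add: \<gamma>_def G0)
  have \<gamma>V: "F (\<gamma> t) = 0" "v \<bullet> snd (\<gamma> t) = t" "\<gamma> t \<in> N" "\<gamma> t \<in> \<Omega>" if "\<bar>t\<bar> < \<tau>1" for t
    using Gg[OF \<tau>1(2)[OF that]] N(2) by (auto simp: \<gamma>_def G_def)
  have d\<gamma>: "(\<gamma> has_derivative (\<lambda>h. h *\<^sub>R (e t, \<xi> t))) (at t)" if "\<bar>t\<bar> < \<tau>1" for t
  proof -
    have "((\<lambda>t. (t, 0)) has_derivative (\<lambda>h. (h, 0 :: real^3))) (at t)"
      by (auto intro!: derivative_eq_intros)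
    from has_derivative_compose[OF this g'(1)[OF \<tau>1(2)[OF that]]]
    have "(\<gamma> has_derivative (\<lambda>h. dir_deriv (h, 0) g (t, 0))) (at t)" unfolding \<gamma>_eq .
    moreover have "dir_deriv (h, 0) g (t, 0) = h *\<^sub>R (e t, \<xi> t)" for h
    proof -
      have "dir_deriv (h *\<^sub>R (1, 0)) g (t, 0) = h *\<^sub>R dir_deriv (1, 0) g (t, 0)"
        by (rule linear_scale[OF has_derivative_linear[OF g'(1)[OF \<tau>1(2)[OF that]]]])
      then show ?thesis by (simp add: e_def \<xi>_def)
    qed
    ultimately show ?thesis by simp
  qed
  have tangent: "v \<bullet> \<xi> t = 1" "dir_deriv (e t, \<xi> t) F (\<gamma> t) = 0" if "\<bar>t\<bar> < \<tau>1" for t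
  proof -
    have "dir_deriv (e t, \<xi> t) G (\<gamma> t) = (1, 0)"
      using g'(2)[OF \<tau>1(2)[OF that], of "(1, 0)"] by (simp add: \<gamma>_def e_def \<xi>_def)
    then show "v \<bullet> \<xi> t = 1" "dir_deriv (e t, \<xi> t) F (\<gamma> t) = 0"
      using \<gamma>V(4)[OF that] by (simp_all add: dG)
  qed
  have key: "?d (\<gamma> t) = - e t * \<rho> (\<gamma> t)" if "\<bar>t\<bar> < \<tau>1" for t
  proof -
    have "rank_one_update (?M (\<gamma> t)) (e t *\<^sub>R ?Fe (\<gamma> t)) v *v \<xi> t = 0"
      using tangent[OF that] by (simp add: rank_one_update_vector dir_deriv_split[OF F \<gamma>V(4)[OF that], of "e t" "\<xi> t"])
    moreover have "\<xi> t \<noteq> 0" using tangent(1)[OF that] by auto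
    ultimately have "det (rank_one_update (?M (\<gamma> t)) (e t *\<^sub>R ?Fe (\<gamma> t)) v) = 0"
      by (rule det_0_if_kernel)
    then show ?thesis by (simp add: det_rank_one_update \<rho>_def)
  qed
  have e0: "e 0 = 0" using key[of 0] \<tau>1(1) \<rho>0 by (simp add: \<gamma>0 d0)
  obtain c1 where c1: "\<xi> 0 = c1 *\<^sub>R v"
    using ker[of "e 0" "\<xi> 0"] tangent(2)[of 0] \<tau>1(1) by (auto simp: \<gamma>0)
  then have c1_0: "c1 \<noteq> 0" using tangent(1)[of 0] \<tau>1(1) by auto
  define \<kappa> where "\<kappa> = c1 * c"
  have \<kappa>: "\<kappa> \<noteq> 0" using c1_0 fold(2) by (simp add: \<kappa>_def)
  \<comment> \<open>the hypothesis on the line through \<open>v\<close> is a directional derivative, which is then evaluated on the velocity of the curve\<close>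
  have c_eq: "dir_deriv (0, v) ?d (0, 0) = c"
  proof -
    have "((\<lambda>s :: real. (0 :: real, s *\<^sub>R v)) has_derivative (\<lambda>h. (0, h *\<^sub>R v))) (at 0)"
      by (auto intro!: derivative_eq_intros)
    from has_derivative_compose[OF this, of ?d "\<lambda>w. dir_deriv w ?d (0, 0)"]
    have "((\<lambda>s. ?d (0, s *\<^sub>R v)) has_derivative (\<lambda>h. dir_deriv (0, h *\<^sub>R v) ?d (0, 0))) (at 0)"
      using smooth_on_has_derivative[OF smd \<Omega>(2)] by simp
    from has_derivative_unique[OF this fold(1)[unfolded has_field_derivative_def]]
    show ?thesis by (auto dest!: fun_cong[of _ _ 1])
  qed
  have "((\<lambda>t. ?d (\<gamma> t)) has_derivative (\<lambda>h. dir_deriv (h *\<^sub>R (e 0, \<xi> 0)) ?d (0, 0))) (at 0)"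
    using has_derivative_compose[OF d\<gamma>[of 0], of ?d "\<lambda>w. dir_deriv w ?d (0, 0)"] smooth_on_has_derivative[OF smd \<Omega>(2)] \<tau>1(1)
    by (simp add: \<gamma>0)
  moreover have "dir_deriv (h *\<^sub>R (e 0, \<xi> 0)) ?d (0, 0) = \<kappa> * h" for h
  proof -
    have "dir_deriv (h *\<^sub>R (e 0, \<xi> 0)) ?d (0, 0) = dir_deriv ((h * c1) *\<^sub>R (0, v)) ?d (0, 0)"
      by (simp add: e0 c1)
    also have "\<dots> = (h * c1) * dir_deriv (0, v) ?d (0, 0)"
      using linear_scale[OF dir_deriv_linear[OF smd \<Omega>(2)], of "h * c1" "(0, v)"] by (simp only: real_scaleR_def)
    finally show ?thesis by (simp add: c_eq \<kappa>_def)
  qed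
  ultimately have "((\<lambda>t. ?d (\<gamma> t)) has_real_derivative \<kappa>) (at 0)"
    by (simp add: has_field_derivative_def)
  from derivative_sign[OF this _ \<kappa>] d0 obtain \<tau>2 where \<tau>2: "\<tau>2 > 0"
    "\<And>t. t \<noteq> 0 \<Longrightarrow> \<bar>t\<bar> < \<tau>2 \<Longrightarrow> ?d (\<gamma> t) * \<kappa> * t > 0"
    by (auto simp: \<gamma>0)
  have "isCont (\<lambda>t. \<rho> (\<gamma> t)) 0"
  proof (rule isCont_o2[where f = \<gamma> and g = \<rho>])
    show "isCont \<gamma> 0" using d\<gamma>[of 0] \<tau>1(1) by (auto intro: has_derivative_continuous)
    show "isCont \<rho> (\<gamma> 0)" unfolding \<gamma>0
      using smooth_on_has_derivative[OF sm\<rho> \<Omega>(2)] by (rule has_derivative_continuous)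
  qed
  then have "((\<lambda>t. \<rho> (\<gamma> t) * \<rho> (0, 0)) \<longlongrightarrow> \<rho> (0, 0) * \<rho> (0, 0)) (at 0)"
    by (auto simp: isCont_def \<gamma>0 intro!: tendsto_intros)
  moreover have "\<rho> (0, 0) * \<rho> (0, 0) > 0" using \<rho>0 by (metis not_real_square_gt_zero)
  ultimately have "eventually (\<lambda>t. \<rho> (\<gamma> t) * \<rho> (0, 0) > 0) (at 0)"
    by (rule order_tendstoD)
  then obtain \<tau>3 where \<tau>3: "\<tau>3 > 0" "\<And>t. t \<noteq> 0 \<Longrightarrow> \<bar>t\<bar> < \<tau>3 \<Longrightarrow> \<rho> (\<gamma> t) * \<rho> (0, 0) > 0"
    by (auto simp: eventually_at dist_real_def)
  define \<tau> where "\<tau> = Min {\<tau>1, \<tau>2, \<tau>3}"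
  have \<tau>: "\<tau> > 0" "\<tau> \<le> \<tau>1" "\<tau> \<le> \<tau>2" "\<tau> \<le> \<tau>3"
    using \<tau>1(1) \<tau>2(1) \<tau>3(1) by (auto simp: \<tau>_def)
  \<comment> \<open>the sign of \<open>e\<close> for positive \<open>t\<close>, from \<open>det F\<^sub>x = - e \<rho>\<close> and the sign of \<open>det F\<^sub>x\<close>\<close>
  define \<sigma> where "\<sigma> = - sgn (\<kappa> * \<rho> (0, 0))"
  have \<sigma>: "\<sigma> = 1 \<or> \<sigma> = -1" using \<kappa> \<rho>0 by (auto simp: \<sigma>_def sgn_if)
  show thesis
  proof (rule that[where N = N and \<gamma> = \<gamma> and \<tau> = \<tau> and \<sigma> = \<sigma> and \<kappa> = \<kappa> and e = e])
    show "\<sigma> * e t * t > 0" if t: "t \<noteq> 0" "\<bar>t\<bar> < \<tau>" for t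
    proof -
      have 1: "- e t * \<rho> (\<gamma> t) * \<kappa> * t > 0" using \<tau>2(2)[of t] key[of t] t \<tau> by simp
      have 2: "\<rho> (\<gamma> t) * \<rho> (0, 0) > 0" using \<tau>3(2)[of t] t \<tau> by simp
      have "\<sigma> * e t * t * (\<bar>\<kappa> * \<rho> (0, 0)\<bar> * (\<rho> (\<gamma> t) * \<rho> (\<gamma> t))) =
          (- e t * \<rho> (\<gamma> t) * \<kappa> * t) * (\<rho> (\<gamma> t) * \<rho> (0, 0))"
        by (simp add: \<sigma>_def sgn_if abs_if algebra_simps) 
      also have "\<dots> > 0" using 1 2 by (rule mult_pos_pos)
      finally show ?thesis
        using \<kappa> \<rho>0 by (metis abs_ge_zero mult_nonneg_nonneg not_less zero_le_square zero_less_mult_pos2 mult_nonpos_nonneg)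
    qed
    show "det (?M (\<gamma> t)) * \<kappa> * t > 0" if "t \<noteq> 0" "\<bar>t\<bar> < \<tau>" for t
      using \<tau>2(2)[of t] that \<tau> by simp
    show "F (\<gamma> t) = 0 \<and> v \<bullet> snd (\<gamma> t) = t" if "\<bar>t\<bar> < \<tau>" for t
      using \<gamma>V that \<tau> by simp
    show "z = \<gamma> (v \<bullet> snd z)" if "z \<in> N" "F z = 0" for z
      using gG[OF that(1)] that(2) by (simp add: \<gamma>_def G_def)
    show "isCont \<gamma> t" if "\<bar>t\<bar> < \<tau>" for t
      using d\<gamma>[of t] that \<tau> by (auto intro: has_derivative_continuous)
    show "((\<lambda>t. fst (\<gamma> t)) has_real_derivative e t) (at t)" if "\<bar>t\<bar> < \<tau>" for t
    proof -
      have "(*) (e t) = (\<lambda>h. fst (h *\<^sub>R (e t, \<xi> t)))" by (auto simp: fun_eq_iff)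
      then show ?thesis
        unfolding has_field_derivative_def using has_derivative_fst[OF d\<gamma>[of t]] that \<tau> by simp
    qed
  qed (use N \<tau> \<sigma> \<kappa> \<gamma>0 in auto)
qed

text \<open>
  Along the curve of zeros the parameter, up to sign, decreases to \<open>0\<close> at \<open>t = 0\<close> and increases afterwards. So it takes each small
  value of one sign once on either side of \<open>t = 0\<close>, and no value of the other sign.
\<close>

lemma fold_bifurcation:
  fixes F :: "real \<times> (real^3) \<Rightarrow> real^3"
  assumes \<Omega>: "open \<Omega>" "(0, 0) \<in> \<Omega>" and F: "smooth_on \<Omega> F" and F0: "F (0, 0) = 0"
    and v: "v \<noteq> 0" "dir_deriv (0, v) F (0, 0) = 0"
    and ker: "\<And>e x. dir_deriv (e, x) F (0, 0) = 0 \<Longrightarrow> e = 0 \<and> (\<exists>c. x = c *\<^sub>R v)"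
    and fold: "((\<lambda>s. det (space_jacobian F (0, s *\<^sub>R v))) has_real_derivative c) (at 0)" "c \<noteq> 0"
  obtains \<tau> U W where "\<tau> \<in> {1, -1}" "open U" "0 \<in> U" "open W" "0 \<in> W" "W \<times> U \<subseteq> \<Omega>"
    "\<And>\<epsilon>. \<epsilon> \<in> W \<Longrightarrow> \<tau> * \<epsilon> < 0 \<Longrightarrow> {x\<in>U. F (\<epsilon>, x) = 0} = {}"
    "\<And>\<epsilon>. \<epsilon> \<in> W \<Longrightarrow> \<tau> * \<epsilon> > 0 \<Longrightarrow> \<exists>p q. p \<noteq> q \<and> {x\<in>U. F (\<epsilon>, x) = 0} = {p, q} \<and>
       det (space_jacobian F (\<epsilon>, p)) > 0 \<and> det (space_jacobian F (\<epsilon>, q)) < 0"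
proof -
  let ?d = "\<lambda>z. det (space_jacobian F z)"
  obtain N \<gamma> \<tau> \<sigma> \<kappa> e where N: "open N" "(0, 0) \<in> N" "N \<subseteq> \<Omega>" and \<tau>: "\<tau> > 0" and \<sigma>: "\<sigma> = 1 \<or> \<sigma> = -1"
    and \<kappa>: "\<kappa> \<noteq> 0" and \<gamma>0: "\<gamma> 0 = (0, 0)"
    and \<gamma>: "\<And>t. \<bar>t\<bar> < \<tau> \<Longrightarrow> F (\<gamma> t) = 0 \<and> v \<bullet> snd (\<gamma> t) = t"
    and param: "\<And>z. z \<in> N \<Longrightarrow> F z = 0 \<Longrightarrow> z = \<gamma> (v \<bullet> snd z)"
    and cont: "\<And>t. \<bar>t\<bar> < \<tau> \<Longrightarrow> isCont \<gamma> t"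
    and deriv: "\<And>t. \<bar>t\<bar> < \<tau> \<Longrightarrow> ((\<lambda>t. fst (\<gamma> t)) has_real_derivative e t) (at t)"
    and e_sign: "\<And>t. t \<noteq> 0 \<Longrightarrow> \<bar>t\<bar> < \<tau> \<Longrightarrow> \<sigma> * e t * t > 0"
    and d_sign: "\<And>t. t \<noteq> 0 \<Longrightarrow> \<bar>t\<bar> < \<tau> \<Longrightarrow> ?d (\<gamma> t) * \<kappa> * t > 0"
    by (rule fold_curve[OF \<Omega> F F0 v ker fold]) (assumption, rule that)
  define E where "E t = \<sigma> * fst (\<gamma> t)" for t
  have E0: "E 0 = 0" by (simp add: E_def \<gamma>0)
  have dE: "(E has_real_derivative \<sigma> * e t) (at t)" if "\<bar>t\<bar> < \<tau>" for t
    unfolding E_def using deriv[OF that] by (auto intro!: derivative_eq_intros)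
  have cE: "continuous_on {a..b} E" if "- \<tau> < a" "b < \<tau>" for a b
    using that by (intro continuous_at_imp_continuous_on ballI DERIV_isCont[OF dE]) auto
  have inc: "E a < E b" if "0 \<le> a" "a < b" "b < \<tau>" for a b
  proof (rule DERIV_pos_imp_increasing_open[OF that(2)])
    fix x assume x: "a < x" "x < b"
    then have "\<sigma> * e x > 0" using e_sign[of x] that by (simp add: zero_less_mult_iff)
    then show "\<exists>y. (E has_real_derivative y) (at x) \<and> y > 0" using dE[of x] x that by auto
  qed (use cE that in simp)
  have dec: "E b < E a" if "b \<le> 0" "a < b" "- \<tau> < a" for a b
  proof (rule DERIV_neg_imp_decreasing_open[OF that(2)])
    fix x assume x: "a < x" "x < b"
    then have "\<sigma> * e x < 0" using e_sign[of x] that by (simp add: zero_less_mult_iff)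
    then show "\<exists>y. (E has_real_derivative y) (at x) \<and> y < 0" using dE[of x] x that by auto
  qed (use cE that \<tau> in simp)
  obtain W1 U1 where WU: "open W1" "open U1" "(0, 0) \<in> W1 \<times> U1" "W1 \<times> U1 \<subseteq> N"
    using N(1,2) by (rule open_prod_elim)
  define U where "U = U1 \<inter> {x. \<bar>v \<bullet> x\<bar> < \<tau>}"
  have "open {x. \<bar>v \<bullet> x\<bar> < \<tau>}"
    by (intro open_Collect_less continuous_intros)
  then have U: "open U" "0 \<in> U" using WU \<tau> by (auto simp: U_def)
  obtain \<delta> where \<delta>: "\<delta> > 0" "\<And>t. \<bar>t\<bar> < \<delta> \<Longrightarrow> \<gamma> t \<in> W1 \<times> U"
  proof -
    have "isCont \<gamma> 0" using cont \<tau> by simp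
    moreover have "open (W1 \<times> U)" "\<gamma> 0 \<in> W1 \<times> U" using WU U by (auto simp: \<gamma>0 open_Times)
    ultimately have "eventually (\<lambda>t. \<gamma> t \<in> W1 \<times> U) (at 0)"
      unfolding isCont_def by (rule topological_tendstoD)
    then obtain \<delta> where "\<delta> > 0" "\<And>t. t \<noteq> 0 \<Longrightarrow> \<bar>t\<bar> < \<delta> \<Longrightarrow> \<gamma> t \<in> W1 \<times> U"
      by (auto simp: eventually_at dist_real_def)
    with \<open>\<gamma> 0 \<in> W1 \<times> U\<close> show thesis by (intro that[of \<delta>]) metis+
  qed
  \<comment> \<open>the curve stays in the neighbourhood for \<open>\<bar>t\<bar> \<le> a\<close>, and parameters below \<open>E a\<close> and \<open>E (- a)\<close> are reached there\<close>
  define a where "a = min \<tau> \<delta> / 2"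
  have a: "a > 0" "a < \<tau>" "a < \<delta>" using \<tau> \<delta>(1) by (auto simp: a_def)
  have Ea: "E a > 0" "E (- a) > 0" using inc[of 0 a] dec[of 0 "- a"] a by (auto simp: E0)
  define W where "W = W1 \<inter> {\<epsilon>. \<bar>\<epsilon>\<bar> < E a \<and> \<bar>\<epsilon>\<bar> < E (- a)}"
  have "open {\<epsilon>::real. \<bar>\<epsilon>\<bar> < E a \<and> \<bar>\<epsilon>\<bar> < E (- a)}"
    by (intro open_Collect_conj open_Collect_less continuous_intros)
  then have W: "open W" "0 \<in> W" using WU Ea by (auto simp: W_def)
  have zero: "\<exists>t. \<bar>t\<bar> < \<tau> \<and> \<gamma> t = (\<epsilon>, x)" if "\<epsilon> \<in> W" "x \<in> U" "F (\<epsilon>, x) = 0" for \<epsilon> x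
    using param[of "(\<epsilon>, x)"] that WU(4) by (intro exI[of _ "v \<bullet> x"]) (auto simp: U_def W_def)
  have E_pos: "E t \<ge> 0" if "\<bar>t\<bar> < \<tau>" for t
    using inc[of 0 t] dec[of 0 t] that E0 by (cases t "0::real" rule: linorder_cases) auto
  have two: "\<exists>p q. p \<noteq> q \<and> {x\<in>U. F (\<epsilon>, x) = 0} = {p, q} \<and> ?d (\<epsilon>, p) > 0 \<and> ?d (\<epsilon>, q) < 0"
    if \<epsilon>: "\<epsilon> \<in> W" "\<sigma> * \<epsilon> > 0" for \<epsilon>
  proof -
    have abs: "\<sigma> * \<epsilon> = \<bar>\<epsilon>\<bar>" using \<epsilon>(2) \<sigma> by auto
    have "\<sigma> * \<epsilon> \<le> E a" "\<sigma> * \<epsilon> \<le> E (- a)" using \<epsilon>(1) unfolding abs by (auto simp: W_def)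
    moreover have "continuous_on {0..a} E" "continuous_on {-a..0} E" using a by (auto intro!: cE)
    ultimately obtain t1 t2 where t: "0 \<le> t1" "t1 \<le> a" "E t1 = \<sigma> * \<epsilon>" "- a \<le> t2" "t2 \<le> 0" "E t2 = \<sigma> * \<epsilon>"
      using IVT'[of E 0 "\<sigma> * \<epsilon>" a] IVT2'[of E 0 "\<sigma> * \<epsilon>" "- a"] \<epsilon>(2) a E0 by auto
    have t0: "t1 > 0" "t2 < 0" using t \<epsilon>(2) E0 by (auto simp: less_le)
    have fst_eq: "fst (\<gamma> s) = \<epsilon>" if "E s = \<sigma> * \<epsilon>" for s using that \<sigma> by (auto simp: E_def)
    define x1 x2 where "x1 = snd (\<gamma> t1)" and "x2 = snd (\<gamma> t2)"
    have \<gamma>12: "\<gamma> t1 = (\<epsilon>, x1)" "\<gamma> t2 = (\<epsilon>, x2)"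
      using fst_eq t by (auto simp: x1_def x2_def prod_eq_iff)
    have in_U: "x1 \<in> U" "x2 \<in> U" using \<delta>(2)[of t1] \<delta>(2)[of t2] t a \<gamma>12 by auto
    have Fx: "F (\<epsilon>, x1) = 0" "F (\<epsilon>, x2) = 0" "v \<bullet> x1 = t1" "v \<bullet> x2 = t2"
      using \<gamma>[of t1] \<gamma>[of t2] t a \<gamma>12 by auto
    have "x1 \<noteq> x2" using Fx t0 by auto
    have "{x\<in>U. F (\<epsilon>, x) = 0} = {x1, x2}"
    proof (intro equalityI subsetI)
      fix x assume "x \<in> {x\<in>U. F (\<epsilon>, x) = 0}"
      then obtain s where s: "\<bar>s\<bar> < \<tau>" "\<gamma> s = (\<epsilon>, x)" using zero[OF \<epsilon>(1)] by blast
      then have Es: "E s = \<sigma> * \<epsilon>" by (simp add: E_def)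
      have "s = t1 \<or> s = t2"
      proof (cases "s \<ge> 0")
        case True
        then have "s = t1" using inc[of s t1] inc[of t1 s] t s a Es by (cases s t1 rule: linorder_cases) auto
        then show ?thesis ..
      next
        case False
        then have "s = t2" using dec[of s t2] dec[of t2 s] t s a Es by (cases s t2 rule: linorder_cases) auto
        then show ?thesis ..
      qed
      then show "x \<in> {x1, x2}" using s(2) \<gamma>12 by auto
    qed (use in_U Fx in auto)
    moreover have "?d (\<epsilon>, x1) * \<kappa> > 0" "?d (\<epsilon>, x2) * \<kappa> < 0"
      using d_sign[of t1] d_sign[of t2] t t0 a \<gamma>12 by (auto simp: zero_less_mult_iff)
    ultimately show ?thesis
      using \<open>x1 \<noteq> x2\<close> \<kappa>
      by (cases "\<kappa> > 0")
        ((rule exI[of _ x1], rule exI[of _ x2], force simp: zero_less_mult_iff mult_less_0_iff),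
         (rule exI[of _ x2], rule exI[of _ x1], force simp: zero_less_mult_iff mult_less_0_iff))
  qed
  have none: "{x\<in>U. F (\<epsilon>, x) = 0} = {}" if "\<epsilon> \<in> W" "\<sigma> * \<epsilon> < 0" for \<epsilon>
  proof -
    have False if "x \<in> U" "F (\<epsilon>, x) = 0" for x
      using zero[OF \<open>\<epsilon> \<in> W\<close> that] E_pos \<open>\<sigma> * \<epsilon> < 0\<close> by (force simp: E_def)
    then show ?thesis by blast
  qed
  have "W \<times> U \<subseteq> \<Omega>" using WU(4) N(3) by (auto simp: W_def U_def)
  moreover have "\<sigma> \<in> {1, -1}" using \<sigma> by auto
  ultimately show thesis by (intro that[OF _ U W _ none two])
qed

section \<open>Unfoldings in normalised coordinates\<close>

lemma smooth_on_slice: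
  fixes f :: "real \<times> (real^3) \<Rightarrow> 'c::real_normed_vector"
  assumes "open A" "open B" "smooth_on (A \<times> B) f" "\<epsilon> \<in> A"
  shows "smooth_on B (\<lambda>x. f (\<epsilon>, x))"
    and "x \<in> B \<Longrightarrow> dir_deriv v (\<lambda>x. f (\<epsilon>, x)) x = dir_deriv (0, v) f (\<epsilon>, x)"
proof -
  have "bounded_linear (\<lambda>x. x :: real^3)" by (rule bounded_linear_ident)
  then have sm: "smooth_on B (\<lambda>x. (\<epsilon>, x))"
    by (intro smooth_on_Pair assms smooth_on_const smooth_on_linear)
  have d: "dir_deriv v (\<lambda>x. (\<epsilon>, x)) x = (0, v)" for x v :: "real^3"
    by (rule dir_deriv_eq) (auto intro!: derivative_eq_intros)
  note c = smooth_on_compose[OF assms(2) open_Times[OF assms(1,2)] sm assms(3)]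
  show "smooth_on B (\<lambda>x. f (\<epsilon>, x))"
    by (rule c(1)) (use assms in auto)
  show "dir_deriv v (\<lambda>x. f (\<epsilon>, x)) x = dir_deriv (0, v) f (\<epsilon>, x)" if "x \<in> B"
    using c(2)[of x v] that assms by (simp add: d image_subset_iff)
qed

lemma dir_deriv_cong_open:
  assumes "open S" "x \<in> S" "\<And>y. y \<in> S \<Longrightarrow> f y = g y" "smooth_on S f"
  shows "dir_deriv v f x = dir_deriv v g x"
  using has_derivative_transform_within_open[OF smooth_on_has_derivative[OF assms(4,2)] assms(1,2,3)]
  by (simp add: dir_deriv_eq)

lemma det_derivative_corank_1:
  fixes A :: "real \<Rightarrow> real^3^3"
  assumes d: "\<And>i j. ((\<lambda>t. A t $ i $ j) has_real_derivative A' $ i $ j) (at 0)"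
    and A0: "\<And>i j. A 0 $ i $ j = (if i = j then if i = 1 then \<alpha> else if i = 3 then \<beta> else 0 else 0)"
  shows "((\<lambda>t. det (A t)) has_real_derivative \<alpha> * \<beta> * A' $ 2 $ 2) (at 0)"
  unfolding det_3 by (auto intro!: derivative_eq_intros d simp: A0)

text \<open>
  A linear map \<open>J\<close> acts on bivectors, regarded as vectors, by its cofactor matrix, and \<open>J\<^sup>T\<close> times the cofactor matrix is
  \<open>det J\<close>.
\<close>

lemma adjugate_bivector_of:
  fixes J :: "real^3^3"
  assumes "B = J ** bivector_of p ** transpose J"
  shows "(B $ 2 $ 3) *\<^sub>R J $ 1 + (B $ 3 $ 1) *\<^sub>R J $ 2 + (B $ 1 $ 2) *\<^sub>R J $ 3 = det J *\<^sub>R p"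
  unfolding assms conjugate_bivector_of
  by (simp add: vec_eq_iff forall_3 cross3_def inner_vec_def sum_3 det_3 algebra_simps)

lemma jacobian_eq_space_jacobian:
  assumes "\<And>v. dir_deriv v f x = dir_deriv (0, v) g z"
  shows "jacobian f x = space_jacobian g z"
proof -
  have "frechet_derivative f (at x) = (\<lambda>v. dir_deriv (0, v) g z)"
    using assms by (simp add: dir_deriv_def fun_eq_iff)
  then show ?thesis by (simp add: jacobian_def space_jacobian_def)
qed

text \<open>
  The data of a generic unfolding in its final coordinates \<open>\<Psi>\<close>. The initial coordinates \<open>\<theta>\<close>
  are those that single out the base points \<open>p\<close>.
\<close>

locale normalised_unfolding =
  fixes s :: int and P :: "real \<Rightarrow> real^3 \<Rightarrow> real^3^3" and h :: "real \<Rightarrow> real"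
    and W :: "real set" and N M :: "(real^3) set" and \<theta> \<Psi> :: "real \<Rightarrow> real^3 \<Rightarrow> real^3"
    and p :: "real \<Rightarrow> real^3" and H :: "real \<Rightarrow> real^3 \<Rightarrow> real" and R :: "real \<Rightarrow> real^3 \<Rightarrow> real^3^3"
  assumes s: "s = 1 \<or> s = -1"
    and \<theta>: "coordinate_family W N \<theta>" and p: "\<And>\<epsilon>. \<epsilon> \<in> W \<Longrightarrow> p \<epsilon> \<in> N \<and> \<theta> \<epsilon> (p \<epsilon>) = 0"
    and \<Psi>: "coordinate_family W N \<Psi>" and M: "open M" "\<And>\<epsilon>. \<epsilon> \<in> W \<Longrightarrow> \<Psi> \<epsilon> ` N \<subseteq> M"
    and H: "smooth_on (W \<times> M) (\<lambda>(\<epsilon>, y). H \<epsilon> y)" "H 0 0 > 0"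
    and h: "smooth_on W h" "h 0 = 0" "deriv h 0 \<noteq> 0"
    and R: "smooth_on (W \<times> M) (\<lambda>(\<epsilon>, y). R \<epsilon> y)" "\<And>\<epsilon>. \<epsilon> \<in> W \<Longrightarrow> flat_at (R \<epsilon>) (\<Psi> \<epsilon> (p \<epsilon>))"
    and coords: "\<And>\<epsilon>. \<epsilon> \<in> W \<Longrightarrow> in_coordinates N (\<Psi> \<epsilon>) (P \<epsilon>)
           (\<lambda>y. H \<epsilon> y *\<^sub>R bivector (y $ 3) (of_int s * y $ 1) ((y $ 2)\<^sup>2 + h \<epsilon>) + R \<epsilon> y)"
    and poisson: "\<And>\<epsilon>. \<epsilon> \<in> W \<Longrightarrow> poisson_structure (P \<epsilon>)"
begin

definition "\<psi> = (\<lambda>(\<epsilon>, x). \<Psi> \<epsilon> x)"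
definition "H' = (\<lambda>(\<epsilon>, y). H \<epsilon> y)"
definition "R' = (\<lambda>(\<epsilon>, y). R \<epsilon> y)"
definition "\<sigma> = (of_int s :: real)"

lemma WNM: "open W" "0 \<in> W" "open N" "0 \<in> N" "open (W \<times> N)" "open (W \<times> M)" "(0, 0) \<in> W \<times> N"
  and \<psi>: "smooth_on (W \<times> N) \<psi>" "\<psi> (0, 0) = 0"
  and M0: "0 \<in> M" "(0, 0) \<in> W \<times> M"
proof -
  show *: "open W" "0 \<in> W" "open N" "0 \<in> N" "smooth_on (W \<times> N) \<psi>" "\<psi> (0, 0) = 0"
    using \<Psi> by (auto simp: coordinate_family_def \<psi>_def)
  then show "open (W \<times> N)" "open (W \<times> M)" "(0, 0) \<in> W \<times> N"
    using M by (auto intro: open_Times)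
  show "0 \<in> M" using M(2)[OF *(2)] *(4,6) by (auto simp: \<psi>_def)
  then show "(0, 0) \<in> W \<times> M" using * by auto
qed

lemma smooth_H': "smooth_on (W \<times> M) H'" and smooth_R': "smooth_on (W \<times> M) R'"
  using H(1) R(1) by (auto simp: H'_def R'_def)

lemma smooth_R'_nth: "smooth_on (W \<times> M) (\<lambda>z. R' z $ i $ j)"
  by (intro smooth_on_nth WNM smooth_R')

lemma jacobian_\<Psi>:
  assumes "\<epsilon> \<in> W" "x \<in> N"
  shows "jacobian (\<Psi> \<epsilon>) x = space_jacobian \<psi> (\<epsilon>, x)"
proof -
  have "dir_deriv v (\<Psi> \<epsilon>) x = dir_deriv (0, v) \<psi> (\<epsilon>, x)" for v
    using smooth_on_slice(2)[OF WNM(1,3) \<psi>(1) assms, of v] by (simp add: \<psi>_def)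
  then show ?thesis by (rule jacobian_eq_space_jacobian)
qed

lemma det_jacobian_\<psi>: "z \<in> W \<times> N \<Longrightarrow> det (space_jacobian \<psi> z) \<noteq> 0"
  using \<Psi> jacobian_\<Psi> by (cases z) (auto simp: coordinate_family_def local_coordinates_def invertible_det_nz)

text \<open>
  The change of coordinates, fibred over the parameter.
\<close>

definition "K z = (fst z, \<psi> z)"

lemma K: "smooth_on (W \<times> N) K" "K ` (W \<times> N) \<subseteq> W \<times> M" "K (0, 0) = (0, 0)"
  "z \<in> W \<times> N \<Longrightarrow> dir_deriv (e, x) K z = (e, dir_deriv (e, x) \<psi> z)"
proof -
  show "smooth_on (W \<times> N) K"
    unfolding K_def by (intro smooth_on_Pair WNM \<psi> smooth_on_linear bounded_linear_fst)
  show "K ` (W \<times> N) \<subseteq> W \<times> M" "K (0, 0) = (0, 0)"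
    using M(2) \<psi>(2) by (auto simp: K_def \<psi>_def)
  show "dir_deriv (e, x) K z = (e, dir_deriv (e, x) \<psi> z)" if "z \<in> W \<times> N"
  proof -
    have "(K has_derivative (\<lambda>w. (fst w, dir_deriv w \<psi> z))) (at z)"
      unfolding K_def
      by (intro has_derivative_Pair bounded_linear_imp_has_derivative bounded_linear_fst
          smooth_on_has_derivative[OF \<psi>(1) that])
    from dir_deriv_eq[OF this, of "(e, x)"] show ?thesis by simp
  qed
qed

text \<open>
  The base points solve \<open>\<theta> \<epsilon> x = 0\<close>; by injectivity they coincide with the solution that the implicit function theorem
  provides.
\<close>

lemma p_differentiable: "\<exists>D. (p has_derivative D) (at 0)" and p0: "p 0 = 0"
proof -
  define f where "f = (\<lambda>(\<epsilon>, x). \<theta> \<epsilon> x)"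
  have f: "smooth_on (W \<times> N) f" "f (0, 0) = 0"
    using \<theta> by (auto simp: coordinate_family_def f_def)
  have inj: "inj_on (\<theta> \<epsilon>) N" if "\<epsilon> \<in> W" for \<epsilon>
    using \<theta> that by (auto simp: coordinate_family_def local_coordinates_def)
  show "p 0 = 0"
    using inj_onD[OF inj[OF WNM(2)], of "p 0" 0] p[OF WNM(2)] f(2) WNM(4) by (simp add: f_def)
  have "jacobian (\<theta> 0) 0 = space_jacobian f (0, 0)"
  proof -
    have "dir_deriv v (\<theta> 0) 0 = dir_deriv (0, v) f (0, 0)" for v
      using smooth_on_slice(2)[OF WNM(1,3) f(1) WNM(2,4), of v] by (simp add: f_def)
    then show ?thesis by (rule jacobian_eq_space_jacobian)
  qed
  moreover have "invertible (jacobian (\<theta> 0) 0)"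
    using \<theta> by (auto simp: coordinate_family_def local_coordinates_def)
  ultimately have "det (space_jacobian f (0, 0)) \<noteq> 0"
    by (simp add: invertible_det_nz)
  from smooth_implicit_curve[OF WNM(5,7) f this] obtain \<gamma> \<delta> D where \<gamma>: "\<delta> > 0"
    "\<And>\<epsilon>. \<bar>\<epsilon>\<bar> < \<delta> \<Longrightarrow> (\<epsilon>, \<gamma> \<epsilon>) \<in> W \<times> N \<and> f (\<epsilon>, \<gamma> \<epsilon>) = 0" "(\<gamma> has_derivative D) (at 0)"
    by metis
  have "\<gamma> \<epsilon> = p \<epsilon>" if "\<epsilon> \<in> ball 0 \<delta>" for \<epsilon>
  proof -
    have *: "\<epsilon> \<in> W" "\<gamma> \<epsilon> \<in> N" "\<theta> \<epsilon> (\<gamma> \<epsilon>) = 0"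
      using \<gamma>(2)[of \<epsilon>] that by (auto simp: f_def)
    then show ?thesis using inj_onD[OF inj[OF *(1)], of "\<gamma> \<epsilon>" "p \<epsilon>"] p[OF *(1)] by simp
  qed
  then have "(p has_derivative D) (at 0)"
    using has_derivative_transform_within_open[OF \<gamma>(3), of "ball 0 \<delta>" p] \<gamma>(1) by simp
  then show "\<exists>D. (p has_derivative D) (at 0)" by blast
qed

lemma flat_0: "flat_at (R 0) 0"
  using R(2)[OF WNM(2)] p0 \<psi>(2) by (simp add: \<psi>_def)

lemma R'_0: "R' (0, 0) = 0"
  using flat_0[unfolded flat_at_def, rule_format, of "[]"] by (simp add: R'_def)

lemma R'_space_deriv: "dir_deriv (0, v) R' (0, 0) = 0"
proof -
  have "dir_deriv v (R 0) 0 = 0"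
    using flat_0[unfolded flat_at_def, rule_format, of "[v]"] by simp
  then show ?thesis
    using smooth_on_slice(2)[OF WNM(1) M(1) smooth_R' WNM(2) M0(1), of v] by (simp add: R'_def)
qed

lemma R'_space_deriv2: "dir_deriv (0, w) (dir_deriv (0, v) R') (0, 0) = 0"
proof -
  have eq: "dir_deriv v (R 0) y = dir_deriv (0, v) R' (0, y)" if "y \<in> M" for y
    using smooth_on_slice(2)[OF WNM(1) M(1) smooth_R' WNM(2) that, of v] by (simp add: R'_def)
  have "dir_deriv w (dir_deriv v (R 0)) 0 = 0"
    using flat_0[unfolded flat_at_def, rule_format, of "[v, w]"] by simp
  moreover have sm: "smooth_on M (dir_deriv v (R 0))"
    using smooth_on_slice(1)[OF WNM(1) M(1) smooth_R' WNM(2)] by (auto simp: R'_def intro: smooth_on_dir_deriv)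
  moreover have "dir_deriv w (dir_deriv v (R 0)) 0 = dir_deriv w (\<lambda>y. dir_deriv (0, v) R' (0, y)) 0"
    by (rule dir_deriv_cong_open[OF M(1) M0(1) eq sm])
  ultimately show ?thesis
    using smooth_on_slice(2)[OF WNM(1) M(1) smooth_on_dir_deriv[OF smooth_R'] WNM(2) M0(1), of w "(0, v)"]
    by simp
qed

text \<open>
  The space derivatives vanish by flatness at \<open>\<epsilon> = 0\<close>. For the parameter derivative, differentiate \<open>R = 0\<close> along the curve
  of base points.
\<close>

lemma R'_deriv: "dir_deriv z R' (0, 0) = 0"
proof -
  obtain D where D: "(p has_derivative D) (at 0)"
    using p_differentiable by blast
  have "((\<lambda>\<epsilon>. (\<epsilon>, p \<epsilon>)) has_derivative (\<lambda>e. (e, D e))) (at 0)"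
    by (intro has_derivative_Pair D has_derivative_ident)
  from has_derivative_compose[OF this, of K "\<lambda>w. dir_deriv w K (0, 0)"]
  have "((\<lambda>\<epsilon>. K (\<epsilon>, p \<epsilon>)) has_derivative (\<lambda>e. dir_deriv (e, D e) K (0, 0))) (at 0)"
    using smooth_on_has_derivative[OF K(1) WNM(7)] by (simp add: p0)
  from has_derivative_compose[OF this, of R' "\<lambda>w. dir_deriv w R' (0, 0)"]
  have "((\<lambda>\<epsilon>. R' (K (\<epsilon>, p \<epsilon>))) has_derivative (\<lambda>e. dir_deriv (dir_deriv (e, D e) K (0, 0)) R' (0, 0))) (at 0)"
    using smooth_on_has_derivative[OF smooth_R' M0(2)] by (simp add: p0 K(3))
  moreover have "((\<lambda>\<epsilon>. R' (K (\<epsilon>, p \<epsilon>))) has_derivative (\<lambda>e. 0)) (at 0)"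
  proof (rule has_derivative_transform_within_open[OF has_derivative_const WNM(1,2)])
    fix \<epsilon> assume "\<epsilon> \<in> W"
    then show "0 = R' (K (\<epsilon>, p \<epsilon>))"
      using R(2)[of \<epsilon>, unfolded flat_at_def, rule_format, of "[]"] by (simp add: R'_def K_def \<psi>_def)
  qed
  ultimately have "dir_deriv (dir_deriv (1, D 1) K (0, 0)) R' (0, 0) = 0"
    using has_derivative_unique by (metis (no_types, lifting))
  then have 1: "dir_deriv (1, dir_deriv (1, D 1) \<psi> (0, 0)) R' (0, 0) = 0"
    by (simp add: K(4)[OF WNM(7)])
  note lin = dir_deriv_linear[OF smooth_R' M0(2)]
  have split: "dir_deriv (e, y) R' (0, 0) = e *\<^sub>R dir_deriv (1, 0) R' (0, 0)" for e y
  proof -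
    have "dir_deriv (e *\<^sub>R (1, 0) + (0, y)) R' (0, 0) = e *\<^sub>R dir_deriv (1, 0) R' (0, 0) + dir_deriv (0, y) R' (0, 0)"
      by (simp only: linear_add[OF lin] linear_scale[OF lin])
    then show ?thesis by (simp add: R'_space_deriv)
  qed
  have "dir_deriv (1, 0) R' (0, 0) = 0"
    using 1 split[of 1 "dir_deriv (1, D 1) \<psi> (0, 0)"] by simp
  then show ?thesis
    using split[of "fst z" "snd z"] by simp
qed

lemma R'_deriv_nth: "dir_deriv w (\<lambda>z. R' z $ i $ j) z = dir_deriv w R' z $ i $ j" if "z \<in> W \<times> M"
proof -
  have "bounded_linear (\<lambda>M :: real^3^3. M $ i $ j)"
    by (intro bounded_linear_compose[OF bounded_linear_vec_nth bounded_linear_vec_nth])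
  from smooth_on_bounded_linear_comp(2)[OF WNM(6) this smooth_R' that] show ?thesis .
qed

text \<open>
  The components \<open>{y,z}, {z,x}, {x,y}\<close> in the final coordinates.
\<close>

definition "B z = (vector [H' z * (\<sigma> * snd z $ 1) + R' z $ 2 $ 3,
    H' z * ((snd z $ 2)\<^sup>2 + h (fst z)) + R' z $ 3 $ 1, H' z * snd z $ 3 + R' z $ 1 $ 2] :: real^3)"

lemma B_nth: "B z $ 1 = H' z * (\<sigma> * snd z $ 1) + R' z $ 2 $ 3"
  "B z $ 2 = H' z * ((snd z $ 2)\<^sup>2 + h (fst z)) + R' z $ 3 $ 1" "B z $ 3 = H' z * snd z $ 3 + R' z $ 1 $ 2"
  by (simp_all add: B_def)

lemma snd_nth_linear: "bounded_linear (\<lambda>z :: real \<times> (real^3). snd z $ i)"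
  by (intro bounded_linear_compose[OF bounded_linear_vec_nth bounded_linear_snd])

lemma smooth_h: "smooth_on (W \<times> M) (\<lambda>z. h (fst z))"
  by (rule smooth_on_compose(1)[OF WNM(6,1) smooth_on_linear[OF bounded_linear_fst] h(1)]) auto

lemma smooth_B: "smooth_on (W \<times> M) B"
proof (rule smooth_on_vec_lambda[OF WNM(6)])
  note nth = smooth_on_linear[OF snd_nth_linear]
  have "smooth_on (W \<times> M) (\<lambda>z. H' z * (\<sigma> * snd z $ 1) + R' z $ 2 $ 3)"
    "smooth_on (W \<times> M) (\<lambda>z. H' z * (snd z $ 2 * snd z $ 2 + h (fst z)) + R' z $ 3 $ 1)"
    "smooth_on (W \<times> M) (\<lambda>z. H' z * snd z $ 3 + R' z $ 1 $ 2)"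
    by (intro smooth_on_add smooth_on_mult WNM smooth_H' smooth_R'_nth smooth_h nth smooth_on_const)+
  then show "smooth_on (W \<times> M) (\<lambda>z. B z $ i)" for i
    using exhaust_3[of i] by (auto simp: B_nth power2_eq_square)
qed

lemma dir_deriv_B:
  assumes z: "z \<in> W \<times> M"
  shows "dir_deriv w B z $ 1 = dir_deriv w H' z * (\<sigma> * snd z $ 1) + H' z * (\<sigma> * snd w $ 1) + dir_deriv w R' z $ 2 $ 3"
    and "dir_deriv w B z $ 2 = dir_deriv w H' z * ((snd z $ 2)\<^sup>2 + h (fst z))
      + H' z * (2 * snd z $ 2 * snd w $ 2 + dir_deriv (fst w) h (fst z)) + dir_deriv w R' z $ 3 $ 1"
    and "dir_deriv w B z $ 3 = dir_deriv w H' z * snd z $ 3 + H' z * snd w $ 3 + dir_deriv w R' z $ 1 $ 2"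
proof -
  have nth: "dir_deriv w B z $ i = dir_deriv w (\<lambda>z. B z $ i) z" for i
    using smooth_on_bounded_linear_comp(2)[OF WNM(6) bounded_linear_vec_nth smooth_B z] by simp
  note dH = smooth_on_has_derivative[OF smooth_H' z]
  have dR: "((\<lambda>z. R' z $ i $ j) has_derivative (\<lambda>w. dir_deriv w R' z $ i $ j)) (at z)" for i j
    using smooth_on_has_derivative[OF smooth_R'_nth z] by (simp add: R'_deriv_nth[OF z])
  have dsnd: "((\<lambda>z. snd z $ i) has_derivative (\<lambda>w. snd w $ i)) (at z)" for i
    by (rule bounded_linear_imp_has_derivative[OF snd_nth_linear])
  have dh: "((\<lambda>z. h (fst z)) has_derivative (\<lambda>w. dir_deriv (fst w) h (fst z))) (at z)"
    using has_derivative_compose[OF bounded_linear_imp_has_derivative[OF bounded_linear_fst] smooth_on_has_derivative[OF h(1)], of z]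
      z by auto
  show "dir_deriv w B z $ 1 = dir_deriv w H' z * (\<sigma> * snd z $ 1) + H' z * (\<sigma> * snd w $ 1) + dir_deriv w R' z $ 2 $ 3"
    unfolding nth B_nth by (rule dir_deriv_eq) (auto intro!: derivative_eq_intros dH dR dsnd)
  show "dir_deriv w B z $ 2 = dir_deriv w H' z * ((snd z $ 2)\<^sup>2 + h (fst z))
      + H' z * (2 * snd z $ 2 * snd w $ 2 + dir_deriv (fst w) h (fst z)) + dir_deriv w R' z $ 3 $ 1"
    unfolding nth B_nth power2_eq_square
    by (rule dir_deriv_eq) (auto intro!: derivative_eq_intros dH dR dsnd dh simp: algebra_simps)
  show "dir_deriv w B z $ 3 = dir_deriv w H' z * snd z $ 3 + H' z * snd w $ 3 + dir_deriv w R' z $ 1 $ 2"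
    unfolding nth B_nth by (rule dir_deriv_eq) (auto intro!: derivative_eq_intros dH dR dsnd)
qed

lemma dir_deriv_B_0:
  "dir_deriv (e, y) B (0, 0) = vector [H 0 0 * (\<sigma> * y $ 1), H 0 0 * (e * deriv h 0), H 0 0 * y $ 3]"
proof -
  have dh: "(h has_derivative (\<lambda>e. dir_deriv e h 0)) (at 0)"
    by (rule smooth_on_has_derivative[OF h(1) WNM(2)])
  have e: "dir_deriv e h 0 = e * dir_deriv 1 h 0" for e
    using linear_scale[OF has_derivative_linear[OF dh], of e 1] by simp
  have "(h has_real_derivative dir_deriv 1 h 0) (at 0)"
    unfolding has_field_derivative_def
    by (rule has_derivative_eq_rhs[OF dh]) (simp add: fun_eq_iff e[symmetric] mult.commute[of "dir_deriv 1 h 0"])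
  then have "deriv h 0 = dir_deriv 1 h 0" by (rule DERIV_imp_deriv)
  with e[of e] show ?thesis
    by (simp add: vec_eq_iff forall_3 dir_deriv_B[OF M0(2)] R'_deriv h(2) H'_def)
qed

lemma space_jacobian_nth: "space_jacobian f z $ i $ j = dir_deriv (0, axis j 1) f z $ i"
  by (simp add: space_jacobian_def matrix_def)

lemma space_jacobian_B_0:
  "space_jacobian B (0, 0) $ i $ j = (if i = j then if i = 1 then H 0 0 * \<sigma> else if i = 3 then H 0 0 else 0 else 0)"
  using exhaust_3[of i] exhaust_3[of j]
  unfolding space_jacobian_nth dir_deriv_B_0
  by (elim disjE) (simp_all add: axis_def)

text \<open>
  At the origin the Jacobian matrix is \<open>H diag(\<sigma>, 0, 1)\<close>, so the derivative of its determinant only involves the derivative of the middle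
  entry; this entry is \<open>2 t H\<close> up to terms of second order, as the second derivatives of the remainder vanish.
\<close>

lemma det_space_jacobian_B:
  "((\<lambda>t. det (space_jacobian B (0, t *\<^sub>R axis 2 1))) has_real_derivative (H 0 0 * \<sigma>) * H 0 0 * (2 * H 0 0)) (at 0)"
proof -
  let ?l = "\<lambda>t. (0 :: real, t *\<^sub>R axis 2 (1::real) :: real^3)"
  have dl: "(?l has_derivative (\<lambda>t. ?l t)) (at 0)"
    by (auto intro!: derivative_eq_intros)
  have along: "((\<lambda>t. f (?l t)) has_real_derivative dir_deriv (0, axis 2 1) f (0, 0)) (at 0)"
    if "smooth_on (W \<times> M) f" for f :: "_ \<Rightarrow> real"
  proof -
    have "(f has_derivative (\<lambda>w. dir_deriv w f (0, 0))) (at (?l 0))"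
      using smooth_on_has_derivative[OF that M0(2)] by simp
    from has_derivative_compose[OF dl this]
    have "((\<lambda>t. f (?l t)) has_derivative (\<lambda>t. dir_deriv (?l t) f (0, 0))) (at 0)" .
    moreover have "dir_deriv (?l t) f (0, 0) = dir_deriv (0, axis 2 1) f (0, 0) * t" for t
      using linear_scale[OF dir_deriv_linear[OF that M0(2)], of t "(0, axis 2 1)"] by (simp add: mult.commute)
    ultimately show ?thesis by (simp add: has_field_derivative_def)
  qed
  define A' :: "real^3^3" where "A' = (\<chi> i j. dir_deriv (0, axis 2 1) (\<lambda>z. space_jacobian B z $ i $ j) (0, 0))"
  have d: "((\<lambda>t. space_jacobian B (?l t) $ i $ j) has_real_derivative A' $ i $ j) (at 0)" for i j
    unfolding A'_def using along[OF smooth_on_space_jacobian[OF WNM(6) smooth_B, of i j]] by simp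
  have "A' $ 2 $ 2 = 2 * H 0 0"
  proof -
    let ?w = "(0 :: real, axis 2 (1::real) :: real^3)"
    have R2: "((\<lambda>t. dir_deriv ?w R' (?l t) $ 3 $ 1) has_real_derivative 0) (at 0)"
    proof -
      have "bounded_linear (\<lambda>M :: real^3^3. M $ 3 $ 1)"
        by (intro bounded_linear_compose[OF bounded_linear_vec_nth bounded_linear_vec_nth])
      from smooth_on_bounded_linear_comp[OF WNM(6) this smooth_on_dir_deriv[OF smooth_R', of ?w]]
      show ?thesis
        using along[of "\<lambda>z. dir_deriv ?w R' z $ 3 $ 1"] M0(2) by (simp add: R'_space_deriv2)
    qed
    note dH = along[OF smooth_H'] and dH2 = along[OF smooth_on_dir_deriv[OF smooth_H', of ?w]]
    have lin0: "dir_deriv 0 h 0 = 0"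
      by (rule linear_0[OF has_derivative_linear[OF smooth_on_has_derivative[OF h(1) WNM(2)]]])
    have "((\<lambda>t. dir_deriv ?w H' (?l t) * t\<^sup>2 + H' (?l t) * (2 * t) + dir_deriv ?w R' (?l t) $ 3 $ 1)
        has_real_derivative 2 * H 0 0) (at 0)"
      by (rule derivative_eq_intros dH dH2 R2 refl | simp add: H'_def)+
    moreover have "eventually (\<lambda>t. ?l t \<in> W \<times> M) (nhds 0)"
    proof -
      have "isCont ?l 0" by (intro continuous_intros)
      then have "filterlim ?l (nhds (?l 0)) (nhds 0)" by (simp add: isCont_def tendsto_nhds_iff)
      then show ?thesis using WNM(6) M0(2) by (intro topological_tendstoD) auto
    qed
    then have "eventually (\<lambda>t. space_jacobian B (?l t) $ 2 $ 2 =
        dir_deriv ?w H' (?l t) * t\<^sup>2 + H' (?l t) * (2 * t) + dir_deriv ?w R' (?l t) $ 3 $ 1) (nhds 0)"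
      by eventually_elim (simp add: space_jacobian_nth dir_deriv_B h(2) lin0)
    ultimately have "((\<lambda>t. space_jacobian B (?l t) $ 2 $ 2) has_real_derivative 2 * H 0 0) (at 0)"
      by (subst DERIV_cong_ev[OF refl _ refl])
    with d[of 2 2] show ?thesis by (rule DERIV_unique)
  qed
  with det_derivative_corank_1[OF d, of "H 0 0 * \<sigma>" "H 0 0"] show ?thesis
    by (simp add: space_jacobian_B_0)
qed

end

section \<open>The bifurcation\<close>

definition bivector_vec :: "real^3^3 \<Rightarrow> real^3" where
  "bivector_vec A = vector [A $ 2 $ 3, A $ 3 $ 1, A $ 1 $ 2]"

lemma bivector_vec_nth [simp]:
  "bivector_vec A $ 1 = A $ 2 $ 3" "bivector_vec A $ 2 = A $ 3 $ 1" "bivector_vec A $ 3 = A $ 1 $ 2"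
  by (simp_all add: bivector_vec_def)

lemma bivector_of_vec: "transpose A = - A \<Longrightarrow> bivector_of (bivector_vec A) = A"
  using skew_matrix_eq[of A] by (simp add: bivector_of_def)

lemma bounded_linear_bivector_vec: "bounded_linear bivector_vec"
  unfolding linear_conv_bounded_linear[symmetric]
  by (rule linearI) (simp_all add: vec_eq_iff forall_3)

lemma bounded_linear_bivector_of: "bounded_linear bivector_of"
  unfolding linear_conv_bounded_linear[symmetric]
  by (rule linearI) (simp_all add: vec_eq_iff forall_3)

lemma bivector_of_0 [simp]: "bivector_of 0 = 0" and bivector_vec_0 [simp]: "bivector_vec 0 = 0"
  by (simp_all add: vec_eq_iff forall_3)

lemma smooth_line_derivative_0:
  fixes f :: "real \<times> (real^3) \<Rightarrow> real"
  assumes "smooth_on S f" "(0, 0) \<in> S"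
  shows "((\<lambda>t. f (0, t *\<^sub>R v)) has_real_derivative dir_deriv (0, v) f (0, 0)) (at 0)"
proof -
  have "((\<lambda>t. (0 :: real, t *\<^sub>R v)) has_derivative (\<lambda>t. (0, t *\<^sub>R v))) (at 0)"
    by (auto intro!: derivative_eq_intros)
  moreover have "(f has_derivative (\<lambda>w. dir_deriv w f (0, 0))) (at (0, 0 *\<^sub>R v))"
    using smooth_on_has_derivative[OF assms] by simp
  ultimately have "((\<lambda>t. f (0, t *\<^sub>R v)) has_derivative (\<lambda>t. dir_deriv (0, t *\<^sub>R v) f (0, 0))) (at 0)"
    by (rule has_derivative_compose)
  moreover have "dir_deriv (0, t *\<^sub>R v) f (0, 0) = dir_deriv (0, v) f (0, 0) * t" for t
    using linear_scale[OF dir_deriv_linear[OF assms], of t "(0, v)"] by (simp add: mult.commute)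
  ultimately show ?thesis by (simp add: has_field_derivative_def)
qed

lemma det_scaleR_3: "det (c *\<^sub>R A :: real^3^3) = c ^ 3 * det A"
  by (simp add: det_3 power3_eq_cube algebra_simps)

context normalised_unfolding
begin

text \<open>
  The components of the bivector field in the final coordinates, as functions of the original variables.
\<close>

definition "F z = B (K z)"

abbreviation "J\<psi> \<equiv> space_jacobian \<psi>"
abbreviation "JF \<equiv> space_jacobian F"

lemma smooth_F: "smooth_on (W \<times> N) F"
  and dir_deriv_F: "z \<in> W \<times> N \<Longrightarrow> dir_deriv (e, x) F z = dir_deriv (e, dir_deriv (e, x) \<psi> z) B (K z)"
proof -
  note c = smooth_on_compose[OF WNM(5,6) K(1) smooth_B K(2), folded F_def]
  show "smooth_on (W \<times> N) F" using c(1) by (simp add: F_def[abs_def])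
  show "dir_deriv (e, x) F z = dir_deriv (e, dir_deriv (e, x) \<psi> z) B (K z)" if "z \<in> W \<times> N"
    using c(2)[OF that, of "(e, x)"] K(4)[OF that] by (simp add: F_def[abs_def])
qed

lemma jacobian_F:
  assumes z: "z \<in> W \<times> N"
  shows "JF z = space_jacobian B (K z) ** J\<psi> z"
proof -
  have "K z \<in> W \<times> M" using K(2) z by blast
  then have "JF z *v x = (space_jacobian B (K z) ** J\<psi> z) *v x" for x
    by (simp add: space_jacobian_vector[OF smooth_F z] dir_deriv_F[OF z] space_jacobian_vector[OF smooth_B]
        space_jacobian_vector[OF \<psi>(1) z] flip: matrix_vector_mul_assoc)
  then show ?thesis by (simp add: matrix_eq)
qed

lemma skew: "\<epsilon> \<in> W \<Longrightarrow> transpose (P \<epsilon> x) = - P \<epsilon> x" and smooth_P: "\<epsilon> \<in> W \<Longrightarrow> smooth_on UNIV (P \<epsilon>)"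
  using poisson by (auto simp: poisson_structure_def)

lemma F_components:
  assumes "\<epsilon> \<in> W" "x \<in> N"
  shows "F (\<epsilon>, x) = bivector_vec (J\<psi> (\<epsilon>, x) ** P \<epsilon> x ** transpose (J\<psi> (\<epsilon>, x)))"
proof -
  have "J\<psi> (\<epsilon>, x) ** P \<epsilon> x ** transpose (J\<psi> (\<epsilon>, x)) =
    H \<epsilon> (\<Psi> \<epsilon> x) *\<^sub>R bivector (\<Psi> \<epsilon> x $ 3) (of_int s * \<Psi> \<epsilon> x $ 1) ((\<Psi> \<epsilon> x $ 2)\<^sup>2 + h \<epsilon>) + R \<epsilon> (\<Psi> \<epsilon> x)"
    using coords[OF assms(1)] assms(2) by (simp add: in_coordinates_def jacobian_\<Psi>[OF assms])
  then show ?thesis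
    by (simp add: vec_eq_iff forall_3 F_def B_nth K_def \<psi>_def H'_def R'_def \<sigma>_def bivector_def skew3_def)
qed

text \<open>
  This expresses the bivector field in the original coordinates by \<open>F\<close> and so relates their zeros and linear parts.
\<close>

lemma F_adjugate:
  assumes "\<epsilon> \<in> W" "x \<in> N"
  shows "(\<Sum>i\<in>UNIV. F (\<epsilon>, x) $ i *\<^sub>R J\<psi> (\<epsilon>, x) $ i) = det (J\<psi> (\<epsilon>, x)) *\<^sub>R bivector_vec (P \<epsilon> x)"
  unfolding F_components[OF assms] sum_3 bivector_vec_nth
  by (rule adjugate_bivector_of) (simp add: bivector_of_vec[OF skew[OF assms(1)]])

lemma F_eq_0_iff:
  assumes "\<epsilon> \<in> W" "x \<in> N"
  shows "F (\<epsilon>, x) = 0 \<longleftrightarrow> P \<epsilon> x = 0"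
proof
  assume "F (\<epsilon>, x) = 0"
  then have "bivector_vec (P \<epsilon> x) = 0"
    using F_adjugate[OF assms] det_jacobian_\<psi>[of "(\<epsilon>, x)"] assms by simp
  then show "P \<epsilon> x = 0"
    using bivector_of_vec[OF skew[OF assms(1)], of x] by simp
next
  assume "P \<epsilon> x = 0"
  then show "F (\<epsilon>, x) = 0"
    using linear_0[OF bounded_linear.linear[OF linear_conjugation]] by (simp add: F_components[OF assms])
qed

text \<open>
  Differentiate \<open>F_adjugate\<close>: at a zero the derivatives of the Jacobian matrix drop out.
\<close>

lemma linear_part_at_zero:
  assumes "\<epsilon> \<in> W" "x \<in> N" and F0: "F (\<epsilon>, x) = 0"
  shows "dir_deriv v (P \<epsilon>) x =
    bivector_of (((1 / det (J\<psi> (\<epsilon>, x))) *\<^sub>R (transpose (J\<psi> (\<epsilon>, x)) ** JF (\<epsilon>, x))) *v v)"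
proof -
  note z = \<open>\<epsilon> \<in> W\<close> \<open>x \<in> N\<close>
  have zz: "(\<epsilon>, x) \<in> W \<times> N" using z by simp
  have P0: "P \<epsilon> x = 0" using F_eq_0_iff[OF z] F0 by simp
  let ?J = "\<lambda>x. J\<psi> (\<epsilon>, x)"
  have slice: "(\<lambda>x. f (\<epsilon>, x)) differentiable (at x)" if "smooth_on (W \<times> N) f" for f :: "_ \<Rightarrow> 'b::real_normed_vector"
    using smooth_on_differentiable[OF smooth_on_slice(1)[OF WNM(1,3) that z(1)] z(2)] .
  have dF: "((\<lambda>x. F (\<epsilon>, x) $ i) has_derivative (\<lambda>v. (JF (\<epsilon>, x) *v v) $ i)) (at x)" for i
  proof -
    have "((\<lambda>x. F (\<epsilon>, x)) has_derivative (\<lambda>v. JF (\<epsilon>, x) *v v)) (at x)"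
      using smooth_on_has_derivative[OF smooth_on_slice(1)[OF WNM(1,3) smooth_F z(1)] z(2)]
        smooth_on_slice(2)[OF WNM(1,3) smooth_F z]
      by (simp add: space_jacobian_vector[OF smooth_F zz])
    then show ?thesis by (rule bounded_linear.has_derivative[OF bounded_linear_vec_nth])
  qed
  have "smooth_on (W \<times> N) (\<lambda>z. J\<psi> z $ i)" for i
    by (intro smooth_on_vec_lambda smooth_on_space_jacobian WNM \<psi>)
  then have "\<exists>D. ((\<lambda>x. ?J x $ i) has_derivative D) (at x)" for i
    using slice unfolding differentiable_def by blast
  then obtain DJ where DJ: "\<And>i. ((\<lambda>x. ?J x $ i) has_derivative DJ i) (at x)" by metis
  have "\<exists>D. ((\<lambda>x. det (?J x)) has_derivative D) (at x)"
    using slice[OF smooth_on_det[OF WNM(5) smooth_on_space_jacobian[OF WNM(5) \<psi>(1)]]]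
    unfolding differentiable_def by blast
  then obtain Dd where Dd: "((\<lambda>x. det (?J x)) has_derivative Dd) (at x)" by blast
  have dP: "(P \<epsilon> has_derivative (\<lambda>v. dir_deriv v (P \<epsilon>) x)) (at x)"
    by (rule smooth_on_has_derivative[OF smooth_P[OF z(1)] UNIV_I])
  have "((\<lambda>x. \<Sum>i\<in>UNIV. F (\<epsilon>, x) $ i *\<^sub>R ?J x $ i) has_derivative
      (\<lambda>v. \<Sum>i\<in>UNIV. F (\<epsilon>, x) $ i *\<^sub>R DJ i v + (JF (\<epsilon>, x) *v v) $ i *\<^sub>R ?J x $ i)) (at x)"
    by (intro has_derivative_sum bounded_bilinear.FDERIV[OF bounded_bilinear_scaleR] dF DJ)
  moreover have "((\<lambda>x. det (?J x) *\<^sub>R bivector_vec (P \<epsilon> x)) has_derivative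
      (\<lambda>v. det (?J x) *\<^sub>R bivector_vec (dir_deriv v (P \<epsilon>) x) + Dd v *\<^sub>R bivector_vec (P \<epsilon> x))) (at x)"
    by (intro bounded_bilinear.FDERIV[OF bounded_bilinear_scaleR] Dd
        bounded_linear.has_derivative[OF bounded_linear_bivector_vec dP])
  then have "((\<lambda>x. \<Sum>i\<in>UNIV. F (\<epsilon>, x) $ i *\<^sub>R ?J x $ i) has_derivative
      (\<lambda>v. det (?J x) *\<^sub>R bivector_vec (dir_deriv v (P \<epsilon>) x) + Dd v *\<^sub>R bivector_vec (P \<epsilon> x))) (at x)"
    by (rule has_derivative_transform_within_open[OF _ WNM(3) z(2)]) (simp add: F_adjugate[OF z(1)])
  ultimately have "(\<Sum>i\<in>UNIV. F (\<epsilon>, x) $ i *\<^sub>R DJ i v + (JF (\<epsilon>, x) *v v) $ i *\<^sub>R ?J x $ i) =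
      det (?J x) *\<^sub>R bivector_vec (dir_deriv v (P \<epsilon>) x) + Dd v *\<^sub>R bivector_vec (P \<epsilon> x)"
    using has_derivative_unique by (metis (no_types, lifting))
  then have "(\<Sum>i\<in>UNIV. (JF (\<epsilon>, x) *v v) $ i *\<^sub>R ?J x $ i) = det (?J x) *\<^sub>R bivector_vec (dir_deriv v (P \<epsilon>) x)"
    by (simp add: F0 P0)
  moreover have "(\<Sum>i\<in>UNIV. (JF (\<epsilon>, x) *v v) $ i *\<^sub>R ?J x $ i) = (transpose (?J x) ** JF (\<epsilon>, x)) *v v"
  proof -
    have rows: "(\<Sum>i\<in>UNIV. y $ i *\<^sub>R ?J x $ i) = transpose (?J x) *v y" for y
      by (simp add: vec_eq_iff matrix_vector_mult_def transpose_def mult.commute)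
    show ?thesis by (simp only: rows matrix_vector_mul_assoc)
  qed
  ultimately have *: "bivector_vec (dir_deriv v (P \<epsilon>) x) =
      ((1 / det (?J x)) *\<^sub>R (transpose (?J x) ** JF (\<epsilon>, x))) *v v"
    using det_jacobian_\<psi>[OF zz] by (simp add: scaleR_matrix_vector_assoc[symmetric])
  have "dir_deriv v (P \<epsilon>) x = bivector_of (bivector_vec (dir_deriv v (P \<epsilon>) x))"
  proof -
    have bl: "bounded_linear (\<lambda>A. bivector_of (bivector_vec A))"
      by (rule bounded_linear_compose[OF bounded_linear_bivector_of bounded_linear_bivector_vec])
    have "P \<epsilon> = (\<lambda>x. bivector_of (bivector_vec (P \<epsilon> x)))"
      by (simp add: fun_eq_iff bivector_of_vec[OF skew[OF z(1)]])
    then show ?thesis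
      using smooth_on_bounded_linear_comp(2)[OF open_UNIV bl smooth_P[OF z(1)] UNIV_I, of v x] by simp
  qed
  then show ?thesis by (simp add: *)
qed

text \<open>
  At a zero, \<open>T w w'\<close> is \<open>det J\<close> times the bilinear form of the linear part of the Poisson structure. In contrast to this form it is
  defined, and continuous, at all points.
\<close>

definition "T w w' z = dir_deriv (0, w) \<psi> z \<bullet> dir_deriv (0, w') F z"

text \<open>
  On the span of \<open>w1\<close> and \<open>w2\<close> the bilinear form has the signature prescribed by \<open>\<sigma>\<close>, up to the sign of \<open>det J\<close>. Orthogonalising \<open>w2\<close>
  against \<open>w1\<close> gives the pair of vectors required by \<open>singularity_type_of_linear_part\<close>.
\<close>

lemma singularity_type_at_zero:
  assumes z: "\<epsilon> \<in> W" "x \<in> N" and F0: "F (\<epsilon>, x) = 0" and d: "det (JF (\<epsilon>, x)) \<noteq> 0"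
    and T11: "T w1 w1 (\<epsilon>, x) > 0"
    and disc: "\<sigma> * (T w1 w1 (\<epsilon>, x) * T w2 w2 (\<epsilon>, x) - T w1 w2 (\<epsilon>, x) * T w2 w1 (\<epsilon>, x)) > 0"
  shows "\<sigma> = 1 \<Longrightarrow> det (JF (\<epsilon>, x)) * det (J\<psi> (\<epsilon>, x)) > 0 \<Longrightarrow> so3_singularity_at (P \<epsilon>) x"
    and "\<sigma> = -1 \<or> det (JF (\<epsilon>, x)) * det (J\<psi> (\<epsilon>, x)) < 0 \<Longrightarrow> sl2_singularity_at (P \<epsilon>) x"
proof -
  have zz: "(\<epsilon>, x) \<in> W \<times> N" using z by simp
  define k where "k = det (J\<psi> (\<epsilon>, x))"
  define \<delta> where "\<delta> = det (JF (\<epsilon>, x))"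
  define L where "L = (1 / k) *\<^sub>R (transpose (J\<psi> (\<epsilon>, x)) ** JF (\<epsilon>, x))"
  have k: "k \<noteq> 0" using det_jacobian_\<psi>[OF zz] by (simp add: k_def)
  have lin: "dir_deriv v (P \<epsilon>) x = bivector_of (L *v v)" for v
    unfolding L_def k_def by (rule linear_part_at_zero[OF z F0])
  have P0: "P \<epsilon> x = 0" using F_eq_0_iff[OF z] F0 by simp
  have detL: "det L = \<delta> / k\<^sup>2"
    using k by (simp add: L_def det_scaleR_3 det_mul \<delta>_def power3_eq_cube power2_eq_square flip: k_def)
  then have detL0: "det L \<noteq> 0" using d k by (simp add: \<delta>_def)
  note sym = linear_part_symmetric[OF poisson[OF z(1)] P0 lin detL0]
  define t where "t w w' = T w w' (\<epsilon>, x)" for w w'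
  have t: "w \<bullet> (L *v w') = t w w' / k" for w w'
  proof -
    have "w \<bullet> (transpose (J\<psi> (\<epsilon>, x)) *v y) = (J\<psi> (\<epsilon>, x) *v w) \<bullet> y" for y
      using dot_lmul_matrix[of w "transpose (J\<psi> (\<epsilon>, x))" y] by simp
    moreover have "L *v w' = (1 / k) *\<^sub>R (transpose (J\<psi> (\<epsilon>, x)) *v (JF (\<epsilon>, x) *v w'))"
      by (simp add: L_def scaleR_matrix_vector_assoc[symmetric] matrix_vector_mul_assoc)
    ultimately show ?thesis
      by (simp add: t_def T_def space_jacobian_vector[OF \<psi>(1) zz] space_jacobian_vector[OF smooth_F zz])
  qed
  have t_sym: "t w2 w1 = t w1 w2"
  proof -
    have "w2 \<bullet> (L *v w1) = w1 \<bullet> (L *v w2)"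
      using dot_lmul_matrix[of w2 L w1] transpose_matrix_vector[of L w2] by (simp add: sym inner_commute)
    then show ?thesis using k by (simp add: t)
  qed
  define u where "u = w2 - (t w1 w2 / t w1 w1) *\<^sub>R w1"
  have t11: "t w1 w1 > 0" using T11 by (simp add: t_def)
  have Lu: "L *v u = L *v w2 - (t w1 w2 / t w1 w1) *\<^sub>R (L *v w1)"
    by (simp add: u_def matrix_vector_mult_diff_distrib matrix_vector_mult_scaleR)
  have w1u: "w1 \<bullet> (L *v u) = 0"
    using t11 k by (simp add: Lu inner_diff_right t)
  have uu: "u \<bullet> (L *v u) = (t w1 w1 * t w2 w2 - t w1 w2 * t w2 w1) / (t w1 w1 * k)"
  proof -
    have "u \<bullet> y = w2 \<bullet> y - (t w1 w2 / t w1 w1) * (w1 \<bullet> y)" for y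
      by (simp add: u_def inner_diff_left)
    then have "u \<bullet> (L *v u) = w2 \<bullet> (L *v u)"
      using w1u by simp
    also have "\<dots> = (t w2 w2 - (t w1 w2 / t w1 w1) * t w2 w1) / k"
      by (simp add: Lu inner_diff_right t diff_divide_distrib)
    finally show ?thesis using t11 k by (simp add: field_simps)
  qed
  define D where "D = t w1 w1 * t w2 w2 - t w1 w2 * t w2 w1"
  have disc': "\<sigma> * D > 0" using disc by (simp add: t_def D_def)
  then have D0: "D \<noteq> 0" by auto
  have n1: "det L * (w1 \<bullet> (L *v w1)) = (\<delta> * k) * (t w1 w1 / k ^ 4)"
    using k by (simp add: detL t field_simps power2_eq_square power4_eq_xxxx)
  have n2: "det L * (u \<bullet> (L *v u)) = (\<delta> * k) * (D / (t w1 w1 * k ^ 4))"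
    using k t11 by (simp add: detL uu D_def[symmetric] field_simps power2_eq_square power4_eq_xxxx)
  have k4: "k ^ 4 > 0" using k by simp
  have s1: "det L * (w1 \<bullet> (L *v w1)) > 0 \<longleftrightarrow> \<delta> * k > 0"
    unfolding n1 using t11 k4 by (simp add: zero_less_mult_iff[of "\<delta> * k"] zero_less_divide_iff divide_less_0_iff)
  have s2: "det L * (u \<bullet> (L *v u)) > 0 \<longleftrightarrow> \<delta> * k * D > 0"
  proof -
    have "det L * (u \<bullet> (L *v u)) = (\<delta> * k * D) * (1 / (t w1 w1 * k ^ 4))" unfolding n2 by simp
    moreover have "1 / (t w1 w1 * k ^ 4) > 0" using t11 k4 by simp
    ultimately show ?thesis by (metis mult_pos_pos zero_less_mult_pos2)
  qed
  note type = singularity_type_of_linear_part[OF poisson[OF z(1)] P0 lin detL0 w1u]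
  have "w1 \<bullet> (L *v w1) \<noteq> 0" using t11 k by (simp add: t)
  moreover have "u \<bullet> (L *v u) \<noteq> 0" unfolding uu D_def[symmetric] using t11 k D0 by simp
  ultimately have nz: "w1 \<bullet> (L *v w1) \<noteq> 0" "u \<bullet> (L *v u) \<noteq> 0" .
  show "so3_singularity_at (P \<epsilon>) x" if "\<sigma> = 1" "det (JF (\<epsilon>, x)) * det (J\<psi> (\<epsilon>, x)) > 0"
    by (rule type(1)[OF nz]) (use that disc' in \<open>simp_all add: s1 s2 \<delta>_def k_def\<close>)
  show "sl2_singularity_at (P \<epsilon>) x" if "\<sigma> = -1 \<or> det (JF (\<epsilon>, x)) * det (J\<psi> (\<epsilon>, x)) < 0"
  proof (rule type(2)[OF nz])
    have "\<not> (\<delta> * k > 0 \<and> \<delta> * k * D > 0)"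
      using that disc' by (auto simp: \<delta>_def k_def zero_less_mult_iff mult_less_0_iff)
    then show "\<not> (det L * (w1 \<bullet> (L *v w1)) > 0 \<and> det L * (u \<bullet> (L *v u)) > 0)"
      unfolding s1 s2 .
  qed
qed

text \<open>
  The fold is applied on a neighbourhood \<open>\<Omega>\<close> on which the sign conditions of \<open>singularity_type_at_zero\<close> persist. They hold at the origin
  for the preimages \<open>w1\<close>, \<open>w2\<close> of the third and first axis, while the preimage \<open>v\<close> of the second axis spans the kernel.
\<close>

lemma bifurcation:
  obtains \<tau> U W' where "\<tau> \<in> {1, -1}" "open U" "0 \<in> U" "open W'" "0 \<in> W'" "W' \<subseteq> W"
    "\<And>\<epsilon>. \<epsilon> \<in> W' \<Longrightarrow> \<tau> * \<epsilon> < 0 \<Longrightarrow> {x\<in>U. P \<epsilon> x = 0} = {}"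
    "\<And>\<epsilon>. \<epsilon> \<in> W' \<Longrightarrow> \<tau> * \<epsilon> > 0 \<Longrightarrow> \<exists>p q. p \<noteq> q \<and> {x\<in>U. P \<epsilon> x = 0} = {p, q} \<and>
       (s = 1 \<longrightarrow> so3_singularity_at (P \<epsilon>) p \<and> sl2_singularity_at (P \<epsilon>) q) \<and>
       (s = -1 \<longrightarrow> sl2_singularity_at (P \<epsilon>) p \<and> sl2_singularity_at (P \<epsilon>) q)"
proof -
  have \<sigma>0: "\<sigma> \<noteq> 0" "\<sigma> * \<sigma> = 1" using s by (auto simp: \<sigma>_def)
  have H0: "H 0 0 > 0" by (rule H(2))
  define J0 where "J0 = J\<psi> (0, 0)"
  have detJ0: "det J0 \<noteq> 0" unfolding J0_def by (rule det_jacobian_\<psi>[OF WNM(7)])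
  then obtain J' where J': "J' ** J0 = mat 1" "J0 ** J' = mat 1"
    by (auto simp: invertible_det_nz[symmetric] invertible_def)
  have J0J': "J0 *v (J' *v y) = y" "J' *v (J0 *v y) = y" for y
    by (simp_all add: matrix_vector_mul_assoc J')
  have d\<psi>: "dir_deriv (0, x) \<psi> (0, 0) = J0 *v x" for x
    unfolding J0_def by (rule space_jacobian_vector[OF \<psi>(1) WNM(7), symmetric])
  define v where "v = J' *v axis 2 1"
  have v0: "v \<noteq> 0"
    using J0J'(1)[of "axis 2 1"] by (auto simp: v_def axis_eq_0_iff)
  have F0: "F (0, 0) = 0"
    by (simp add: F_def K(3) vec_eq_iff forall_3 B_nth R'_0 h(2))
  have dF0: "dir_deriv (e, x) F (0, 0) = dir_deriv (e, dir_deriv (e, x) \<psi> (0, 0)) B (0, 0)" for e x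
    using dir_deriv_F[OF WNM(7)] by (simp add: K(3))
  have dFv: "dir_deriv (0, v) F (0, 0) = 0"
    by (simp add: dF0 dir_deriv_B_0 d\<psi> v_def J0J' vec_eq_iff forall_3 axis_def)
  have ker: "e = 0 \<and> (\<exists>c. x = c *\<^sub>R v)" if "dir_deriv (e, x) F (0, 0) = 0" for e x
  proof -
    have e: "e = 0" using that H0 h(3) by (simp add: dF0 dir_deriv_B_0 vec_eq_iff forall_3)
    then have "(J0 *v x) $ 1 = 0" "(J0 *v x) $ 3 = 0"
      using that H0 \<sigma>0 by (simp_all add: dF0 dir_deriv_B_0 vec_eq_iff forall_3 d\<psi>)
    then have "J0 *v x = (J0 *v x) $ 2 *\<^sub>R axis 2 1"
      by (simp add: vec_eq_iff forall_3 axis_def)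
    then have "x = (J0 *v x) $ 2 *\<^sub>R v"
      unfolding v_def using J0J'(2)[of x] by (metis matrix_vector_mult_scaleR)
    with e show ?thesis by blast
  qed
  define \<mu> where "\<mu> z = det (space_jacobian B z)" for z
  have sm\<mu>: "smooth_on (W \<times> M) \<mu>" unfolding \<mu>_def
    by (intro smooth_on_det smooth_on_space_jacobian WNM smooth_B)
  have d\<mu>: "dir_deriv (0, axis 2 1) \<mu> (0, 0) = (H 0 0 * \<sigma>) * H 0 0 * (2 * H 0 0)"
    using DERIV_unique[OF smooth_line_derivative_0[OF sm\<mu> M0(2)] det_space_jacobian_B[folded \<mu>_def]] .
  have \<mu>0: "\<mu> (0, 0) = 0"
    by (simp add: \<mu>_def det_3 space_jacobian_B_0)
  define j where "j z = det (J\<psi> z)" for z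
  have j0: "j (0, 0) = det J0" by (simp add: j_def J0_def)
  have smj: "smooth_on (W \<times> N) j" unfolding j_def
    by (intro smooth_on_det smooth_on_space_jacobian WNM \<psi>)
  have smF: "smooth_on (W \<times> N) (\<lambda>z. det (JF z))"
    by (intro smooth_on_det smooth_on_space_jacobian WNM smooth_F)
  have "dir_deriv (0, v) (\<lambda>z. det (JF z)) (0, 0) = (H 0 0 * \<sigma>) * H 0 0 * (2 * H 0 0) * det J0"
  proof (rule dir_deriv_eq[THEN trans])
    have "(\<mu> has_derivative (\<lambda>w. dir_deriv w \<mu> (0, 0))) (at (K (0, 0)))"
      using smooth_on_has_derivative[OF sm\<mu> M0(2)] by (simp add: K(3))
    from has_derivative_compose[OF smooth_on_has_derivative[OF K(1) WNM(7)] this]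
    have "((\<lambda>z. \<mu> (K z)) has_derivative (\<lambda>w. dir_deriv (dir_deriv w K (0, 0)) \<mu> (0, 0))) (at (0, 0))" .
    from has_derivative_mult[OF this smooth_on_has_derivative[OF smj WNM(7)]]
    show "((\<lambda>z. det (JF z)) has_derivative (\<lambda>w. \<mu> (K (0, 0)) * dir_deriv w j (0, 0)
        + dir_deriv (dir_deriv w K (0, 0)) \<mu> (0, 0) * j (0, 0))) (at (0, 0))"
      by (rule has_derivative_transform_within_open[OF _ WNM(5,7)]) (simp add: jacobian_F det_mul \<mu>_def j_def)
  qed (simp add: K(3) K(4)[OF WNM(7)] \<mu>0 d\<psi> v_def J0J' d\<mu> j0)
  then have fold: "((\<lambda>t. det (JF (0, t *\<^sub>R v))) has_real_derivative (H 0 0 * \<sigma>) * H 0 0 * (2 * H 0 0) * det J0) (at 0)"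
    using smooth_line_derivative_0[OF smF WNM(7), of v] by simp
  have fold0: "(H 0 0 * \<sigma>) * H 0 0 * (2 * H 0 0) * det J0 \<noteq> 0"
    using H0 \<sigma>0 detJ0 by simp
  define w1 where "w1 = J' *v axis 3 1"
  define w2 where "w2 = J' *v axis 1 1"
  define f where "f z = \<sigma> * (T w1 w1 z * T w2 w2 z - T w1 w2 z * T w2 w1 z)" for z
  have T0: "T w w' (0, 0) = (J0 *v w) \<bullet> vector [H 0 0 * (\<sigma> * (J0 *v w') $ 1), 0, H 0 0 * (J0 *v w') $ 3]" for w w'
    by (simp add: T_def dF0 d\<psi> dir_deriv_B_0)
  have init: "T w1 w1 (0, 0) > 0" "f (0, 0) > 0" "j (0, 0) * det J0 > 0"
  proof -
    show "T w1 w1 (0, 0) > 0"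
      using H0 by (simp add: T0 w1_def J0J' axis_def inner_vec_def sum_3)
    have "f (0, 0) = (\<sigma> * \<sigma>) * (H 0 0 * H 0 0)"
      by (simp add: f_def T0 w1_def w2_def J0J' axis_def inner_vec_def sum_3)
    then show "f (0, 0) > 0" using H0 \<sigma>0(2) by simp
    show "j (0, 0) * det J0 > 0"
      unfolding j0 using detJ0 by (metis not_real_square_gt_zero)
  qed
  have contT: "continuous_on (W \<times> N) (T w w')" for w w'
    unfolding T_def by (intro continuous_on_inner smooth_on_continuous smooth_on_dir_deriv \<psi> smooth_F)
  have contf: "continuous_on (W \<times> N) f"
    unfolding f_def by (intro continuous_intros contT)
  have contj: "continuous_on (W \<times> N) (\<lambda>z. j z * det J0)"
    by (intro continuous_intros smooth_on_continuous smj)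
  define \<Omega> where "\<Omega> = (W \<times> N \<inter> T w1 w1 -` {0<..}) \<inter> (W \<times> N \<inter> f -` {0<..}) \<inter> (W \<times> N \<inter> (\<lambda>z. j z * det J0) -` {0<..})"
  have \<Omega>: "open \<Omega>" "(0, 0) \<in> \<Omega>" "\<Omega> \<subseteq> W \<times> N"
  proof -
    show "open \<Omega>" unfolding \<Omega>_def
      by (intro open_Int continuous_open_preimage contT contf contj WNM open_greaterThan)
    show "(0, 0) \<in> \<Omega>" "\<Omega> \<subseteq> W \<times> N" using init WNM by (auto simp: \<Omega>_def)
  qed
  obtain \<tau> U W' where \<tau>: "\<tau> \<in> {1, -1}" and U: "open U" "0 \<in> U" and W': "open W'" "0 \<in> W'"
    and WU: "W' \<times> U \<subseteq> \<Omega>" and none: "\<And>\<epsilon>. \<epsilon> \<in> W' \<Longrightarrow> \<tau> * \<epsilon> < 0 \<Longrightarrow> {x\<in>U. F (\<epsilon>, x) = 0} = {}"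
    and two: "\<And>\<epsilon>. \<epsilon> \<in> W' \<Longrightarrow> \<tau> * \<epsilon> > 0 \<Longrightarrow> \<exists>p q. p \<noteq> q \<and> {x\<in>U. F (\<epsilon>, x) = 0} = {p, q} \<and>
       det (JF (\<epsilon>, p)) > 0 \<and> det (JF (\<epsilon>, q)) < 0"
    by (rule fold_bifurcation[OF \<Omega>(1,2) smooth_on_subset[OF smooth_F \<Omega>(1,3)] F0 v0 dFv ker fold fold0])
      (assumption, rule that)
  have WU_sub: "\<epsilon> \<in> W" "x \<in> N" if "\<epsilon> \<in> W'" "x \<in> U" for \<epsilon> x using WU \<Omega>(3) that by auto
  have zeros: "{x\<in>U. P \<epsilon> x = 0} = {x\<in>U. F (\<epsilon>, x) = 0}" if "\<epsilon> \<in> W'" for \<epsilon>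
    using F_eq_0_iff WU_sub that by blast
  have W'W: "W' \<subseteq> W" using WU_sub(1) U(2) by blast
  have types: "so3_singularity_at (P \<epsilon>) x" if "s = 1" "\<epsilon> \<in> W'" "x \<in> U" "F (\<epsilon>, x) = 0" "det (JF (\<epsilon>, x)) * det J0 > 0" for \<epsilon> x
  proof -
    have "(\<epsilon>, x) \<in> \<Omega>" using that WU by auto
    then have *: "T w1 w1 (\<epsilon>, x) > 0" "f (\<epsilon>, x) > 0" "j (\<epsilon>, x) * det J0 > 0" by (auto simp: \<Omega>_def)
    have "det (JF (\<epsilon>, x)) \<noteq> 0" "det (JF (\<epsilon>, x)) * det (J\<psi> (\<epsilon>, x)) > 0"
      using that(5) *(3) by (auto simp: zero_less_mult_iff j_def)
    moreover have "\<sigma> = 1" unfolding \<sigma>_def using that(1) by simp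
    ultimately show ?thesis
      using * singularity_type_at_zero(1)[OF WU_sub[OF that(2,3)] that(4), of w1 w2] by (simp add: f_def)
  qed
  have types': "sl2_singularity_at (P \<epsilon>) x" if "\<epsilon> \<in> W'" "x \<in> U" "F (\<epsilon>, x) = 0" "det (JF (\<epsilon>, x)) \<noteq> 0"
    "s = -1 \<or> det (JF (\<epsilon>, x)) * det J0 < 0" for \<epsilon> x
  proof -
    have "(\<epsilon>, x) \<in> \<Omega>" using that WU by auto
    then have *: "T w1 w1 (\<epsilon>, x) > 0" "f (\<epsilon>, x) > 0" "j (\<epsilon>, x) * det J0 > 0" by (auto simp: \<Omega>_def)
    have "\<sigma> = -1 \<or> det (JF (\<epsilon>, x)) * det (J\<psi> (\<epsilon>, x)) < 0"
      using that(5) *(3) by (auto simp: zero_less_mult_iff mult_less_0_iff j_def \<sigma>_def)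
    with * that(4) show ?thesis
      using singularity_type_at_zero(2)[OF WU_sub[OF that(1,2)] that(3), of w1 w2] by (simp add: f_def)
  qed
  have main: "\<exists>p q. p \<noteq> q \<and> {x\<in>U. P \<epsilon> x = 0} = {p, q} \<and>
         (s = 1 \<longrightarrow> so3_singularity_at (P \<epsilon>) p \<and> sl2_singularity_at (P \<epsilon>) q) \<and>
         (s = -1 \<longrightarrow> sl2_singularity_at (P \<epsilon>) p \<and> sl2_singularity_at (P \<epsilon>) q)"
    if \<epsilon>: "\<epsilon> \<in> W'" "\<tau> * \<epsilon> > 0" for \<epsilon>
  proof -
    from two[OF \<epsilon>]
    obtain p q where pq: "p \<noteq> q" "{x\<in>U. F (\<epsilon>, x) = 0} = {p, q}" "det (JF (\<epsilon>, p)) > 0" "det (JF (\<epsilon>, q)) < 0"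
      by (elim exE conjE) (rule that)
    then have in_U: "p \<in> U" "q \<in> U" "F (\<epsilon>, p) = 0" "F (\<epsilon>, q) = 0" by blast+
    show ?thesis
    proof (cases "det J0 > 0")
      case True
      then have "det (JF (\<epsilon>, p)) * det J0 > 0" "det (JF (\<epsilon>, q)) * det J0 < 0"
        using pq by (auto simp: mult_less_0_iff)
      then show ?thesis
        using types[OF _ \<epsilon>(1) in_U(1,3)] types'[OF \<epsilon>(1) in_U(1,3)] types'[OF \<epsilon>(1) in_U(2,4)] pq zeros[OF \<epsilon>(1)]
        by (intro exI[of _ p] exI[of _ q]) auto
    next
      case False
      with detJ0 have "det J0 < 0" by simp
      then have "det (JF (\<epsilon>, q)) * det J0 > 0" "det (JF (\<epsilon>, p)) * det J0 < 0"
        using pq by (auto simp: mult_less_0_iff zero_less_mult_iff)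
      then show ?thesis
        using types[OF _ \<epsilon>(1) in_U(2,4)] types'[OF \<epsilon>(1) in_U(1,3)] types'[OF \<epsilon>(1) in_U(2,4)] pq zeros[OF \<epsilon>(1)]
        by (intro exI[of _ q] exI[of _ p]) auto
    qed
  qed
  have empty: "{x\<in>U. P \<epsilon> x = 0} = {}" if "\<epsilon> \<in> W'" "\<tau> * \<epsilon> < 0" for \<epsilon>
    using none[OF that] zeros[OF that(1)] by simp
  show thesis by (rule that[OF \<tau> U W' W'W empty main])
qed

end

lemma coordinate_family_subset:
  "coordinate_family W N \<psi> \<Longrightarrow> open W' \<Longrightarrow> 0 \<in> W' \<Longrightarrow> W' \<subseteq> W \<Longrightarrow> coordinate_family W' N \<psi>"
  unfolding coordinate_family_def
  by (auto intro: smooth_on_subset[where T = "W \<times> N"] open_Times)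

theorem theorem3p2:
  fixes P :: "real^3 \<Rightarrow> real^3^3"
    and P\<epsilon> :: "real \<Rightarrow> real^3 \<Rightarrow> real^3^3"
    and J :: "real set"
    and s :: int
  assumes "poisson_structure P"
    and "s = 1 \<or> s = -1"
    and "generic_A_singularity s P"
    and "smooth_unfolding J P\<epsilon>"
    and "P\<epsilon> 0 = P"
    and "generic_unfolding s P\<epsilon>"
  shows "\<exists>U W. open U \<and> 0 \<in> U \<and> open W \<and> 0 \<in> W \<and> W \<subseteq> J \<and>
    (\<exists>\<sigma>\<in>{1, -1}. \<forall>\<epsilon>\<in>W.
       (\<sigma> * \<epsilon> < 0 \<longrightarrow> {x\<in>U. singular_point (P\<epsilon> \<epsilon>) x} = {}) \<and>
       (\<sigma> * \<epsilon> > 0 \<longrightarrow>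
          (\<exists>p q. p \<noteq> q \<and> {x\<in>U. singular_point (P\<epsilon> \<epsilon>) x} = {p, q} \<and>
             (s = 1 \<longrightarrow> so3_singularity_at (P\<epsilon> \<epsilon>) p \<and> sl2_singularity_at (P\<epsilon> \<epsilon>) q) \<and>
             (s = -1 \<longrightarrow> sl2_singularity_at (P\<epsilon> \<epsilon>) p \<and> sl2_singularity_at (P\<epsilon> \<epsilon>) q))))"
proof -
  obtain h where h: "unfolding_normal_form s P\<epsilon> h" "deriv h 0 \<noteq> 0"
    using assms(6) by (auto simp: generic_unfolding_def)
  from h(1)[unfolded unfolding_normal_form_def] obtain W N M \<theta> p \<Psi> H R where nf:
    "coordinate_family W N \<theta>" "\<forall>\<epsilon>\<in>W. p \<epsilon> \<in> N \<and> \<theta> \<epsilon> (p \<epsilon>) = 0" "coordinate_family W N \<Psi>"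
    "open M" "\<forall>\<epsilon>\<in>W. \<Psi> \<epsilon> ` N \<subseteq> M" "smooth_on (W \<times> M) (\<lambda>(\<epsilon>, y). H \<epsilon> y)" "H 0 0 > (0::real)"
    "smooth_on W h" "h 0 = 0"
    "smooth_on (W \<times> M) (\<lambda>(\<epsilon>, y). R \<epsilon> y)" "\<forall>\<epsilon>\<in>W. flat_at (R \<epsilon>) (\<Psi> \<epsilon> (p \<epsilon>))"
    "\<forall>\<epsilon>\<in>W. in_coordinates N (\<Psi> \<epsilon>) (P\<epsilon> \<epsilon>)
           (\<lambda>y. H \<epsilon> y *\<^sub>R bivector (y $ 3) (of_int s * y $ 1) ((y $ 2)\<^sup>2 + h \<epsilon>) + R \<epsilon> y)"
    by (elim exE conjE) (rule that)
  have J: "open J" "0 \<in> J" "\<And>\<epsilon>. \<epsilon> \<in> J \<Longrightarrow> poisson_structure (P\<epsilon> \<epsilon>)"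
    using assms(4) by (auto simp: smooth_unfolding_def)
  have W: "open W" "0 \<in> W" using nf(1) by (auto simp: coordinate_family_def)
  let ?W = "W \<inter> J"
  have W': "open ?W" "0 \<in> ?W" "?W \<subseteq> W" using W J by auto
  have sub: "smooth_on (?W \<times> M) f" if "smooth_on (W \<times> M) f" for f :: "_ \<Rightarrow> 'b::real_normed_vector"
    using that W' nf(4) by (auto intro: smooth_on_subset[where T = "W \<times> M"] open_Times)
  interpret normalised_unfolding s P\<epsilon> h ?W N M \<theta> \<Psi> p H R
  proof
    show "coordinate_family ?W N \<theta>" "coordinate_family ?W N \<Psi>"
      using nf(1,3) W' by (auto intro: coordinate_family_subset)
    show "smooth_on ?W h" using nf(8) W' by (auto intro: smooth_on_subset)
    show "smooth_on (?W \<times> M) (\<lambda>(\<epsilon>, y). H \<epsilon> y)" "smooth_on (?W \<times> M) (\<lambda>(\<epsilon>, y). R \<epsilon> y)"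
      using nf sub by blast+
  qed (use assms(2) nf h(2) J in auto)
  show ?thesis
  proof (rule bifurcation)
    fix \<tau> :: real and U W''
    assume *: "\<tau> \<in> {1, -1}" "open U" "0 \<in> U" "open W''" "0 \<in> W''" "W'' \<subseteq> ?W"
      "\<And>\<epsilon>. \<epsilon> \<in> W'' \<Longrightarrow> \<tau> * \<epsilon> < 0 \<Longrightarrow> {x\<in>U. P\<epsilon> \<epsilon> x = 0} = {}"
      "\<And>\<epsilon>. \<epsilon> \<in> W'' \<Longrightarrow> \<tau> * \<epsilon> > 0 \<Longrightarrow> \<exists>p q. p \<noteq> q \<and> {x\<in>U. P\<epsilon> \<epsilon> x = 0} = {p, q} \<and>
         (s = 1 \<longrightarrow> so3_singularity_at (P\<epsilon> \<epsilon>) p \<and> sl2_singularity_at (P\<epsilon> \<epsilon>) q) \<and>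
         (s = -1 \<longrightarrow> sl2_singularity_at (P\<epsilon> \<epsilon>) p \<and> sl2_singularity_at (P\<epsilon> \<epsilon>) q)"
    show ?thesis
      unfolding singular_point_def
      by (intro exI[of _ U] exI[of _ W''] conjI bexI[OF _ *(1)] ballI impI *(2-5,7,8)) (use *(6) in blast)
  qed
qed

end
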